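(* Let $s,m,n\in\mathbb{Z}_+$, $s\ge1$, $m\ge 2s-1$, $\varkappa\ge0$, $\sigma>0$, $D_n=\{-n,\dots,n\}$, $\kappa_{m,n}=\sqrt{\frac{2n+1}{2m+1}}$. (i) Let $\widehat x_{\rm con}=\widehat\varphi_{\rm con}*y$, where $\widehat\varphi_{\rm con}$ is an optimal solution to $$\min_{\phi\in\mathbb{C}_m(\mathbb{Z})}\|y-\phi*y\|_{n,2}^2\quad\text{subject to}\quad\|F_m[\phi]\|_1\le\frac{\bar\varrho}{\sqrt{2m+1}}$$ with some $\bar\varrho\ge4s$. Then for any $\alpha\in(0,1/2]$ $$\mathrm{Risk}_{D_n,2,\alpha}(\widehat x_{\rm con}|\mathcal{X}_{m,n}(s,\varkappa))\le C\psi^\alpha_{m,n}(\sigma,s,\varkappa;\bar\varrho),$$ where $C$ is an absolute constant and $$\psi^\alpha_{m,n}(\sigma,s,\varkappa;\bar\varrho)=\sigma s\big(\kappa_{m,n}\sqrt{\log[1/\alpha]}+\varkappa\big)+\sigma\Big(\bar\varrho(\kappa_{m,n}^2+1)\log[(m+n)/\alpha]+\bar\varrho\,\varkappa\sqrt{\log[1/\alpha]}+s\Big)^{1/2}.$$ In particular, when moreover $\bar\varrho\le C's$ for some constant $C'\geq 4$, one has, with a constant $C$ depending only on $C'$, $$\mathrm{Risk}_{D_n,2,\alpha}(\widehat x_{\rm con}|\mathcal{X}_{m,n}(s,\varkappa))\le C\,\overline\psi^\alpha_{m,n}(\sigma,s,\varkappa),$$ $$\overline\psi^\alpha_{m,n}(\sigma,s,\varkappa)=\sigma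 s\big(\kappa_{m,n}\sqrt{\log[1/\alpha]}+\varkappa\big)+\sigma\Big(s(\kappa_{m,n}^2+1)\log[(m+n)/\alpha]+s\varkappa\sqrt{\log[1/\alpha]}+s\Big)^{1/2}.$$ (ii) Let $\alpha\in(0,1/2]$, $\lambda=Q_1^{1/2}$ with $Q_1=(\kappa_{m,n}^2+1)\log[(m+n)/\alpha]+\varkappa\sqrt{\log[1/\alpha]}+1$, and let $\widehat x_{\rm pen}=\widehat\varphi_{\rm pen}*y$, where $\widehat\varphi_{\rm pen}$ is an optimal solution to $$\min_{\phi\in\mathbb{C}_m(\mathbb{Z})}\|y-\phi*y\|_{n,2}^2+\sigma^2\lambda^2(2m+1)\|F_m[\phi]\|_1^2 .$$ Then, with an absolute constant $C$, $$\mathrm{Risk}_{D_n,2,\alpha}(\widehat x_{\rm pen}|\mathcal{X}_{m,n}(s,\varkappa))\le C\,\widetilde\psi^\alpha_{m,n}(\sigma,s,\varkappa),$$ $$\widetilde\psi^\alpha_{m,n}(\sigma,s,\varkappa)=\sigma s\big(\kappa_{m,n}\sqrt{\log[1/\alpha]}+\varkappa\big)+\sigma s(\kappa_{m,n}+1)\sqrt{\log[(m+n)/\alpha]} .$$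
   Context: $\mathbb{Z}_+$ is the set of nonnegative integers. $\mathbb{C}(\mathbb{Z})$ is the space of two-sided complex sequences; $\mathbb{C}_m(\mathbb{Z})$ is the subspace of sequences vanishing outside $\{-m,\dots,m\}$ (its elements are called filters). Convolution: $[\varphi*y]_t=\sum_{\tau\in\mathbb{Z}}\varphi_\tau y_{t-\tau}$. Shift: $[\Delta x]_t=x_{t-1}$, with inverse $\Delta^{-1}$. Semi-norm: $\|x\|_{n,2}=\big(\sum_{|\tau|\le n}|x_\tau|^2\big)^{1/2}$. The unitary DFT $F_m:\mathbb{C}_m(\mathbb{Z})\to\mathbb{C}^{2m+1}$ is $(F_m[x])_k=\frac{1}{\sqrt{2m+1}}\sum_{|\tau|\le m}\exp\big(-\frac{2\pi i k\tau}{2m+1}\big)x_\tau$, $1\le k\le 2m+1$, and $\|\cdot\|_1$ on $\mathbb{C}^{2m+1}$ is the $\ell_1$-norm. Observations: $y_\tau=x_\tau+\sigma\zeta_\tau$ for $|\tau|\le m+n$, where $x\in\mathbb{C}(\mathbb{Z})$ is a deterministic unknown signal and the $\zeta_\tau$ are i.i.d. standard complex Gaussian, i.e. $\zeta_\tau=\zeta_\tau^1+i\zeta_\tau^2$ with $\zeta^1_\tau,\zeta^2_\tau$ i.i.d. $\mathcal{N}(0,1)$. Class $\mathcal{X}_{m,n}(s,\varkappa)$: the set of $x\in\mathbb{C}(\mathbb{Z})$ admitting a decomposition $x=x^{\mathcal S}+\varepsilon$, where $x^{\mathcal S}\in\mathcal S$ for some (unknown, possibly depending on $x$) shift-invariant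 linear subspace $\mathcal S$ of $\mathbb{C}(\mathbb{Z})$ (i.e. $\Delta\mathcal S\subseteq\mathcal S$) with $\dim\mathcal S=s\le 2n+1$, and $\|\Delta^{-\tau}\varepsilon\|_{n,2}\le\varkappa\sigma$ for all $|\tau|\le m$. Integral $\alpha$-risk of an estimate $\widehat x$ over a class $\mathcal X$ on a finite set $D$: $$\mathrm{Risk}_{D,2,\alpha}(\widehat x|\mathcal X)=\inf\Big\{r:\ \sup_{x\in\mathcal X}\mathrm{Prob}\Big\{\Big(\sum_{t\in D}|[\widehat x-x]_t|^2\Big)^{1/2}\ge r\Big\}\le\alpha\Big\}.$$ *)

theory Defs
  imports "HOL-Probability.Probability" "HOL-Library.Function_Algebras"
begin

type_synonym signal = "int \<Rightarrow> complex"

definition window :: "nat \<Rightarrow> int set" where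
  "window n = {- int n..int n}"

definition filters :: "nat \<Rightarrow> signal set" where
  "filters m = {\<phi>. \<forall>\<tau>. \<tau> \<notin> window m \<longrightarrow> \<phi> \<tau> = 0}"

(* Used only with \<phi> in filters m, so that only finitely many terms are nonzero. *)
definition conv :: "signal \<Rightarrow> signal \<Rightarrow> signal" where
  "conv \<phi> y t = (\<Sum>\<^sub>\<infinity>\<tau>\<in>UNIV. \<phi> \<tau> * y (t - \<tau>))"

(* shift k is the k-th power of the unit delay Delta; Delta itself is shift 1. *)
definition shift :: "int \<Rightarrow> signal \<Rightarrow> signal" where
  "shift k x t = x (t - k)"

definition seminorm2 :: "nat \<Rightarrow> signal \<Rightarrow> real" where
  "seminorm2 n x = L2_set (\<lambda>\<tau>. cmod (x \<tau>)) (window n)"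

definition dft :: "nat \<Rightarrow> signal \<Rightarrow> nat \<Rightarrow> complex" where
  "dft m x k = complex_of_real (1 / sqrt (2 * real m + 1)) *
     (\<Sum>\<tau>\<in>window m.
        exp (- (2 * complex_of_real pi * \<i> * of_nat k * of_int \<tau> / (2 * of_nat m + 1))) * x \<tau>)"

definition dft_norm1 :: "nat \<Rightarrow> signal \<Rightarrow> real" where
  "dft_norm1 m x = (\<Sum>k = 1..2 * m + 1. cmod (dft m x k))"

interpretation cseq: vector_space "\<lambda>(c::complex) (x::signal) t. c * x t"
  by unfold_locales (auto simp: fun_eq_iff algebra_simps)

(* cseq.dim is 0 for infinite-dimensional spaces, so dim S = s forces finite dimension when s >= 1. *)
definition signal_class :: "nat \<Rightarrow> nat \<Rightarrow> nat \<Rightarrow> real \<Rightarrow> real \<Rightarrow> signal set" where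
  "signal_class m n s \<kappa> \<sigma> =
     {x. \<exists>S xS \<epsilon>. cseq.subspace S \<and> shift 1 ` S \<subseteq> S \<and> cseq.dim S = s \<and> s \<le> 2 * n + 1 \<and>
          xS \<in> S \<and> x = xS + \<epsilon> \<and>
          (\<forall>\<tau>\<in>window m. seminorm2 n (shift (- \<tau>) \<epsilon>) \<le> \<kappa> * \<sigma>)}"

(* Real and imaginary part are independent N(0,1), so the total variance is 2. *)
definition complex_gaussian :: "complex measure" where
  "complex_gaussian =
     distr (density lborel std_normal_density \<Otimes>\<^sub>M density lborel std_normal_density)
       borel (\<lambda>(a, b). Complex a b)"

(* Joint law of the i.i.d. noise. The risk depends on the noise only through this law,
   so the product space serves as the sample space. *)
definition noise :: "nat \<Rightarrow> signal measure" where
  "noise N = (\<Pi>\<^sub>M \<tau>\<in>window N. complex_gaussian)"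

(* Observed data carry no information outside the window: they are extensional functions there. *)
definition observations :: "nat \<Rightarrow> signal set" where
  "observations N = (\<Pi>\<^sub>E \<tau>\<in>window N. UNIV)"

definition observe :: "nat \<Rightarrow> real \<Rightarrow> signal \<Rightarrow> signal \<Rightarrow> signal" where
  "observe N \<sigma> x \<zeta> = (\<lambda>\<tau>\<in>window N. x \<tau> + complex_of_real \<sigma> * \<zeta> \<tau>)"

(* An estimate maps the data on window N to a signal. The extended reals give the usual
   conventions: the supremum over an empty class is 0, the infimum of an empty set is infinity. *)
definition risk ::
  "nat \<Rightarrow> real \<Rightarrow> int set \<Rightarrow> real \<Rightarrow> (signal \<Rightarrow> signal) \<Rightarrow> signal set \<Rightarrow> ereal" where
  "risk N \<sigma> D \<alpha> xhat X =
     Inf {ereal r | r.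
       (SUP x\<in>X. emeasure (noise N)
          {\<zeta> \<in> space (noise N).
             L2_set (\<lambda>t. cmod (xhat (observe N \<sigma> x \<zeta>) t - x t)) D \<ge> r}) \<le> ennreal \<alpha>}"

definition filter_estimate :: "(signal \<Rightarrow> signal) \<Rightarrow> signal \<Rightarrow> signal" where
  "filter_estimate \<phi>hat y = conv (\<phi>hat y) y"

(* The filter is an arbitrary selection of an optimal solution for each data vector. By strict
   convexity of the squared semi-norm, all optimal solutions give the same conv \<phi> y on
   window n, and this is continuous in the data; hence the events in risk are measurable
   without any condition on the selection. (The same holds for the penalized estimator.) *)
definition constrained_filter ::
  "nat \<Rightarrow> nat \<Rightarrow> real \<Rightarrow> (signal \<Rightarrow> signal) \<Rightarrow> bool" where
  "constrained_filter m n \<rho> \<phi>hat \<longleftrightarrow>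
     (\<forall>y\<in>observations (m + n).
        is_arg_min (\<lambda>\<phi>. (seminorm2 n (\<lambda>t. y t - conv \<phi> y t))\<^sup>2)
          (\<lambda>\<phi>. \<phi> \<in> filters m \<and> dft_norm1 m \<phi> \<le> \<rho> / sqrt (2 * real m + 1)) (\<phi>hat y))"

definition penalized_filter ::
  "nat \<Rightarrow> nat \<Rightarrow> real \<Rightarrow> real \<Rightarrow> (signal \<Rightarrow> signal) \<Rightarrow> bool" where
  "penalized_filter m n \<sigma> lam \<phi>hat \<longleftrightarrow>
     (\<forall>y\<in>observations (m + n).
        is_arg_min
          (\<lambda>\<phi>. (seminorm2 n (\<lambda>t. y t - conv \<phi> y t))\<^sup>2 +
                \<sigma>\<^sup>2 * lam\<^sup>2 * (2 * real m + 1) * (dft_norm1 m \<phi>)\<^sup>2)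
          (\<lambda>\<phi>. \<phi> \<in> filters m) (\<phi>hat y))"

(* Below, \<kappa> is the approximation level of signal_class, not the ratio kappa_mn. *)
definition kappa_mn :: "nat \<Rightarrow> nat \<Rightarrow> real" where
  "kappa_mn m n = sqrt ((2 * real n + 1) / (2 * real m + 1))"

definition psi :: "nat \<Rightarrow> nat \<Rightarrow> real \<Rightarrow> real \<Rightarrow> nat \<Rightarrow> real \<Rightarrow> real \<Rightarrow> real" where
  "psi m n \<alpha> \<sigma> s \<kappa> \<rho> =
     \<sigma> * real s * (kappa_mn m n * sqrt (ln (1 / \<alpha>)) + \<kappa>) +
     \<sigma> * sqrt (\<rho> * ((kappa_mn m n)\<^sup>2 + 1) * ln ((real m + real n) / \<alpha>)
               + \<rho> * \<kappa> * sqrt (ln (1 / \<alpha>)) + real s)"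

definition psi_bar :: "nat \<Rightarrow> nat \<Rightarrow> real \<Rightarrow> real \<Rightarrow> nat \<Rightarrow> real \<Rightarrow> real" where
  "psi_bar m n \<alpha> \<sigma> s \<kappa> =
     \<sigma> * real s * (kappa_mn m n * sqrt (ln (1 / \<alpha>)) + \<kappa>) +
     \<sigma> * sqrt (real s * ((kappa_mn m n)\<^sup>2 + 1) * ln ((real m + real n) / \<alpha>)
               + real s * \<kappa> * sqrt (ln (1 / \<alpha>)) + real s)"

definition psi_tilde :: "nat \<Rightarrow> nat \<Rightarrow> real \<Rightarrow> real \<Rightarrow> nat \<Rightarrow> real \<Rightarrow> real" where
  "psi_tilde m n \<alpha> \<sigma> s \<kappa> =
     \<sigma> * real s * (kappa_mn m n * sqrt (ln (1 / \<alpha>)) + \<kappa>) +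
     \<sigma> * real s * (kappa_mn m n + 1) * sqrt (ln ((real m + real n) / \<alpha>))"

definition Q1 :: "nat \<Rightarrow> nat \<Rightarrow> real \<Rightarrow> real \<Rightarrow> real" where
  "Q1 m n \<alpha> \<kappa> =
     ((kappa_mn m n)\<^sup>2 + 1) * ln ((real m + real n) / \<alpha>) + \<kappa> * sqrt (ln (1 / \<alpha>)) + 1"

end

theory Submission
  imports Defs
begin

text \<open>
  The rows of the orthogonal projection onto \<open>S\<close>, restricted to a window of about \<open>m / 2\<close> points, are
  filters reproducing \<open>S\<close>; one of them has squared norm at most \<open>2 s / (m + 1)\<close>, and its convolution
  with itself is an oracle \<open>\<phi>\<^sub>0\<close> whose spectral \<open>\<ell>\<^sub>1\<close> norm is at most \<open>4 s / sqrt (2 m + 1)\<close>.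

  Comparing the objective at the estimated filter with its value at \<open>\<phi>\<^sub>0\<close> bounds the squared loss by
  that of the oracle plus the cross terms \<open><\<zeta>, x - \<phi> * y>\<close> for both filters. Split \<open>\<zeta>\<close> by the projection
  \<open>\<Pi>\<close> onto \<open>S\<close> restricted to the window of size \<open>n\<close>. The part \<open>\<Pi> \<zeta>\<close> has norm of order \<open>sqrt s\<close> and is
  paired with the loss itself. The complementary part does not see \<open>S\<close>, which leaves Gaussian linear
  forms in \<open>\<epsilon>\<close> and, after expanding \<open>\<phi>\<close> in the Fourier basis, one quadratic form in the noise for each
  frequency. Such a form concentrates around its trace at the scale of its Frobenius norm
  \<open>sqrt ((2 n + 1) (2 m + 1))\<close>; its trace is not small, but the \<open>\<ell>\<^sub>1\<close> norm of the Dirichlet kernel bounds it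
  by \<open>2 n + 1\<close> times a logarithm, so that a single logarithm is lost in total.
\<close>


section \<open>Complex Gaussian integrals\<close>

text \<open>The obstacle is that the estimated filter depends on the noise, so the cross terms must
  be controlled on one event for all filters at once. Duality achieves this: over all filters of a
  given spectral l1 norm, the pairing is governed by a maximum over finitely many fixed modulations.
  The component of the signal in \<open>S\<close> may be arbitrarily large, so
  \<open>xS - conv \<phi> xS\<close> cannot be estimated and has to be annihilated exactly;
  shift-invariance makes this possible because it keeps the difference in \<open>S\<close>. The
  price is that a projection enters the quadratic forms and destroys their Toeplitz structure.
  Bounding its contribution to the trace by rank times operator norm would introduce another factor
  s, which is what the argument with the Dirichlet kernel avoids. All tail bounds come from one
  device: an exponential moment bounded by 2, then Markov's inequality. Where summands are
  dependent, convexity of exp replaces independence. The estimator does not know \<open>S\<close>: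
  projection and oracle occur in the analysis only.\<close>

lemma sets_complex_gaussian [measurable_cong, simp]: "sets complex_gaussian = sets borel"
  by (simp add: complex_gaussian_def)

lemma space_complex_gaussian [simp]: "space complex_gaussian = UNIV"
  by (simp add: complex_gaussian_def)

lemma measurable_complex_gaussian: "measurable M complex_gaussian = borel_measurable M"
  by (rule measurable_cong_sets) simp_all

lemma measurable_Complex [measurable]:
  "(\<lambda>(a, b). Complex a b) \<in> borel_measurable (density lborel std_normal_density \<Otimes>\<^sub>M density lborel std_normal_density)"
  unfolding Complex_eq split_beta by measurable

lemma prob_space_complex_gaussian: "prob_space complex_gaussian"
proof -
  interpret N: prob_space "density lborel std_normal_density"
    by (rule prob_space_normal_density) simp
  interpret NN: pair_prob_space "density lborel std_normal_density" "density lborel std_normal_density" ..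
  show ?thesis unfolding complex_gaussian_def by (rule NN.prob_space_distr) measurable
qed

lemma nn_integral_normal_density:
  assumes "0 < \<sigma>" shows "(\<integral>\<^sup>+x. ennreal (normal_density \<mu> \<sigma> x) \<partial>lborel) = 1"
proof -
  interpret prob_space "density lborel (normal_density \<mu> \<sigma>)"
    by (rule prob_space_normal_density) fact
  show ?thesis using emeasure_space_1 by (simp add: emeasure_density)
qed

lemma nn_integral_complex_gaussian_prod:
  fixes g h :: "real \<Rightarrow> ennreal"
  assumes [measurable]: "g \<in> borel_measurable borel" "h \<in> borel_measurable borel"
  shows "(\<integral>\<^sup>+z. g (Re z) * h (Im z) \<partial>complex_gaussian) =
    (\<integral>\<^sup>+x. g x \<partial>density lborel std_normal_density) * (\<integral>\<^sup>+x. h x \<partial>density lborel std_normal_density)"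
proof -
  interpret N: prob_space "density lborel std_normal_density"
    by (rule prob_space_normal_density) simp
  have "(\<integral>\<^sup>+z. g (Re z) * h (Im z) \<partial>complex_gaussian) =
    (\<integral>\<^sup>+p. g (fst p) * h (snd p) \<partial>(density lborel std_normal_density \<Otimes>\<^sub>M density lborel std_normal_density))"
    unfolding complex_gaussian_def
    by (subst nn_integral_distr) (auto simp: split_beta)
  also have "\<dots> = (\<integral>\<^sup>+x. \<integral>\<^sup>+y. g x * h y \<partial>density lborel std_normal_density \<partial>density lborel std_normal_density)"
    by (subst N.nn_integral_fst[symmetric]) auto
  finally show ?thesis by (simp add: nn_integral_cmult nn_integral_multc)
qed

lemma std_normal_mgf:
  "(\<integral>\<^sup>+x. ennreal (exp (b * x)) \<partial>density lborel std_normal_density) = ennreal (exp (b\<^sup>2 / 2))"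
proof -
  have "std_normal_density x * exp (b * x) = exp (b\<^sup>2 / 2) * normal_density b 1 x" for x
    by (simp add: normal_density_def field_simps power2_eq_square flip: exp_add)
  then have "(\<integral>\<^sup>+x. ennreal (exp (b * x)) \<partial>density lborel std_normal_density) =
     (\<integral>\<^sup>+x. ennreal (exp (b\<^sup>2 / 2)) * ennreal (normal_density b 1 x) \<partial>lborel)"
    by (simp add: nn_integral_density flip: ennreal_mult')
  then show ?thesis by (simp add: nn_integral_cmult nn_integral_normal_density)
qed

text \<open>Tilting by \<open>exp (a * x\<^sup>2)\<close> turns the standard normal density into the
  centred one of standard deviation \<tau> = 1 / sqrt (1 - 2 a), up to the factor \<tau>, which is
  the value of the integral.\<close>

lemma std_normal_mgf_square:
  assumes "a < 1 / 2"
  shows "(\<integral>\<^sup>+x. ennreal (exp (a * x\<^sup>2)) \<partial>density lborel std_normal_density) = ennreal (1 / sqrt (1 - 2 * a))"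
proof -
  define \<tau> where "\<tau> = 1 / sqrt (1 - 2 * a)"
  have \<tau>: "0 < \<tau>" "\<tau>\<^sup>2 = 1 / (1 - 2 * a)"
    using assms by (auto simp: \<tau>_def power_divide)
  have "std_normal_density x * exp (a * x\<^sup>2) = \<tau> * normal_density 0 \<tau> x" for x
  proof -
    have "exp (-x\<^sup>2 / 2) * exp (a * x\<^sup>2) = exp (- x\<^sup>2 / (2 * \<tau>\<^sup>2))"
      using assms by (simp add: \<tau>(2) algebra_simps diff_divide_distrib flip: exp_add)
    moreover have "sqrt (2 * pi * \<tau>\<^sup>2) = sqrt (2 * pi) * \<tau>"
      using \<tau>(1) by (simp add: real_sqrt_mult)
    ultimately show ?thesis using \<tau>(1)
      by (simp add: normal_density_def field_simps)
  qed
  then have "(\<integral>\<^sup>+x. ennreal (exp (a * x\<^sup>2)) \<partial>density lborel std_normal_density) =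
     (\<integral>\<^sup>+x. ennreal \<tau> * ennreal (normal_density 0 \<tau> x) \<partial>lborel)"
    using \<tau>(1) by (simp add: nn_integral_density flip: ennreal_mult')
  then show ?thesis using \<tau>(1) by (simp add: nn_integral_cmult nn_integral_normal_density \<tau>_def)
qed

lemma complex_gaussian_mgf:
  "(\<integral>\<^sup>+z. ennreal (exp (Re (cnj w * z))) \<partial>complex_gaussian) = ennreal (exp ((cmod w)\<^sup>2 / 2))"
proof -
  have "(\<integral>\<^sup>+z. ennreal (exp (Re (cnj w * z))) \<partial>complex_gaussian) =
    (\<integral>\<^sup>+z. ennreal (exp (Re w * Re z)) * ennreal (exp (Im w * Im z)) \<partial>complex_gaussian)"
    by (simp add: exp_add flip: ennreal_mult')
  also have "\<dots> = ennreal (exp ((Re w)\<^sup>2 / 2)) * ennreal (exp ((Im w)\<^sup>2 / 2))"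
    by (subst nn_integral_complex_gaussian_prod) (simp_all add: std_normal_mgf)
  finally show ?thesis
    by (simp add: cmod_power2 add_divide_distrib exp_add flip: ennreal_mult')
qed

text \<open>Real and imaginary part contribute one inverse square root each, so the root
  disappears.\<close>

lemma complex_gaussian_mgf_square:
  assumes "a < 1 / 2"
  shows "(\<integral>\<^sup>+z. ennreal (exp (a * (cmod z)\<^sup>2)) \<partial>complex_gaussian) = ennreal (1 / (1 - 2 * a))"
proof -
  have "(\<integral>\<^sup>+z. ennreal (exp (a * (cmod z)\<^sup>2)) \<partial>complex_gaussian) =
    (\<integral>\<^sup>+z. ennreal (exp (a * (Re z)\<^sup>2)) * ennreal (exp (a * (Im z)\<^sup>2)) \<partial>complex_gaussian)"
    by (simp add: exp_add cmod_power2 algebra_simps flip: ennreal_mult')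
  also have "\<dots> = ennreal (1 / sqrt (1 - 2 * a)) * ennreal (1 / sqrt (1 - 2 * a))"
    using assms by (subst nn_integral_complex_gaussian_prod) (simp_all add: std_normal_mgf_square)
  finally show ?thesis
    using assms by (simp flip: ennreal_mult')
qed

interpretation gprod: product_sigma_finite "\<lambda>_. complex_gaussian"
  using prob_space_complex_gaussian by (simp add: product_sigma_finite_def prob_space_imp_sigma_finite)

lemma prob_space_gprod: "prob_space (Pi\<^sub>M W (\<lambda>_. complex_gaussian))"
  by (rule prob_space_PiM) (rule prob_space_complex_gaussian)

lemma gprod_linear_mgf:
  assumes [simp]: "finite W"
  shows "(\<integral>\<^sup>+\<zeta>. ennreal (exp (Re (\<Sum>u\<in>W. cnj (c u) * \<zeta> u))) \<partial>Pi\<^sub>M W (\<lambda>_. complex_gaussian)) =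
    ennreal (exp ((\<Sum>u\<in>W. (cmod (c u))\<^sup>2) / 2))"
proof -
  have "(\<integral>\<^sup>+\<zeta>. ennreal (exp (Re (\<Sum>u\<in>W. cnj (c u) * \<zeta> u))) \<partial>Pi\<^sub>M W (\<lambda>_. complex_gaussian)) =
    (\<integral>\<^sup>+\<zeta>. (\<Prod>u\<in>W. ennreal (exp (Re (cnj (c u) * \<zeta> u)))) \<partial>Pi\<^sub>M W (\<lambda>_. complex_gaussian))"
    by (simp only: Re_sum exp_sum[OF assms]) (simp add: prod_ennreal)
  also have "\<dots> = (\<Prod>u\<in>W. ennreal (exp ((cmod (c u))\<^sup>2 / 2)))"
    by (subst gprod.product_nn_integral_prod) (simp_all add: complex_gaussian_mgf del: cnj.sel complex_cnj times_complex.sel)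
  finally show ?thesis
    by (simp add: prod_ennreal exp_sum sum_divide_distrib)
qed

lemma borel_measurable_cnj [measurable (raw)]:
  "f \<in> borel_measurable M \<Longrightarrow> (\<lambda>x. cnj (f x)) \<in> borel_measurable M"
  by (rule borel_measurable_continuous_on[where f=cnj]) (intro continuous_intros)

text \<open>The square in the exponent is linearized by an independent Gaussian \<open>g\<close>:
  \<open>exp (\<bar>w\<bar>\<^sup>2 / 2)\<close> is the mean of \<open>exp (Re (cnj w * g))\<close>.\<close>

lemma gprod_linear_square_mgf:
  assumes [simp]: "finite W" and a: "0 \<le> a" "2 * a * (\<Sum>u\<in>W. (cmod (c u))\<^sup>2) < 1"
  shows "(\<integral>\<^sup>+\<zeta>. ennreal (exp (a * (cmod (\<Sum>u\<in>W. c u * \<zeta> u))\<^sup>2)) \<partial>Pi\<^sub>M W (\<lambda>_. complex_gaussian)) =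
    ennreal (1 / (1 - 2 * a * (\<Sum>u\<in>W. (cmod (c u))\<^sup>2)))"
proof -
  interpret P: prob_space "Pi\<^sub>M W (\<lambda>_. complex_gaussian)" by (rule prob_space_gprod)
  interpret G: prob_space complex_gaussian by (rule prob_space_complex_gaussian)
  interpret PG: pair_sigma_finite "Pi\<^sub>M W (\<lambda>_. complex_gaussian)" complex_gaussian ..
  define b where "b = complex_of_real (sqrt (2 * a))"
  have b: "(cmod b)\<^sup>2 = 2 * a" using a by (simp add: b_def)
  let ?z = "\<lambda>\<zeta>. \<Sum>u\<in>W. c u * \<zeta> u"
  have "(\<integral>\<^sup>+\<zeta>. ennreal (exp (a * (cmod (?z \<zeta>))\<^sup>2)) \<partial>Pi\<^sub>M W (\<lambda>_. complex_gaussian)) =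
    (\<integral>\<^sup>+\<zeta>. \<integral>\<^sup>+g. ennreal (exp (Re (cnj (b * ?z \<zeta>) * g))) \<partial>complex_gaussian \<partial>Pi\<^sub>M W (\<lambda>_. complex_gaussian))"
    by (simp only: complex_gaussian_mgf norm_mult power_mult_distrib b) (simp add: mult.assoc)
  also have "\<dots> = (\<integral>\<^sup>+g. \<integral>\<^sup>+\<zeta>. ennreal (exp (Re (cnj (b * ?z \<zeta>) * g))) \<partial>Pi\<^sub>M W (\<lambda>_. complex_gaussian) \<partial>complex_gaussian)"
  proof (rule PG.Fubini'[symmetric])
    have [measurable]: "(\<lambda>x. snd x) \<in> borel_measurable (Pi\<^sub>M W (\<lambda>_. complex_gaussian) \<Otimes>\<^sub>M complex_gaussian)"
      using measurable_snd[of "Pi\<^sub>M W (\<lambda>_. complex_gaussian)" complex_gaussian]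
      unfolding measurable_complex_gaussian .
    have [measurable]: "(\<lambda>x. fst x u) \<in> borel_measurable (Pi\<^sub>M W (\<lambda>_. complex_gaussian) \<Otimes>\<^sub>M complex_gaussian)" if "u \<in> W" for u
      using measurable_compose[OF measurable_fst measurable_component_singleton[OF that, of "\<lambda>_. complex_gaussian"], of complex_gaussian]
      unfolding measurable_complex_gaussian .
    show "(\<lambda>(\<zeta>, g). ennreal (exp (Re (cnj (b * ?z \<zeta>) * g))))
        \<in> borel_measurable (Pi\<^sub>M W (\<lambda>_. complex_gaussian) \<Otimes>\<^sub>M complex_gaussian)"
      unfolding split_beta by measurable
  qed
  also have "\<dots> = (\<integral>\<^sup>+g. \<integral>\<^sup>+\<zeta>. ennreal (exp (Re (\<Sum>u\<in>W. cnj (g * cnj b * cnj (c u)) * \<zeta> u))) \<partial>Pi\<^sub>M W (\<lambda>_. complex_gaussian) \<partial>complex_gaussian)"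
  proof -
    \<comment> \<open>\<open>gprod_linear_mgf\<close> expects the noise unconjugated; conjugating
      the whole expression leaves its real part unchanged and moves the conjugation to the
      coefficients.\<close>
    have "Re (cnj (b * ?z \<zeta>) * g) = Re (\<Sum>u\<in>W. cnj (g * cnj b * cnj (c u)) * \<zeta> u)" for \<zeta> g
    proof -
      have "Re (cnj (b * ?z \<zeta>) * g) = Re (cnj (cnj (b * ?z \<zeta>) * g))" by (simp only: cnj.sel)
      also have "cnj (cnj (b * ?z \<zeta>) * g) = (\<Sum>u\<in>W. cnj (g * cnj b * cnj (c u)) * \<zeta> u)"
        by (simp add: sum_distrib_left sum_distrib_right mult_ac)
      finally show ?thesis .
    qed
    then show ?thesis by presburger
  qed
  also have "\<dots> = (\<integral>\<^sup>+g. ennreal (exp ((a * (\<Sum>u\<in>W. (cmod (c u))\<^sup>2)) * (cmod g)\<^sup>2)) \<partial>complex_gaussian)"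
    by (simp only: gprod_linear_mgf[OF assms(1)] norm_mult power_mult_distrib complex_mod_cnj b)
       (simp add: sum_distrib_left sum_distrib_right sum_divide_distrib mult_ac)
  also have "\<dots> = ennreal (1 / (1 - 2 * (a * (\<Sum>u\<in>W. (cmod (c u))\<^sup>2))))"
    using a by (intro complex_gaussian_mgf_square) simp
  finally show ?thesis by (simp add: mult.assoc)
qed

section \<open>Deviations of sums of squares\<close>

lemma measurable_gprod_component:
  "t \<in> W \<Longrightarrow> (\<lambda>\<zeta>. \<zeta> t) \<in> borel_measurable (Pi\<^sub>M W (\<lambda>_. complex_gaussian))"
  using measurable_component_singleton[of t W "\<lambda>_. complex_gaussian"]
  unfolding measurable_complex_gaussian .

lemma exp_weighted_sum_le:
  fixes w x :: "'a \<Rightarrow> real"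
  assumes "finite I" "\<And>i. i \<in> I \<Longrightarrow> 0 \<le> w i" "(\<Sum>i\<in>I. w i) = 1"
  shows "exp (\<Sum>i\<in>I. w i * x i) \<le> (\<Sum>i\<in>I. w i * exp (x i))"
proof -
  have "I \<noteq> {}" using assms(3) by auto
  with convex_on_sum[OF assms(1) _ exp_convex assms(3,2), of x]
  show ?thesis by simp
qed

text \<open>Jensen's inequality passes a moment bound from the terms to their convex combinations,
  whatever their dependence. It is used with weights given by variances, by a uniformly random
  subset, and by the split into diagonal and off-diagonal part.\<close>

lemma nn_integral_exp_weighted_sum_le:
  fixes w :: "'a \<Rightarrow> real" and X :: "'a \<Rightarrow> 'b \<Rightarrow> real"
  assumes "finite I" "\<And>i. i \<in> I \<Longrightarrow> 0 \<le> w i" "(\<Sum>i\<in>I. w i) = 1" "0 \<le> c"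
    and [measurable]: "\<And>i. i \<in> I \<Longrightarrow> X i \<in> borel_measurable M"
    and X: "\<And>i. i \<in> I \<Longrightarrow> (\<integral>\<^sup>+x. ennreal (exp (X i x)) \<partial>M) \<le> ennreal c"
  shows "(\<integral>\<^sup>+x. ennreal (exp (\<Sum>i\<in>I. w i * X i x)) \<partial>M) \<le> ennreal c"
proof -
  have "(\<integral>\<^sup>+x. ennreal (exp (\<Sum>i\<in>I. w i * X i x)) \<partial>M) \<le>
    (\<integral>\<^sup>+x. (\<Sum>i\<in>I. ennreal (w i) * ennreal (exp (X i x))) \<partial>M)"
  proof (rule nn_integral_mono)
    fix x
    have "(\<Sum>i\<in>I. ennreal (w i) * ennreal (exp (X i x))) = ennreal (\<Sum>i\<in>I. w i * exp (X i x))"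
      using assms(2) by (subst sum_ennreal[symmetric]) (auto simp: ennreal_mult intro!: sum.cong)
    then show "ennreal (exp (\<Sum>i\<in>I. w i * X i x)) \<le> (\<Sum>i\<in>I. ennreal (w i) * ennreal (exp (X i x)))"
      using exp_weighted_sum_le[OF assms(1-3), of "\<lambda>i. X i x"] by (simp add: ennreal_leI)
  qed
  also have "\<dots> = (\<Sum>i\<in>I. ennreal (w i) * (\<integral>\<^sup>+x. ennreal (exp (X i x)) \<partial>M))"
    by (subst nn_integral_sum) (auto simp: nn_integral_cmult)
  also have "\<dots> \<le> (\<Sum>i\<in>I. ennreal (w i) * ennreal c)"
    by (intro sum_mono mult_left_mono X) auto
  also have "\<dots> = ennreal (\<Sum>i\<in>I. w i * c)"
    using assms(2,4) by (subst sum_ennreal[symmetric]) (auto simp: ennreal_mult intro!: sum.cong)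
  also have "(\<Sum>i\<in>I. w i * c) = c" using assms(3) by (simp flip: sum_distrib_right)
  finally show ?thesis .
qed

lemma exp_Markov:
  assumes [measurable]: "X \<in> borel_measurable M"
    and X: "(\<integral>\<^sup>+x. ennreal (exp (X x)) \<partial>M) \<le> ennreal c" and "0 < c" "0 < \<delta>"
  shows "emeasure M {x \<in> space M. ln (c / \<delta>) \<le> X x} \<le> ennreal \<delta>"
proof -
  have eq: "ln (c / \<delta>) \<le> X x \<longleftrightarrow> 1 \<le> ennreal (\<delta> / c) * ennreal (exp (X x))" for x
  proof -
    have "ln (c / \<delta>) \<le> X x \<longleftrightarrow> c / \<delta> \<le> exp (X x)"
      using assms by (metis divide_pos_pos exp_ln exp_le_cancel_iff)
    also have "\<dots> \<longleftrightarrow> 1 \<le> \<delta> / c * exp (X x)" using assms by (simp add: field_simps)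
    finally show ?thesis using assms by (simp flip: ennreal_mult' ennreal_1)
  qed
  have "emeasure M {x \<in> space M. ln (c / \<delta>) \<le> X x} \<le> ennreal (\<delta> / c) * (\<integral>\<^sup>+x. ennreal (exp (X x)) * indicator (space M) x \<partial>M)"
    unfolding eq by (rule nn_integral_Markov_inequality) auto
  also have "(\<integral>\<^sup>+x. ennreal (exp (X x)) * indicator (space M) x \<partial>M) = (\<integral>\<^sup>+x. ennreal (exp (X x)) \<partial>M)"
    by (rule nn_integral_cong) simp
  also have "ennreal (\<delta> / c) * \<dots> \<le> ennreal (\<delta> / c) * ennreal c"
    by (intro mult_left_mono X) auto
  also have "\<dots> = ennreal \<delta>" using assms by (simp flip: ennreal_mult')
  finally show ?thesis .
qed

text \<open>The squares are dependent, so Jensen is applied with weights proportional to the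
  variances. This leaves single squares normalized by their own \<open>S i\<close>, for which the
  coefficient 1 / (4 \<open>S i\<close>) gives exactly 1 / (1 - 1 / 2) = 2.\<close>

lemma gprod_sum_squares_mgf:
  assumes [simp]: "finite W" "finite I" and B: "(\<Sum>i\<in>I. \<Sum>u\<in>W. (cmod (a i u))\<^sup>2) \<le> B"
  shows "(\<integral>\<^sup>+\<zeta>. ennreal (exp ((\<Sum>i\<in>I. (cmod (\<Sum>u\<in>W. a i u * \<zeta> u))\<^sup>2) / (4 * B)))
      \<partial>Pi\<^sub>M W (\<lambda>_. complex_gaussian)) \<le> ennreal 2"
proof -
  interpret P: prob_space "Pi\<^sub>M W (\<lambda>_. complex_gaussian)" by (rule prob_space_gprod)
  define S where "S i = (\<Sum>u\<in>W. (cmod (a i u))\<^sup>2)" for i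
  define X where "X i \<zeta> = (cmod (\<Sum>u\<in>W. a i u * \<zeta> u))\<^sup>2" for i and \<zeta> :: "'a \<Rightarrow> complex"
  have S0: "0 \<le> S i" for i unfolding S_def by (intro sum_nonneg) simp
  have X0: "0 \<le> X i \<zeta>" for i \<zeta> unfolding X_def by simp
  \<comment> \<open>A row of norm zero gets weight zero and a quotient by zero, so its term in the
    weighted sum is 0; the sum stays correct because the row itself vanishes.\<close>
  have X_zero: "X i \<zeta> = 0" if "S i = 0" for i \<zeta>
  proof -
    have "\<forall>u\<in>W. (cmod (a i u))\<^sup>2 = 0"
      using that unfolding S_def by (subst (asm) sum_nonneg_eq_0_iff) auto
    then show ?thesis by (simp add: X_def)
  qed
  have [measurable]: "X i \<in> borel_measurable (Pi\<^sub>M W (\<lambda>_. complex_gaussian))" for i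
    unfolding X_def by measurable
  show ?thesis
  proof (cases "(\<Sum>i\<in>I. S i) = 0")
    case True
    then have "\<forall>i\<in>I. S i = 0" using S0 by (subst (asm) sum_nonneg_eq_0_iff) auto
    then have "(\<Sum>i\<in>I. X i \<zeta>) = 0" for \<zeta> using X_zero by (intro sum.neutral) auto
    then show ?thesis unfolding X_def[symmetric] by (simp add: P.emeasure_space_1)
  next
    case False
    define T where "T = (\<Sum>i\<in>I. S i)"
    have T: "0 < T" using False S0 sum_nonneg[of I S] by (auto simp: T_def less_le)
    have TB: "T \<le> B" using B by (simp add: T_def S_def)
    have "(\<integral>\<^sup>+\<zeta>. ennreal (exp ((\<Sum>i\<in>I. X i \<zeta>) / (4 * B))) \<partial>Pi\<^sub>M W (\<lambda>_. complex_gaussian)) \<le>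
       (\<integral>\<^sup>+\<zeta>. ennreal (exp (\<Sum>i\<in>I. S i / T * (X i \<zeta> / (4 * S i)))) \<partial>Pi\<^sub>M W (\<lambda>_. complex_gaussian))"
    proof (rule nn_integral_mono)
      fix \<zeta> :: "'a \<Rightarrow> complex"
      have "(\<Sum>i\<in>I. S i / T * (X i \<zeta> / (4 * S i))) = (\<Sum>i\<in>I. X i \<zeta>) / (4 * T)"
        unfolding sum_divide_distrib by (rule sum.cong) (use X_zero in auto)
      moreover have "(\<Sum>i\<in>I. X i \<zeta>) / (4 * B) \<le> (\<Sum>i\<in>I. X i \<zeta>) / (4 * T)"
        using T TB X0 by (intro divide_left_mono sum_nonneg) auto
      ultimately show "ennreal (exp ((\<Sum>i\<in>I. X i \<zeta>) / (4 * B))) \<le> ennreal (exp (\<Sum>i\<in>I. S i / T * (X i \<zeta> / (4 * S i))))"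
        by (intro ennreal_leI) simp
    qed
    also have "\<dots> \<le> ennreal 2"
    proof (rule nn_integral_exp_weighted_sum_le)
      show "(\<Sum>i\<in>I. S i / T) = 1" using T by (simp add: T_def flip: sum_divide_distrib)
      show "(\<integral>\<^sup>+\<zeta>. ennreal (exp (X i \<zeta> / (4 * S i))) \<partial>Pi\<^sub>M W (\<lambda>_. complex_gaussian)) \<le> ennreal 2" for i
      proof (cases "S i = 0")
        case True then show ?thesis by (simp add: P.emeasure_space_1)
      next
        case False
        then have "(\<integral>\<^sup>+\<zeta>. ennreal (exp (1 / (4 * S i) * X i \<zeta>)) \<partial>Pi\<^sub>M W (\<lambda>_. complex_gaussian)) =
          ennreal (1 / (1 - 2 * (1 / (4 * S i)) * S i))"
          unfolding X_def S_def using S0[of i]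
          by (intro gprod_linear_square_mgf) (auto simp: S_def)
        then show ?thesis using False by simp
      qed
    qed (use S0 T in auto)
    finally show ?thesis by (simp add: X_def)
  qed
qed

text \<open>Asking for a measurable exceptional set makes sense of \<open>Q\<close> holding with probability
  \<open>1 - \<delta>\<close> without requiring \<open>Q\<close> itself to be measurable.\<close>

definition whp :: "'a measure \<Rightarrow> real \<Rightarrow> ('a \<Rightarrow> bool) \<Rightarrow> bool" where
  "whp M \<delta> Q \<longleftrightarrow> (\<exists>A\<in>sets M. emeasure M A \<le> ennreal \<delta> \<and> (\<forall>\<omega>\<in>space M - A. Q \<omega>))"

lemma whp_mono: "whp M \<delta> Q \<Longrightarrow> (\<And>\<omega>. \<omega> \<in> space M \<Longrightarrow> Q \<omega> \<Longrightarrow> R \<omega>) \<Longrightarrow> \<delta> \<le> \<delta>' \<Longrightarrow> whp M \<delta>' R"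
  unfolding whp_def by (meson DiffD1 ennreal_leI order_trans)

lemma whp_ball:
  assumes "finite I" "\<And>i. i \<in> I \<Longrightarrow> whp M (\<delta> i) (Q i)" "\<And>i. i \<in> I \<Longrightarrow> 0 \<le> \<delta> i"
  shows "whp M (\<Sum>i\<in>I. \<delta> i) (\<lambda>\<omega>. \<forall>i\<in>I. Q i \<omega>)"
proof -
  obtain A where A: "\<And>i. i \<in> I \<Longrightarrow> A i \<in> sets M" "\<And>i. i \<in> I \<Longrightarrow> emeasure M (A i) \<le> ennreal (\<delta> i)"
    "\<And>i \<omega>. i \<in> I \<Longrightarrow> \<omega> \<in> space M - A i \<Longrightarrow> Q i \<omega>"
    using assms(2) unfolding whp_def by metis
  have "emeasure M (\<Union>i\<in>I. A i) \<le> (\<Sum>i\<in>I. emeasure M (A i))"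
    using A assms(1) by (intro emeasure_subadditive_finite) auto
  also have "\<dots> \<le> (\<Sum>i\<in>I. ennreal (\<delta> i))" by (intro sum_mono A)
  also have "\<dots> = ennreal (\<Sum>i\<in>I. \<delta> i)" using assms(3) by (rule sum_ennreal)
  finally show ?thesis unfolding whp_def
    using A assms(1) by (intro bexI[of _ "\<Union>i\<in>I. A i"]) auto
qed

lemma whp_conj:
  assumes "whp M \<delta> Q" "whp M \<delta>' R" "0 \<le> \<delta>" "0 \<le> \<delta>'"
  shows "whp M (\<delta> + \<delta>') (\<lambda>\<omega>. Q \<omega> \<and> R \<omega>)"
proof -
  have "whp M (\<Sum>b\<in>UNIV. if b then \<delta> else \<delta>') (\<lambda>\<omega>. \<forall>b\<in>UNIV. (if b then Q else R) \<omega>)"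
    using assms by (intro whp_ball) auto
  then show ?thesis
    by (rule whp_mono) (auto simp: UNIV_bool)
qed

lemma whp_le:
  fixes X :: "'a \<Rightarrow> real"
  assumes [measurable]: "X \<in> borel_measurable M"
    and "emeasure M {\<omega> \<in> space M. b \<le> X \<omega>} \<le> ennreal \<delta>"
  shows "whp M \<delta> (\<lambda>\<omega>. X \<omega> \<le> b)"
  unfolding whp_def using assms(2) by (intro bexI[of _ "{\<omega> \<in> space M. b \<le> X \<omega>}"]) auto

lemma gprod_sum_squares_tail:
  assumes [simp]: "finite W" "finite I" and B: "(\<Sum>i\<in>I. \<Sum>u\<in>W. (cmod (a i u))\<^sup>2) \<le> B" and "0 < \<delta>"
  shows "whp (Pi\<^sub>M W (\<lambda>_. complex_gaussian)) \<delta>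
     (\<lambda>\<zeta>. (\<Sum>i\<in>I. (cmod (\<Sum>u\<in>W. a i u * \<zeta> u))\<^sup>2) \<le> 4 * B * ln (2 / \<delta>))"
\<comment> \<open>The hypothesis makes \<open>B\<close> nonnegative, so this is the degenerate case
  \<open>B = 0\<close>, in which all coefficients vanish and dividing by 4 \<open>B\<close> would be
  meaningless.\<close>
proof (cases "B \<le> 0")
  case True
  have S0: "0 \<le> (\<Sum>u\<in>W. (cmod (a i u))\<^sup>2)" for i by (intro sum_nonneg) simp
  have "(\<Sum>i\<in>I. \<Sum>u\<in>W. (cmod (a i u))\<^sup>2) = 0" and B0: "B = 0"
    using True B sum_nonneg[of I "\<lambda>i. \<Sum>u\<in>W. (cmod (a i u))\<^sup>2"] S0 by auto
  then have "\<forall>i\<in>I. \<forall>u\<in>W. a i u = 0"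
    using S0 by (simp add: sum_nonneg_eq_0_iff)
  then show ?thesis using B0 unfolding whp_def by (intro bexI[of _ "{}"]) auto
next
  case False
  let ?P = "Pi\<^sub>M W (\<lambda>_. complex_gaussian)"
  have "whp ?P \<delta> (\<lambda>\<zeta>. (\<Sum>i\<in>I. (cmod (\<Sum>u\<in>W. a i u * \<zeta> u))\<^sup>2) / (4 * B) \<le> ln (2 / \<delta>))"
    using gprod_sum_squares_mgf[OF assms(1,2) B] \<open>0 < \<delta>\<close> by (intro whp_le exp_Markov) auto
  then show ?thesis
    by (rule whp_mono) (use False in \<open>auto simp: pos_divide_le_eq mult_ac\<close>)
qed

text \<open>For a frozen block \<open>J\<close> the form is linear in the block \<open>I\<close>.
  Integrating \<open>I\<close> out leaves half the sum of squares of linear forms in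
  \<open>J\<close>, which is the sum-of-squares bound with \<open>B\<close> = 1 / 2.\<close>

lemma gprod_bilinear_mgf:
  assumes [simp]: "finite I" "finite J" and IJ: "I \<inter> J = {}"
    and a: "(\<Sum>t\<in>I. \<Sum>u\<in>J. (cmod (a t u))\<^sup>2) \<le> 1 / 2"
  shows "(\<integral>\<^sup>+\<zeta>. ennreal (exp (Re (\<Sum>t\<in>I. \<Sum>u\<in>J. cnj (\<zeta> t) * a t u * \<zeta> u)))
      \<partial>Pi\<^sub>M (I \<union> J) (\<lambda>_. complex_gaussian)) \<le> ennreal 2"
proof -
  have "(\<integral>\<^sup>+\<zeta>. ennreal (exp (Re (\<Sum>t\<in>I. \<Sum>u\<in>J. cnj (\<zeta> t) * a t u * \<zeta> u)))
      \<partial>Pi\<^sub>M (J \<union> I) (\<lambda>_. complex_gaussian)) =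
    (\<integral>\<^sup>+x. \<integral>\<^sup>+y. ennreal (exp (Re (\<Sum>t\<in>I. \<Sum>u\<in>J. cnj (y t) * a t u * x u)))
      \<partial>Pi\<^sub>M I (\<lambda>_. complex_gaussian) \<partial>Pi\<^sub>M J (\<lambda>_. complex_gaussian))"
  proof (subst gprod.product_nn_integral_fold)
    show "J \<inter> I = {}" using IJ by auto
    show "(\<lambda>\<zeta>. ennreal (exp (Re (\<Sum>t\<in>I. \<Sum>u\<in>J. cnj (\<zeta> t) * a t u * \<zeta> u)))) \<in> borel_measurable (Pi\<^sub>M (J \<union> I) (\<lambda>_. complex_gaussian))"
    proof -
      have [measurable]: "(\<lambda>\<zeta>. \<zeta> t) \<in> borel_measurable (Pi\<^sub>M (J \<union> I) (\<lambda>_. complex_gaussian))" if "t \<in> I \<or> t \<in> J" for t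
        using that by (intro measurable_gprod_component) auto
      show ?thesis by measurable
    qed
    have "merge J I (x, y) t = y t" if "t \<in> I" for x y :: "'a \<Rightarrow> complex" and t
      using that IJ by (auto simp: merge_def)
    moreover have "merge J I (x, y) u = x u" if "u \<in> J" for x y :: "'a \<Rightarrow> complex" and u
      using that by (auto simp: merge_def)
    ultimately have "(\<Sum>t\<in>I. \<Sum>u\<in>J. cnj (merge J I (x, y) t) * a t u * merge J I (x, y) u) =
       (\<Sum>t\<in>I. \<Sum>u\<in>J. cnj (y t) * a t u * x u)" for x y
      by (intro sum.cong) auto
    then show "(\<integral>\<^sup>+x. \<integral>\<^sup>+y. ennreal (exp (Re (\<Sum>t\<in>I. \<Sum>u\<in>J. cnj (merge J I (x, y) t) * a t u * merge J I (x, y) u)))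
      \<partial>Pi\<^sub>M I (\<lambda>_. complex_gaussian) \<partial>Pi\<^sub>M J (\<lambda>_. complex_gaussian)) =
      (\<integral>\<^sup>+x. \<integral>\<^sup>+y. ennreal (exp (Re (\<Sum>t\<in>I. \<Sum>u\<in>J. cnj (y t) * a t u * x u)))
      \<partial>Pi\<^sub>M I (\<lambda>_. complex_gaussian) \<partial>Pi\<^sub>M J (\<lambda>_. complex_gaussian))" by presburger
  qed auto
  also have "\<dots> = (\<integral>\<^sup>+x. ennreal (exp ((\<Sum>t\<in>I. (cmod (\<Sum>u\<in>J. a t u * x u))\<^sup>2) / (4 * (1 / 2))))
      \<partial>Pi\<^sub>M J (\<lambda>_. complex_gaussian))"
  proof -
    have "Re (\<Sum>t\<in>I. \<Sum>u\<in>J. cnj (y t) * a t u * x u) = Re (\<Sum>t\<in>I. cnj (\<Sum>u\<in>J. a t u * x u) * y t)" for x y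
    proof -
      have "Re (\<Sum>t\<in>I. cnj (\<Sum>u\<in>J. a t u * x u) * y t) = Re (cnj (\<Sum>t\<in>I. cnj (\<Sum>u\<in>J. a t u * x u) * y t))"
        by (simp only: cnj.sel)
      also have "cnj (\<Sum>t\<in>I. cnj (\<Sum>u\<in>J. a t u * x u) * y t) = (\<Sum>t\<in>I. \<Sum>u\<in>J. cnj (y t) * a t u * x u)"
        by (simp add: sum_distrib_left sum_distrib_right mult_ac)
      finally show ?thesis by simp
    qed
    then show ?thesis by (simp only: gprod_linear_mgf[OF assms(1)]) simp
  qed
  also have "\<dots> \<le> ennreal 2" by (rule gprod_sum_squares_mgf) (use a in auto)
  finally show ?thesis by (simp add: Un_commute)
qed

section \<open>Deviations of quadratic forms\<close>

lemma card_separating_subsets: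
  assumes [simp]: "finite W" and "t \<in> W" "u \<in> W" "t \<noteq> u"
  shows "4 * card {I \<in> Pow W. t \<in> I \<and> u \<notin> I} = 2 ^ card W"
proof -
  have "bij_betw (insert t) (Pow (W - {t, u})) {I \<in> Pow W. t \<in> I \<and> u \<notin> I}"
    by (rule bij_betwI[where g = "\<lambda>I. I - {t}"]) (use assms in auto)
  then have "card {I \<in> Pow W. t \<in> I \<and> u \<notin> I} = 2 ^ card (W - {t, u})"
    by (simp add: card_Pow flip: bij_betw_same_card)
  moreover have "card W = card (W - {t, u}) + 2"
    using assms card_Diff_subset[of "{t, u}" W] card_mono[of W "{t, u}"] by simp
  ultimately show ?thesis by simp
qed

text \<open>The factor 4 undoes the probability 1 / 4 of separation. Being an exact identity, this
  displays the off-diagonal sum as a convex combination, ready for Jensen.\<close>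

lemma sum_offdiag_eq_average:
  fixes f :: "'a \<Rightarrow> 'a \<Rightarrow> real"
  assumes [simp]: "finite W"
  shows "(\<Sum>t\<in>W. \<Sum>u\<in>W - {t}. f t u) =
    (\<Sum>I\<in>Pow W. 1 / 2 ^ card W * (4 * (\<Sum>t\<in>I. \<Sum>u\<in>W - I. f t u)))"
proof -
  have inner: "(\<Sum>t\<in>I. \<Sum>u\<in>W - I. f t u) = (\<Sum>t\<in>W. \<Sum>u\<in>W. if t \<in> I \<and> u \<notin> I then f t u else 0)" if "I \<in> Pow W" for I
  proof -
    have "(\<Sum>t\<in>I. \<Sum>u\<in>W - I. f t u) = (\<Sum>t\<in>W. if t \<in> I then (\<Sum>u\<in>W. if u \<notin> I then f t u else 0) else 0)"
      using that by (intro sum.mono_neutral_cong_left) (auto simp: Diff_subset finite_subset intro!: sum.mono_neutral_cong_left)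
    also have "\<dots> = (\<Sum>t\<in>W. \<Sum>u\<in>W. if t \<in> I \<and> u \<notin> I then f t u else 0)"
      by (intro sum.cong) auto
    finally show ?thesis .
  qed
  have weight: "4 / 2 ^ card W * (real (card {I \<in> Pow W. t \<in> I \<and> u \<notin> I}) * f t u) = (if u = t then 0 else f t u)"
    if tu: "t \<in> W" "u \<in> W" for t u
  proof (cases "u = t")
    case False
    have "4 * real (card {I \<in> Pow W. t \<in> I \<and> u \<notin> I}) = real (4 * card {I \<in> Pow W. t \<in> I \<and> u \<notin> I})" by simp
    also have "\<dots> = 2 ^ card W" using card_separating_subsets[OF assms tu] False by simp
    finally show ?thesis using False by (simp add: field_simps)
  next
    case True
    then have "{I \<in> Pow W. t \<in> I \<and> u \<notin> I} = {}" by auto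
    then show ?thesis using True by simp
  qed
  have "(\<Sum>I\<in>Pow W. \<Sum>t\<in>W. \<Sum>u\<in>W. if t \<in> I \<and> u \<notin> I then f t u else 0) =
    (\<Sum>t\<in>W. \<Sum>u\<in>W. \<Sum>I\<in>Pow W. if t \<in> I \<and> u \<notin> I then f t u else 0)"
    by (rule trans[OF sum.swap sum.cong[OF refl sum.swap]])
  also have "\<dots> = (\<Sum>t\<in>W. \<Sum>u\<in>W. real (card {I \<in> Pow W. t \<in> I \<and> u \<notin> I}) * f t u)"
    by (intro sum.cong refl) (simp flip: sum.inter_filter)
  finally have swap: "(\<Sum>I\<in>Pow W. \<Sum>t\<in>W. \<Sum>u\<in>W. if t \<in> I \<and> u \<notin> I then f t u else 0) =
    (\<Sum>t\<in>W. \<Sum>u\<in>W. real (card {I \<in> Pow W. t \<in> I \<and> u \<notin> I}) * f t u)" .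
  have "(\<Sum>I\<in>Pow W. 1 / 2 ^ card W * (4 * (\<Sum>t\<in>I. \<Sum>u\<in>W - I. f t u))) =
    (\<Sum>I\<in>Pow W. 4 / 2 ^ card W * (\<Sum>t\<in>W. \<Sum>u\<in>W. if t \<in> I \<and> u \<notin> I then f t u else 0))"
    by (intro sum.cong refl) (simp add: inner)
  also have "\<dots> = 4 / 2 ^ card W * (\<Sum>t\<in>W. \<Sum>u\<in>W. real (card {I \<in> Pow W. t \<in> I \<and> u \<notin> I}) * f t u)"
    unfolding swap[symmetric] by (rule sum_distrib_left[symmetric])
  also have "\<dots> = (\<Sum>t\<in>W. \<Sum>u\<in>W. 4 / 2 ^ card W * (real (card {I \<in> Pow W. t \<in> I \<and> u \<notin> I}) * f t u))"
    by (simp only: sum_distrib_left)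
  also have "\<dots> = (\<Sum>t\<in>W. \<Sum>u\<in>W. if u = t then 0 else f t u)"
    by (rule sum.cong[OF refl sum.cong[OF refl]]) (rule weight)
  also have "\<dots> = (\<Sum>t\<in>W. \<Sum>u\<in>W - {t}. f t u)"
    by (intro sum.cong refl sum.mono_neutral_cong_right) auto
  finally show ?thesis by simp
qed

text \<open>Decoupling: a uniformly random \<open>I\<close> separates two given distinct indices with probability
  \<open>1 / 4\<close>, and for fixed \<open>I\<close> the form is bilinear in two independent blocks.\<close>

lemma gprod_offdiag_mgf:
  assumes [simp]: "finite W" and a: "(\<Sum>t\<in>W. \<Sum>u\<in>W. (cmod (a t u))\<^sup>2) \<le> 1 / 32"
  shows "(\<integral>\<^sup>+\<zeta>. ennreal (exp (\<Sum>t\<in>W. \<Sum>u\<in>W - {t}. Re (cnj (\<zeta> t) * a t u * \<zeta> u)))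
      \<partial>Pi\<^sub>M W (\<lambda>_. complex_gaussian)) \<le> ennreal 2"
  unfolding sum_offdiag_eq_average[OF assms(1)]
proof (rule nn_integral_exp_weighted_sum_le)
  show "(\<Sum>I\<in>Pow W. 1 / 2 ^ card W :: real) = 1" by (simp add: card_Pow)
  fix I assume I: "I \<in> Pow W"
  then have IW: "I \<union> (W - I) = W" "finite I" using finite_subset[of I W] by auto
  have [measurable]: "(\<lambda>\<zeta>. \<zeta> t) \<in> borel_measurable (Pi\<^sub>M W (\<lambda>_. complex_gaussian))" if "t \<in> W" for t
    using that by (rule measurable_gprod_component)
  have [measurable]: "(\<lambda>\<zeta>. \<zeta> t) \<in> borel_measurable (Pi\<^sub>M W (\<lambda>_. complex_gaussian))" if "t \<in> I" for t
    using that I by (intro measurable_gprod_component) auto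
  have [measurable]: "(\<lambda>\<zeta>. \<zeta> t) \<in> borel_measurable (Pi\<^sub>M W (\<lambda>_. complex_gaussian))" if "t \<in> W - I" for t
    using that I by (intro measurable_gprod_component) auto
  show "(\<lambda>\<zeta>. 4 * (\<Sum>t\<in>I. \<Sum>u\<in>W - I. Re (cnj (\<zeta> t) * a t u * \<zeta> u))) \<in> borel_measurable (Pi\<^sub>M W (\<lambda>_. complex_gaussian))"
    by measurable
  have "(\<integral>\<^sup>+\<zeta>. ennreal (exp (Re (\<Sum>t\<in>I. \<Sum>u\<in>W - I. cnj (\<zeta> t) * (4 * a t u) * \<zeta> u)))
      \<partial>Pi\<^sub>M (I \<union> (W - I)) (\<lambda>_. complex_gaussian)) \<le> ennreal 2"
  proof (rule gprod_bilinear_mgf)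
    \<comment> \<open>Decoupling multiplies the coefficients by 4 and their squares by 16; 16 / 32 =
      1 / 2 is what the bilinear bound admits.\<close>
    have "(\<Sum>t\<in>I. \<Sum>u\<in>W - I. (cmod (4 * a t u))\<^sup>2) \<le> (\<Sum>t\<in>W. \<Sum>u\<in>W. (cmod (4 * a t u))\<^sup>2)"
      using I by (intro order_trans[OF sum_mono sum_mono2] sum_mono2 sum_nonneg) auto
    also have "\<dots> = 16 * (\<Sum>t\<in>W. \<Sum>u\<in>W. (cmod (a t u))\<^sup>2)"
      by (simp add: norm_mult power_mult_distrib sum_distrib_left)
    finally show "(\<Sum>t\<in>I. \<Sum>u\<in>W - I. (cmod (4 * a t u))\<^sup>2) \<le> 1 / 2" using a by simp
  qed (use IW in auto)
  also have "(\<lambda>\<zeta>. Re (\<Sum>t\<in>I. \<Sum>u\<in>W - I. cnj (\<zeta> t) * (4 * a t u) * \<zeta> u)) =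
     (\<lambda>\<zeta>. 4 * (\<Sum>t\<in>I. \<Sum>u\<in>W - I. Re (cnj (\<zeta> t) * a t u * \<zeta> u)))"
  proof
    fix \<zeta> :: "'a \<Rightarrow> complex"
    have "(\<Sum>t\<in>I. \<Sum>u\<in>W - I. cnj (\<zeta> t) * (4 * a t u) * \<zeta> u) = of_real 4 * (\<Sum>t\<in>I. \<Sum>u\<in>W - I. cnj (\<zeta> t) * a t u * \<zeta> u)"
      by (simp add: sum_distrib_left mult_ac)
    then have "Re (\<Sum>t\<in>I. \<Sum>u\<in>W - I. cnj (\<zeta> t) * (4 * a t u) * \<zeta> u) = 4 * Re (\<Sum>t\<in>I. \<Sum>u\<in>W - I. cnj (\<zeta> t) * a t u * \<zeta> u)"
      by (simp only: scaleR_conv_of_real[symmetric] scaleR_complex.sel)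
    then show "Re (\<Sum>t\<in>I. \<Sum>u\<in>W - I. cnj (\<zeta> t) * (4 * a t u) * \<zeta> u) = 4 * (\<Sum>t\<in>I. \<Sum>u\<in>W - I. Re (cnj (\<zeta> t) * a t u * \<zeta> u))"
      by (simp only: Re_sum)
  qed
  finally show "(\<integral>\<^sup>+\<zeta>. ennreal (exp (4 * (\<Sum>t\<in>I. \<Sum>u\<in>W - I. Re (cnj (\<zeta> t) * a t u * \<zeta> u))))
      \<partial>Pi\<^sub>M W (\<lambda>_. complex_gaussian)) \<le> ennreal 2"
    unfolding IW(1) .
qed auto

text \<open>Subtracting the mean 2 cancels the first-order term of - ln (1 - 2 b), so only a
  quadratic remainder is left. This cancellation is why the deviation scales with the Frobenius norm
  and not with the trace. The bound on \<open>b\<close> keeps 2 b within 1 / 2, where the expansion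
  of the logarithm is valid.\<close>

lemma complex_gaussian_mgf_centered_square:
  assumes "\<bar>b\<bar> \<le> 1 / 4"
  shows "(\<integral>\<^sup>+z. ennreal (exp (b * ((cmod z)\<^sup>2 - 2))) \<partial>complex_gaussian) \<le> ennreal (exp (8 * b\<^sup>2))"
proof -
  have "(\<integral>\<^sup>+z. ennreal (exp (b * ((cmod z)\<^sup>2 - 2))) \<partial>complex_gaussian) =
    (\<integral>\<^sup>+z. ennreal (exp (- 2 * b)) * ennreal (exp (b * (cmod z)\<^sup>2)) \<partial>complex_gaussian)"
    by (simp add: algebra_simps flip: ennreal_mult' exp_add)
  also have "\<dots> = ennreal (exp (- 2 * b)) * ennreal (1 / (1 - 2 * b))"
    using assms by (subst nn_integral_cmult) (simp_all add: complex_gaussian_mgf_square)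
  also have "\<dots> = ennreal (exp (- 2 * b) * (1 / (1 - 2 * b)))"
    using assms by (simp flip: ennreal_mult')
  also have "\<dots> \<le> ennreal (exp (8 * b\<^sup>2))"
  proof (rule ennreal_leI)
    have "\<bar>ln (1 + (- 2 * b)) - (- 2 * b)\<bar> \<le> 2 * (- 2 * b)\<^sup>2"
      by (rule abs_ln_one_plus_x_minus_x_bound) (use assms in auto)
    then have "- 2 * b - ln (1 - 2 * b) \<le> 8 * b\<^sup>2" by (simp add: power2_eq_square)
    then have "exp (- 2 * b - ln (1 - 2 * b)) \<le> exp (8 * b\<^sup>2)" by simp
    then show "exp (- 2 * b) * (1 / (1 - 2 * b)) \<le> exp (8 * b\<^sup>2)"
      using assms by (simp add: exp_diff)
  qed
  finally show ?thesis .
qed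

lemma gprod_diag_mgf:
  fixes b :: "'a \<Rightarrow> real"
  assumes [simp]: "finite W" and b: "(\<Sum>t\<in>W. (b t)\<^sup>2) \<le> 1 / 16"
  shows "(\<integral>\<^sup>+\<zeta>. ennreal (exp (\<Sum>t\<in>W. b t * ((cmod (\<zeta> t))\<^sup>2 - 2)))
      \<partial>Pi\<^sub>M W (\<lambda>_. complex_gaussian)) \<le> ennreal 2"
proof -
  have "(\<integral>\<^sup>+\<zeta>. ennreal (exp (\<Sum>t\<in>W. b t * ((cmod (\<zeta> t))\<^sup>2 - 2))) \<partial>Pi\<^sub>M W (\<lambda>_. complex_gaussian)) =
    (\<integral>\<^sup>+\<zeta>. (\<Prod>t\<in>W. ennreal (exp (b t * ((cmod (\<zeta> t))\<^sup>2 - 2)))) \<partial>Pi\<^sub>M W (\<lambda>_. complex_gaussian))"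
    by (simp add: exp_sum prod_ennreal)
  also have "\<dots> = (\<Prod>t\<in>W. (\<integral>\<^sup>+z. ennreal (exp (b t * ((cmod z)\<^sup>2 - 2))) \<partial>complex_gaussian))"
    by (subst gprod.product_nn_integral_prod) simp_all
  also have "\<dots> \<le> (\<Prod>t\<in>W. ennreal (exp (8 * (b t)\<^sup>2)))"
  proof (rule prod_mono_ennreal)
    fix t assume "t \<in> W"
    then have "(b t)\<^sup>2 \<le> (\<Sum>t\<in>W. (b t)\<^sup>2)" by (intro member_le_sum) auto
    then have "(b t)\<^sup>2 \<le> (1 / 4)\<^sup>2" using b by (simp add: power2_eq_square)
    then have "\<bar>b t\<bar> \<le> 1 / 4" by (metis abs_le_square_iff abs_of_nonneg zero_le_divide_1_iff zero_le_numeral)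
    then show "(\<integral>\<^sup>+z. ennreal (exp (b t * ((cmod z)\<^sup>2 - 2))) \<partial>complex_gaussian) \<le> ennreal (exp (8 * (b t)\<^sup>2))"
      by (rule complex_gaussian_mgf_centered_square)
  qed
  also have "\<dots> = ennreal (exp (8 * (\<Sum>t\<in>W. (b t)\<^sup>2)))"
    by (simp add: prod_ennreal exp_sum sum_distrib_left)
  \<comment> \<open>8 / 16 = 1 / 2 and exp (1 / 2) \<le> 2.\<close>
  also have "\<dots> \<le> ennreal 2"
    using b by (intro ennreal_leI order_trans[OF _ exp_half_le2]) simp
  finally show ?thesis .
qed

text \<open>The mean is twice the trace because the squared modulus of a coordinate has mean 2.
  Off-diagonal and diagonal part are dependent; Jensen with weights 1 / 2 separates them at the
  price of doubling the coefficients, and 4 / 128 = 1 / 32.\<close>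

lemma gprod_quadratic_mgf:
  assumes [simp]: "finite W" and a: "(\<Sum>t\<in>W. \<Sum>u\<in>W. (cmod (a t u))\<^sup>2) \<le> 1 / 128"
  shows "(\<integral>\<^sup>+\<zeta>. ennreal (exp (Re (\<Sum>t\<in>W. \<Sum>u\<in>W. cnj (\<zeta> t) * a t u * \<zeta> u) - 2 * Re (\<Sum>t\<in>W. a t t)))
      \<partial>Pi\<^sub>M W (\<lambda>_. complex_gaussian)) \<le> ennreal 2"
proof -
  define X where "X i \<zeta> = (if i then \<Sum>t\<in>W. \<Sum>u\<in>W - {t}. Re (cnj (\<zeta> t) * (2 * a t u) * \<zeta> u)
    else \<Sum>t\<in>W. (2 * Re (a t t)) * ((cmod (\<zeta> t))\<^sup>2 - 2))" for i :: bool and \<zeta> :: "'a \<Rightarrow> complex"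
  have a2: "(\<Sum>t\<in>W. \<Sum>u\<in>W. (cmod (2 * a t u))\<^sup>2) \<le> 1 / 32"
    using a by (simp add: norm_mult power_mult_distrib flip: sum_distrib_left)
  have "(\<Sum>t\<in>W. (2 * Re (a t t))\<^sup>2) \<le> (\<Sum>t\<in>W. \<Sum>u\<in>W. (cmod (2 * a t u))\<^sup>2)"
  proof (rule sum_mono)
    fix t assume t: "t \<in> W"
    have "(2 * Re (a t t))\<^sup>2 \<le> (cmod (2 * a t t))\<^sup>2"
      by (simp add: norm_mult power_mult_distrib cmod_power2)
    also have "\<dots> \<le> (\<Sum>u\<in>W. (cmod (2 * a t u))\<^sup>2)" using t by (intro member_le_sum) auto
    finally show "(2 * Re (a t t))\<^sup>2 \<le> (\<Sum>u\<in>W. (cmod (2 * a t u))\<^sup>2)" .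
  qed
  then have b: "(\<Sum>t\<in>W. (2 * Re (a t t))\<^sup>2) \<le> 1 / 16" using a2 by simp
  have "Re (\<Sum>t\<in>W. \<Sum>u\<in>W. cnj (\<zeta> t) * a t u * \<zeta> u) - 2 * Re (\<Sum>t\<in>W. a t t) = (\<Sum>i\<in>UNIV. 1 / 2 * X i \<zeta>)" for \<zeta>
  proof -
    have "(\<Sum>u\<in>W. Re (cnj (\<zeta> t) * a t u * \<zeta> u)) - 2 * Re (a t t) =
      (1 / 2) * (\<Sum>u\<in>W - {t}. Re (cnj (\<zeta> t) * (2 * a t u) * \<zeta> u)) + 1 / 2 * ((2 * Re (a t t)) * ((cmod (\<zeta> t))\<^sup>2 - 2))"
      if t: "t \<in> W" for t
    proof -
      have *: "Re (cnj (\<zeta> t) * a t t * \<zeta> t) = Re (a t t) * (cmod (\<zeta> t))\<^sup>2"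
        by (simp only: cmod_power2) (simp add: power2_eq_square algebra_simps)
      have "Re (cnj (\<zeta> t) * (2 * a t u) * \<zeta> u) = 2 * Re (cnj (\<zeta> t) * a t u * \<zeta> u)" for u
        by (simp add: algebra_simps)
      then have "(\<Sum>u\<in>W - {t}. Re (cnj (\<zeta> t) * (2 * a t u) * \<zeta> u)) = 2 * (\<Sum>u\<in>W - {t}. Re (cnj (\<zeta> t) * a t u * \<zeta> u))"
        by (simp only: sum_distrib_left)
      moreover have "(\<Sum>u\<in>W. Re (cnj (\<zeta> t) * a t u * \<zeta> u)) =
        Re (cnj (\<zeta> t) * a t t * \<zeta> t) + (\<Sum>u\<in>W - {t}. Re (cnj (\<zeta> t) * a t u * \<zeta> u))"
        using t by (intro sum.remove) auto
      ultimately show ?thesis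
        by (simp only: *) (simp add: algebra_simps del: times_complex.sel)
    qed
    then have "(\<Sum>t\<in>W. (\<Sum>u\<in>W. Re (cnj (\<zeta> t) * a t u * \<zeta> u)) - 2 * Re (a t t)) =
      1 / 2 * X True \<zeta> + 1 / 2 * X False \<zeta>"
      unfolding X_def if_True if_False sum_distrib_left sum.distrib[symmetric] by (intro sum.cong) auto
    then show ?thesis by (simp add: UNIV_bool sum_subtractf sum_distrib_left del: times_complex.sel)
  qed
  moreover have "(\<integral>\<^sup>+\<zeta>. ennreal (exp (\<Sum>i\<in>UNIV. 1 / 2 * X i \<zeta>)) \<partial>Pi\<^sub>M W (\<lambda>_. complex_gaussian)) \<le> ennreal 2"
  proof (rule nn_integral_exp_weighted_sum_le)
    fix i :: bool
    have [measurable]: "(\<lambda>\<zeta>. \<zeta> t) \<in> borel_measurable (Pi\<^sub>M W (\<lambda>_. complex_gaussian))" if "t \<in> W" for t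
      using that by (rule measurable_gprod_component)
    have "(\<lambda>\<zeta>. Re (cnj (\<zeta> t) * (2 * a t u) * \<zeta> u)) \<in> borel_measurable (Pi\<^sub>M W (\<lambda>_. complex_gaussian))"
      if "t \<in> W" "u \<in> W" for t u
      using measurable_gprod_component[OF that(1)] measurable_gprod_component[OF that(2)] by measurable
    then show "X i \<in> borel_measurable (Pi\<^sub>M W (\<lambda>_. complex_gaussian))"
      unfolding X_def[abs_def] by (cases i) (simp_all only: if_True if_False, auto intro!: borel_measurable_sum simp del: times_complex.sel)
    show "(\<integral>\<^sup>+\<zeta>. ennreal (exp (X i \<zeta>)) \<partial>Pi\<^sub>M W (\<lambda>_. complex_gaussian)) \<le> ennreal 2"
      using gprod_offdiag_mgf[OF assms(1) a2] gprod_diag_mgf[OF assms(1) b] 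
      by (cases i) (simp_all only: X_def if_True if_False)
  qed (auto simp: UNIV_bool)
  ultimately show ?thesis by presburger
qed

lemma gprod_quadratic_tail_Re:
  assumes [simp]: "finite W" and a: "(\<Sum>t\<in>W. \<Sum>u\<in>W. (cmod (a t u))\<^sup>2) \<le> F\<^sup>2" and "0 < F" "0 < \<delta>"
  shows "whp (Pi\<^sub>M W (\<lambda>_. complex_gaussian)) \<delta> (\<lambda>\<zeta>.
    Re (\<Sum>t\<in>W. \<Sum>u\<in>W. cnj (\<zeta> t) * a t u * \<zeta> u) \<le> 2 * Re (\<Sum>t\<in>W. a t t) + 12 * F * ln (2 / \<delta>))"
proof -
  define q where "q \<zeta> = Re (\<Sum>t\<in>W. \<Sum>u\<in>W. cnj (\<zeta> t) * a t u * \<zeta> u)" for \<zeta>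
  define T where "T = Re (\<Sum>t\<in>W. a t t)"
  \<comment> \<open>12 is the least integer whose square reaches 128, the normalization required by
    the moment bound.\<close>
  define c where "c = 1 / (12 * F)"
  have [measurable]: "q \<in> borel_measurable (Pi\<^sub>M W (\<lambda>_. complex_gaussian))"
    unfolding q_def using measurable_gprod_component[of _ W] by measurable
  have "(\<Sum>t\<in>W. \<Sum>u\<in>W. (cmod (of_real c * a t u))\<^sup>2) = c\<^sup>2 * (\<Sum>t\<in>W. \<Sum>u\<in>W. (cmod (a t u))\<^sup>2)"
    by (simp add: norm_mult power_mult_distrib sum_distrib_left)
  also have "\<dots> \<le> c\<^sup>2 * F\<^sup>2" using a by (intro mult_left_mono) auto
  also have "\<dots> \<le> 1 / 128" using \<open>0 < F\<close> by (simp add: c_def power_divide power_mult_distrib)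
  finally have "(\<integral>\<^sup>+\<zeta>. ennreal (exp (Re (\<Sum>t\<in>W. \<Sum>u\<in>W. cnj (\<zeta> t) * (of_real c * a t u) * \<zeta> u) - 2 * Re (\<Sum>t\<in>W. of_real c * a t t)))
      \<partial>Pi\<^sub>M W (\<lambda>_. complex_gaussian)) \<le> ennreal 2"
    by (intro gprod_quadratic_mgf) auto
  moreover have "Re (\<Sum>t\<in>W. \<Sum>u\<in>W. cnj (\<zeta> t) * (of_real c * a t u) * \<zeta> u) = c * q \<zeta>" for \<zeta>
  proof -
    have "(\<Sum>t\<in>W. \<Sum>u\<in>W. cnj (\<zeta> t) * (of_real c * a t u) * \<zeta> u) = c *\<^sub>R (\<Sum>t\<in>W. \<Sum>u\<in>W. cnj (\<zeta> t) * a t u * \<zeta> u)"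
      by (simp add: scaleR_conv_of_real sum_distrib_left mult_ac)
    then show ?thesis by (simp only: q_def scaleR_complex.sel)
  qed
  moreover have "Re (\<Sum>t\<in>W. of_real c * a t t) = c * T"
    by (simp add: T_def sum_distrib_left)
  ultimately have "(\<integral>\<^sup>+\<zeta>. ennreal (exp (c * q \<zeta> - 2 * (c * T))) \<partial>Pi\<^sub>M W (\<lambda>_. complex_gaussian)) \<le> ennreal 2"
    by (simp only:)
  then have "whp (Pi\<^sub>M W (\<lambda>_. complex_gaussian)) \<delta> (\<lambda>\<zeta>. c * q \<zeta> - 2 * (c * T) \<le> ln (2 / \<delta>))"
    using \<open>0 < \<delta>\<close> by (intro whp_le exp_Markov) auto
  moreover have "c * q \<zeta> - 2 * (c * T) \<le> ln (2 / \<delta>) \<longleftrightarrow> q \<zeta> \<le> 2 * T + 12 * F * ln (2 / \<delta>)" for \<zeta>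
    using \<open>0 < F\<close> by (simp add: c_def field_simps)
  ultimately show ?thesis by (simp only: q_def T_def)
qed

lemma cmod_le_rotations:
  assumes "\<And>k. k < 4 \<Longrightarrow> Re (\<i> ^ k * z) \<le> B" shows "cmod z \<le> 2 * B"
proof -
  have "\<bar>Re z\<bar> \<le> B" "\<bar>Im z\<bar> \<le> B"
    using assms[of 0] assms[of 1] assms[of 2] assms[of 3] by (auto simp: power3_eq_cube)
  then show ?thesis using cmod_le[of z] by linarith
qed

text \<open>One-sided bounds for the four rotations \<open>\<i> ^ k\<close>, at failure probability
  \<delta> / 4 each (hence 8 / \<delta>), control real and imaginary part in both signs. Passing to
  the modulus doubles both terms.\<close>

lemma gprod_quadratic_tail:
  assumes [simp]: "finite W" and a: "(\<Sum>t\<in>W. \<Sum>u\<in>W. (cmod (a t u))\<^sup>2) \<le> F\<^sup>2" and "0 < F" "0 < \<delta>"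
  shows "whp (Pi\<^sub>M W (\<lambda>_. complex_gaussian)) \<delta>
    (\<lambda>\<zeta>. cmod (\<Sum>t\<in>W. \<Sum>u\<in>W. cnj (\<zeta> t) * a t u * \<zeta> u) \<le> 4 * cmod (\<Sum>t\<in>W. a t t) + 24 * F * ln (8 / \<delta>))"
proof -
  let ?P = "Pi\<^sub>M W (\<lambda>_. complex_gaussian)"
  let ?q = "\<lambda>k \<zeta>. Re (\<Sum>t\<in>W. \<Sum>u\<in>W. cnj (\<zeta> t) * (\<i> ^ k * a t u) * \<zeta> u)"
  have "whp ?P (\<delta> / 4) (\<lambda>\<zeta>. ?q k \<zeta> \<le> 2 * Re (\<Sum>t\<in>W. \<i> ^ k * a t t) + 12 * F * ln (8 / \<delta>))" for k :: nat
  proof -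
    have "whp ?P (\<delta> / 4) (\<lambda>\<zeta>. ?q k \<zeta> \<le> 2 * Re (\<Sum>t\<in>W. \<i> ^ k * a t t) + 12 * F * ln (2 / (\<delta> / 4)))"
      by (rule gprod_quadratic_tail_Re) (use assms in \<open>auto simp: norm_mult norm_power\<close>)
    moreover have "2 / (\<delta> / 4) = 8 / \<delta>" by simp
    ultimately show ?thesis by (simp only:)
  qed
  then have "whp ?P (\<Sum>k<4::nat. \<delta> / 4) (\<lambda>\<zeta>. \<forall>k\<in>{..<4}. ?q k \<zeta> \<le> 2 * Re (\<Sum>t\<in>W. \<i> ^ k * a t t) + 12 * F * ln (8 / \<delta>))"
    using \<open>0 < \<delta>\<close> by (intro whp_ball) auto
  then show ?thesis
  proof (rule whp_mono)
    fix \<zeta> assume *: "\<forall>k\<in>{..<4}. ?q k \<zeta> \<le> 2 * Re (\<Sum>t\<in>W. \<i> ^ k * a t t) + 12 * F * ln (8 / \<delta>)"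
    have "cmod (\<Sum>t\<in>W. \<Sum>u\<in>W. cnj (\<zeta> t) * a t u * \<zeta> u) \<le> 2 * (2 * cmod (\<Sum>t\<in>W. a t t) + 12 * F * ln (8 / \<delta>))"
    proof (rule cmod_le_rotations)
      fix k :: nat assume "k < 4"
      with * have le: "?q k \<zeta> \<le> 2 * Re (\<Sum>t\<in>W. \<i> ^ k * a t t) + 12 * F * ln (8 / \<delta>)" by blast
      have q: "(\<Sum>t\<in>W. \<Sum>u\<in>W. cnj (\<zeta> t) * (\<i> ^ k * a t u) * \<zeta> u) = \<i> ^ k * (\<Sum>t\<in>W. \<Sum>u\<in>W. cnj (\<zeta> t) * a t u * \<zeta> u)"
        by (simp add: sum_distrib_left mult_ac)
      have T: "Re (\<Sum>t\<in>W. \<i> ^ k * a t t) \<le> cmod (\<Sum>t\<in>W. a t t)"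
      proof -
        have "Re (\<Sum>t\<in>W. \<i> ^ k * a t t) \<le> cmod (\<Sum>t\<in>W. \<i> ^ k * a t t)" by (rule complex_Re_le_cmod)
        also have "\<dots> = cmod (\<i> ^ k * (\<Sum>t\<in>W. a t t))" by (simp only: sum_distrib_left)
        also have "\<dots> = cmod (\<Sum>t\<in>W. a t t)" by (simp add: norm_mult norm_power)
        finally show ?thesis .
      qed
      show "Re (\<i> ^ k * (\<Sum>t\<in>W. \<Sum>u\<in>W. cnj (\<zeta> t) * a t u * \<zeta> u)) \<le> 2 * cmod (\<Sum>t\<in>W. a t t) + 12 * F * ln (8 / \<delta>)"
        unfolding q[symmetric] by (rule order_trans[OF le add_right_mono[OF mult_left_mono[OF T]]]) simp
    qed
    then show "cmod (\<Sum>t\<in>W. \<Sum>u\<in>W. cnj (\<zeta> t) * a t u * \<zeta> u) \<le> 4 * cmod (\<Sum>t\<in>W. a t t) + 24 * F * ln (8 / \<delta>)"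
      by (rule order_trans) simp
  qed simp
qed

section \<open>Discrete Fourier transform and filters\<close>

lemma finite_window [simp]: "finite (window n)"
  by (simp add: window_def)

lemma card_window [simp]: "card (window n) = 2 * n + 1"
  by (simp add: window_def nat_add_distrib)

lemma sum_window_eq_lessThan:
  "(\<Sum>l\<in>window M. f l) = (\<Sum>k<2 * M + 1. f (int k - int M))"
  by (rule sum.reindex_bij_witness[of _ "\<lambda>k. int k - int M" "\<lambda>l. nat (l + int M)"])
     (auto simp: window_def)

section \<open>Roots of unity and their orthogonality\<close>

definition unity_root :: "nat \<Rightarrow> int \<Rightarrow> complex" where
  "unity_root N j = cis (2 * pi * of_int j / real N)"

lemma unity_root_0 [simp]: "unity_root N 0 = 1"
  by (simp add: unity_root_def)

lemma unity_root_add: "unity_root N (i + j) = unity_root N i * unity_root N j"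
  by (simp add: unity_root_def cis_mult algebra_simps add_divide_distrib)

lemma cnj_unity_root: "cnj (unity_root N j) = unity_root N (- j)"
  by (simp add: unity_root_def cis_cnj)

lemma unity_root_diff: "unity_root N (i - j) = unity_root N i * cnj (unity_root N j)"
  using unity_root_add[of N i "- j"] by (simp add: cnj_unity_root)

lemma norm_unity_root [simp]: "cmod (unity_root N j) = 1"
  by (simp add: unity_root_def)

lemma unity_root_mult_nat: "unity_root N (int k * d) = unity_root N d ^ k"
  by (simp add: unity_root_def Complex.DeMoivre mult_ac)

lemma unity_root_eq_1_iff: 
  assumes "0 < N" shows "unity_root N d = 1 \<longleftrightarrow> int N dvd d"
proof
  assume "unity_root N d = 1"
  then obtain k :: int where "2 * pi * of_int d / real N = of_int (2 * k) * pi"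
    unfolding unity_root_def cis_conv_exp by (auto simp: exp_eq_1)
  then have "real_of_int d = of_int (k * int N)" using assms by (simp add: field_simps)
  then show "int N dvd d" by (simp only: of_int_eq_iff dvd_triv_right)
next
  assume "int N dvd d"
  then obtain k where "d = int N * k" by auto
  then have "2 * pi * of_int d / real N = 2 * pi * of_int k" using assms by simp
  then show "unity_root N d = 1" by (simp only: unity_root_def cis_multiple_2pi Ints_of_int)
qed

lemma sum_unity_root_lessThan:
  assumes "0 < N"
  shows "(\<Sum>k<N. unity_root N (int k * d)) = (if int N dvd d then of_nat N else 0)"
proof (cases "int N dvd d")
  case True
  then have "unity_root N d = 1" using assms by (simp add: unity_root_eq_1_iff)
  then show ?thesis using True by (simp add: unity_root_mult_nat)
next
  case False
  have "unity_root N d ^ N = 1"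
    using unity_root_eq_1_iff[OF assms, of "int N * d"] by (simp add: unity_root_mult_nat)
  then show ?thesis using False assms
    by (simp add: unity_root_mult_nat geometric_sum unity_root_eq_1_iff)
qed

text \<open>The frequencies of \<open>dft\<close> start at 1. Compared with a start at 0 this
  multiplies the sum by \<open>unity_root N d\<close>, which is 1 whenever the sum is
  nonzero.\<close>

lemma sum_unity_root_atLeast1:
  assumes "0 < N"
  shows "(\<Sum>k=1..N. unity_root N (int k * d)) = (if int N dvd d then of_nat N else 0)"
proof -
  have "(\<Sum>k=1..N. unity_root N (int k * d)) = (\<Sum>k<N. unity_root N (int (Suc k) * d))"
    by (rule sum.reindex_bij_witness[of _ Suc "\<lambda>k. k - 1"]) auto
  also have "\<dots> = unity_root N d * (\<Sum>k<N. unity_root N (int k * d))"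
    by (simp add: unity_root_add algebra_simps sum_distrib_left)
  finally show ?thesis
    using unity_root_eq_1_iff[OF assms] by (simp add: sum_unity_root_lessThan[OF assms])
qed

lemma sum_unity_root_window:
  "(\<Sum>l\<in>window M. unity_root (2 * M + 1) (l * d)) = (if int (2 * M + 1) dvd d then of_nat (2 * M + 1) else 0)"
proof -
  have "(\<Sum>l\<in>window M. unity_root (2 * M + 1) (l * d)) =
    (\<Sum>k<2 * M + 1. unity_root (2 * M + 1) (int k * d) * unity_root (2 * M + 1) (- int M * d))"
    unfolding sum_window_eq_lessThan
    by (intro sum.cong refl) (simp add: left_diff_distrib unity_root_diff cnj_unity_root)
  also have "\<dots> = (\<Sum>k<2 * M + 1. unity_root (2 * M + 1) (int k * d)) * unity_root (2 * M + 1) (- int M * d)"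
    by (simp only: sum_distrib_right)
  also have "\<dots> = (if int (2 * M + 1) dvd d then of_nat (2 * M + 1) else 0)"
  proof (cases "int (2 * M + 1) dvd d")
    case True
    then have "unity_root (2 * M + 1) (- int M * d) = 1"
      by (subst unity_root_eq_1_iff) auto
    then show ?thesis by (simp only: sum_unity_root_lessThan) simp
  next
    case False then show ?thesis by (subst sum_unity_root_lessThan) auto
  qed
  finally show ?thesis .
qed

lemma dvd_int_iff_eq_0: "\<bar>d\<bar> < int N \<Longrightarrow> int N dvd d \<longleftrightarrow> d = 0"
  using dvd_imp_le_int[of d "int N"] by auto

section \<open>The unitary transform: inversion and Parseval's identity\<close>

lemma dft_eq:
  "dft m x k = complex_of_real (1 / sqrt (2 * real m + 1)) *
     (\<Sum>\<tau>\<in>window m. unity_root (2 * m + 1) (- (int k * \<tau>)) * x \<tau>)"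
proof -
  have "exp (- (2 * complex_of_real pi * \<i> * of_nat k * of_int \<tau> / (2 * of_nat m + 1))) =
     unity_root (2 * m + 1) (- (int k * \<tau>))" for \<tau>
    unfolding unity_root_def cis_conv_exp by (rule arg_cong[where f=exp]) (simp add: mult_ac)
  then show ?thesis by (simp add: dft_def)
qed

lemma dft_inversion:
  assumes "\<tau> \<in> window m"
  shows "(\<Sum>k=1..2 * m + 1. dft m \<phi> k * unity_root (2 * m + 1) (int k * \<tau>)) = complex_of_real (sqrt (2 * real m + 1)) * \<phi> \<tau>"
proof -
  define r where "r = complex_of_real (sqrt (2 * real m + 1))"
  have r: "r * r = of_nat (2 * m + 1)" "r \<noteq> 0"
    unfolding r_def of_real_mult[symmetric] by simp_all
  \<comment> \<open>Two points of the window differ by at most 2 m, so there is no aliasing modulo 2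
    m + 1.\<close>
  have dvd: "int (2 * m + 1) dvd (\<tau> - \<tau>') \<longleftrightarrow> \<tau>' = \<tau>" if "\<tau>' \<in> window m" for \<tau>'
    using assms that by (subst dvd_int_iff_eq_0) (auto simp: window_def)
  have "(\<Sum>k=1..2 * m + 1. dft m \<phi> k * unity_root (2 * m + 1) (int k * \<tau>)) =
    (\<Sum>k=1..2 * m + 1. \<Sum>\<tau>'\<in>window m. 1 / r * (\<phi> \<tau>' * unity_root (2 * m + 1) (int k * (\<tau> - \<tau>'))))"
    by (simp add: dft_eq r_def sum_distrib_left sum_distrib_right right_diff_distrib unity_root_diff cnj_unity_root mult_ac)
  also have "\<dots> = (\<Sum>\<tau>'\<in>window m. 1 / r * (\<phi> \<tau>' * (\<Sum>k=1..2 * m + 1. unity_root (2 * m + 1) (int k * (\<tau> - \<tau>')))))"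
    by (subst sum.swap) (simp only: sum_distrib_left)
  also have "\<dots> = (\<Sum>\<tau>'\<in>window m. if \<tau>' = \<tau> then 1 / r * (\<phi> \<tau> * of_nat (2 * m + 1)) else 0)"
    by (intro sum.cong refl) (subst sum_unity_root_atLeast1, auto simp only: dvd split: if_splits, auto)
  also have "\<dots> = 1 / r * (\<phi> \<tau> * (r * r))" using assms unfolding r(1) by simp
  also have "\<dots> = r * \<phi> \<tau>" using r(2) by simp
  finally show ?thesis by (simp add: r_def)
qed

lemma dft_parseval: "(\<Sum>k=1..2 * m + 1. (cmod (dft m \<phi> k))\<^sup>2) = (\<Sum>\<tau>\<in>window m. (cmod (\<phi> \<tau>))\<^sup>2)"
proof -
  define r where "r = complex_of_real (sqrt (2 * real m + 1))"
  have r: "r \<noteq> 0" by (simp add: r_def)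
  have "complex_of_real (\<Sum>k=1..2 * m + 1. (cmod (dft m \<phi> k))\<^sup>2) = (\<Sum>k=1..2 * m + 1. dft m \<phi> k * cnj (dft m \<phi> k))"
    unfolding of_real_sum complex_norm_square ..
  also have "\<dots> = (\<Sum>k=1..2 * m + 1. \<Sum>\<tau>\<in>window m. 1 / r * cnj (\<phi> \<tau>) * (dft m \<phi> k * unity_root (2 * m + 1) (int k * \<tau>)))"
  proof (intro sum.cong refl)
    fix k
    have "cnj (dft m \<phi> k) = (\<Sum>\<tau>\<in>window m. 1 / r * cnj (\<phi> \<tau>) * unity_root (2 * m + 1) (int k * \<tau>))"
      by (simp add: dft_eq r_def sum_distrib_left cnj_unity_root mult_ac)
    then show "dft m \<phi> k * cnj (dft m \<phi> k) = (\<Sum>\<tau>\<in>window m. 1 / r * cnj (\<phi> \<tau>) * (dft m \<phi> k * unity_root (2 * m + 1) (int k * \<tau>)))"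
      by (simp add: sum_distrib_left mult_ac)
  qed
  also have "\<dots> = (\<Sum>\<tau>\<in>window m. 1 / r * cnj (\<phi> \<tau>) * (\<Sum>k=1..2 * m + 1. dft m \<phi> k * unity_root (2 * m + 1) (int k * \<tau>)))"
    by (subst sum.swap) (simp only: sum_distrib_left)
  also have "\<dots> = (\<Sum>\<tau>\<in>window m. \<phi> \<tau> * cnj (\<phi> \<tau>))"
    by (intro sum.cong refl) (simp only: dft_inversion, use r in \<open>simp add: r_def\<close>)
  also have "\<dots> = complex_of_real (\<Sum>\<tau>\<in>window m. (cmod (\<phi> \<tau>))\<^sup>2)"
    unfolding of_real_sum complex_norm_square ..
  finally show ?thesis by (simp only: of_real_eq_iff)
qed

text \<open>By Parseval the left side is the l2 norm of the spectrum. This is how a bound on the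
  spectral l1 norm limits a filter in the time domain.\<close>

lemma seminorm2_le_dft_norm1: "seminorm2 m \<phi> \<le> dft_norm1 m \<phi>"
proof -
  have "seminorm2 m \<phi> = L2_set (\<lambda>k. cmod (dft m \<phi> k)) {1..2 * m + 1}"
    by (simp only: seminorm2_def L2_set_def dft_parseval)
  also have "\<dots> \<le> dft_norm1 m \<phi>" unfolding dft_norm1_def by (rule L2_set_le_sum) simp
  finally show ?thesis .
qed

lemma dft_norm1_nonneg: "0 \<le> dft_norm1 m \<phi>"
  by (simp add: dft_norm1_def sum_nonneg)

section \<open>Convolution with filters and its spectrum\<close>

lemma conv_filter:
  assumes "\<phi> \<in> filters m"
  shows "conv \<phi> y t = (\<Sum>\<tau>\<in>window m. \<phi> \<tau> * y (t - \<tau>))"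
proof -
  have "conv \<phi> y t = (\<Sum>\<^sub>\<infinity>\<tau>\<in>window m. \<phi> \<tau> * y (t - \<tau>))"
    unfolding conv_def by (rule infsum_cong_neutral) (use assms in \<open>auto simp: filters_def\<close>)
  then show ?thesis by simp
qed

lemma conv_in_filters:
  assumes "\<phi> \<in> filters m" "\<psi> \<in> filters m'" shows "conv \<phi> \<psi> \<in> filters (m + m')"
  unfolding filters_def mem_Collect_eq
proof (intro allI impI)
  fix \<tau> assume \<tau>: "\<tau> \<notin> window (m + m')"
  have "\<psi> (\<tau> - \<sigma>) = 0" if "\<sigma> \<in> window m" for \<sigma>
  proof -
    have "\<tau> - \<sigma> \<notin> window m'" using \<tau> that by (auto simp: window_def)
    then show ?thesis using assms(2) by (simp add: filters_def)
  qed
  then show "conv \<phi> \<psi> \<tau> = 0" by (simp add: conv_filter[OF assms(1)])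
qed

lemma filters_mono: "m \<le> m' \<Longrightarrow> filters m \<subseteq> filters m'"
  by (auto simp: filters_def window_def)

lemma sum_window_shift:
  assumes \<psi>: "\<psi> \<in> filters m'" and "\<bar>\<sigma>\<bar> + int m' \<le> int m"
  shows "(\<Sum>\<tau>\<in>window m. \<psi> (\<tau> - \<sigma>) * g \<tau>) = (\<Sum>\<rho>\<in>window m'. \<psi> \<rho> * g (\<rho> + \<sigma>))"
proof -
  have "(\<Sum>\<tau>\<in>window m. \<psi> (\<tau> - \<sigma>) * g \<tau>) = (\<Sum>\<tau>\<in>(\<lambda>\<rho>. \<rho> + \<sigma>) ` window m'. \<psi> (\<tau> - \<sigma>) * g \<tau>)"
  proof (rule sum.mono_neutral_right)
    show "(\<lambda>\<rho>. \<rho> + \<sigma>) ` window m' \<subseteq> window m" using assms by (auto simp: window_def)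
    show "\<forall>\<tau>\<in>window m - (\<lambda>\<rho>. \<rho> + \<sigma>) ` window m'. \<psi> (\<tau> - \<sigma>) * g \<tau> = 0"
    proof
      fix \<tau> assume \<tau>: "\<tau> \<in> window m - (\<lambda>\<rho>. \<rho> + \<sigma>) ` window m'"
      then have "\<tau> - \<sigma> \<notin> window m'" by (auto simp: image_iff dest!: bspec[of _ _ "\<tau> - \<sigma>"])
      then show "\<psi> (\<tau> - \<sigma>) * g \<tau> = 0" using \<psi> by (simp add: filters_def)
    qed
  qed simp
  also have "\<dots> = (\<Sum>\<rho>\<in>window m'. \<psi> \<rho> * g (\<rho> + \<sigma>))"
    by (subst sum.reindex) (auto simp: inj_on_def)
  finally show ?thesis .
qed

lemma conv_assoc:
  assumes \<phi>: "\<phi> \<in> filters m\<^sub>1" and \<psi>: "\<psi> \<in> filters m\<^sub>2"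
  shows "conv (conv \<phi> \<psi>) y t = conv \<phi> (conv \<psi> y) t"
proof -
  have "conv (conv \<phi> \<psi>) y t = (\<Sum>\<tau>\<in>window (m\<^sub>1 + m\<^sub>2). \<Sum>\<sigma>\<in>window m\<^sub>1. \<phi> \<sigma> * (\<psi> (\<tau> - \<sigma>) * y (t - \<tau>)))"
    by (simp add: conv_filter[OF conv_in_filters[OF \<phi> \<psi>]] conv_filter[OF \<phi>] sum_distrib_right mult.assoc)
  also have "\<dots> = (\<Sum>\<sigma>\<in>window m\<^sub>1. \<phi> \<sigma> * (\<Sum>\<tau>\<in>window (m\<^sub>1 + m\<^sub>2). \<psi> (\<tau> - \<sigma>) * y (t - \<tau>)))"
    by (subst sum.swap) (simp add: sum_distrib_left)
  also have "\<dots> = (\<Sum>\<sigma>\<in>window m\<^sub>1. \<phi> \<sigma> * (\<Sum>\<rho>\<in>window m\<^sub>2. \<psi> \<rho> * y (t - (\<rho> + \<sigma>))))"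
    by (intro sum.cong refl arg_cong2[where f = "(*)"] sum_window_shift[OF \<psi>]) (auto simp: window_def)
  finally show ?thesis by (simp add: conv_filter[OF \<phi>] conv_filter[OF \<psi>] algebra_simps)
qed

text \<open>The supports fit together into \<open>window m\<close>, so nothing wraps around and the
  linear convolution agrees with the cyclic one. The square root compensates for the unitary
  normalization of both factors.\<close>

lemma dft_conv:
  assumes \<phi>: "\<phi> \<in> filters m\<^sub>1" and \<psi>: "\<psi> \<in> filters m\<^sub>2" and m: "m\<^sub>1 + m\<^sub>2 \<le> m"
  shows "dft m (conv \<phi> \<psi>) k = sqrt (2 * real m + 1) * dft m \<phi> k * dft m \<psi> k"
proof -
  define r where "r = complex_of_real (sqrt (2 * real m + 1))"
  have r: "r \<noteq> 0" by (simp add: r_def)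
  define w where "w \<tau> = unity_root (2 * m + 1) (- (int k * \<tau>))" for \<tau>
  have w: "w (\<sigma> + \<tau>) = w \<sigma> * w \<tau>" for \<sigma> \<tau>
    unfolding w_def unity_root_add[symmetric] by (simp add: algebra_simps)
  have trunc: "(\<Sum>\<tau>\<in>window m. w \<tau> * \<psi> (\<tau> - \<sigma>)) = w \<sigma> * (\<Sum>\<tau>\<in>window m. w \<tau> * \<psi> \<tau>)" if "\<sigma> \<in> window m\<^sub>1" for \<sigma>
  proof -
    have \<sigma>: "\<bar>\<sigma>\<bar> + int m\<^sub>2 \<le> int m" using that m by (auto simp: window_def)
    have "(\<Sum>\<tau>\<in>window m. \<psi> (\<tau> - \<sigma>) * w \<tau>) = (\<Sum>\<rho>\<in>window m\<^sub>2. \<psi> \<rho> * w (\<rho> + \<sigma>))"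
      by (rule sum_window_shift[OF \<psi> \<sigma>])
    also have "\<dots> = w \<sigma> * (\<Sum>\<rho>\<in>window m\<^sub>2. w \<rho> * \<psi> \<rho>)" by (simp add: sum_distrib_left w mult_ac)
    also have "(\<Sum>\<rho>\<in>window m\<^sub>2. w \<rho> * \<psi> \<rho>) = (\<Sum>\<rho>\<in>window m. w \<rho> * \<psi> \<rho>)"
      by (rule sum.mono_neutral_left) (use \<psi> m in \<open>auto simp: filters_def window_def\<close>)
    finally show ?thesis by (simp add: mult_ac)
  qed
  have "(\<Sum>\<tau>\<in>window m. w \<tau> * conv \<phi> \<psi> \<tau>) = (\<Sum>\<tau>\<in>window m. \<Sum>\<sigma>\<in>window m\<^sub>1. \<phi> \<sigma> * (w \<tau> * \<psi> (\<tau> - \<sigma>)))"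
    by (simp add: conv_filter[OF \<phi>] sum_distrib_left mult_ac)
  also have "\<dots> = (\<Sum>\<sigma>\<in>window m\<^sub>1. \<phi> \<sigma> * (\<Sum>\<tau>\<in>window m. w \<tau> * \<psi> (\<tau> - \<sigma>)))"
    by (subst sum.swap) (simp add: sum_distrib_left)
  also have "\<dots> = (\<Sum>\<sigma>\<in>window m\<^sub>1. w \<sigma> * \<phi> \<sigma> * (\<Sum>\<tau>\<in>window m. w \<tau> * \<psi> \<tau>))"
    by (intro sum.cong refl) (simp add: trunc)
  also have "\<dots> = (\<Sum>\<sigma>\<in>window m\<^sub>1. w \<sigma> * \<phi> \<sigma>) * (\<Sum>\<tau>\<in>window m. w \<tau> * \<psi> \<tau>)"
    by (simp add: sum_distrib_right)
  also have "(\<Sum>\<sigma>\<in>window m\<^sub>1. w \<sigma> * \<phi> \<sigma>) = (\<Sum>\<sigma>\<in>window m. w \<sigma> * \<phi> \<sigma>)"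
    by (rule sum.mono_neutral_left) (use \<phi> m in \<open>auto simp: filters_def window_def\<close>)
  finally show ?thesis unfolding dft_eq r_def[symmetric] w_def[symmetric] using r by (simp add: r_def)
qed

text \<open>The spectrum of a self-convolution is a multiple of the squared spectrum, so its l1 norm
  becomes a squared l2 norm, which Parseval evaluates. Hence a filter of small energy yields one of
  small spectral l1 norm.\<close>

lemma dft_norm1_conv_self:
  assumes "\<phi> \<in> filters m\<^sub>0" "2 * m\<^sub>0 \<le> m"
  shows "dft_norm1 m (conv \<phi> \<phi>) = sqrt (2 * real m + 1) * (\<Sum>\<tau>\<in>window m\<^sub>0. (cmod (\<phi> \<tau>))\<^sup>2)"
proof -
  have "(\<Sum>\<tau>\<in>window m\<^sub>0. (cmod (\<phi> \<tau>))\<^sup>2) = (\<Sum>\<tau>\<in>window m. (cmod (\<phi> \<tau>))\<^sup>2)"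
    by (rule sum.mono_neutral_left) (use assms in \<open>auto simp: filters_def window_def\<close>)
  also have "sqrt (2 * real m + 1) * \<dots> = (\<Sum>k=1..2 * m + 1. cmod (dft m (conv \<phi> \<phi>) k))"
    unfolding dft_parseval[symmetric] sum_distrib_left
    by (intro sum.cong refl, subst dft_conv[OF assms(1,1)])
       (use assms in \<open>auto simp: norm_mult power2_eq_square\<close>)
  finally show ?thesis by (simp add: dft_norm1_def)
qed

text \<open>Filtering appears as a combination of modulated sums that do not involve the filter; the
  coefficients are exactly those measured by \<open>dft_norm1\<close>.\<close>

lemma conv_eq_sum_dft:
  assumes "\<phi> \<in> filters m"
  shows "sqrt (2 * real m + 1) * conv \<phi> y t =
    (\<Sum>k=1..2 * m + 1. dft m \<phi> k * (\<Sum>\<tau>\<in>window m. unity_root (2 * m + 1) (int k * \<tau>) * y (t - \<tau>)))"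
proof -
  have "sqrt (2 * real m + 1) * conv \<phi> y t = (\<Sum>\<tau>\<in>window m. (sqrt (2 * real m + 1) * \<phi> \<tau>) * y (t - \<tau>))"
    by (simp add: conv_filter[OF assms] sum_distrib_left mult_ac)
  also have "\<dots> = (\<Sum>\<tau>\<in>window m. (\<Sum>k=1..2 * m + 1. dft m \<phi> k * unity_root (2 * m + 1) (int k * \<tau>)) * y (t - \<tau>))"
    by (intro sum.cong refl) (subst dft_inversion, simp_all)
  also have "\<dots> = (\<Sum>k=1..2 * m + 1. dft m \<phi> k * (\<Sum>\<tau>\<in>window m. unity_root (2 * m + 1) (int k * \<tau>) * y (t - \<tau>)))"
    unfolding sum_distrib_left sum_distrib_right by (subst sum.swap) (simp add: mult_ac)
  finally show ?thesis .
qed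

section \<open>Trace of a compressed band matrix\<close>

lemma harm_le_ln: "0 < n \<Longrightarrow> harm n \<le> 1 + ln (real n)"
proof (induction n rule: nat_induct_non_zero)
  case 1
  then show ?case by (simp add: harm_def)
next
  case (Suc n)
  have "ln (real n / real (Suc n)) \<le> real n / real (Suc n) - 1"
    using Suc by (intro ln_le_minus_one) simp
  also have "\<dots> = - inverse (real (Suc n))" by (simp add: field_simps)
  finally have "inverse (real (Suc n)) \<le> ln (real (Suc n)) - ln (real n)"
    using Suc by (simp add: ln_div)
  then show ?case using Suc by (simp add: harm_Suc)
qed

text \<open>A weak form of Jordan's inequality. Halving the angle writes \<open>sin x\<close> as
  \<open>x\<close> times two cosines taken at angles up to pi / 4, each at least sqrt 2 / 2.\<close>

lemma sin_ge_half:
  assumes "0 \<le> x" "x \<le> pi / 2" shows "x / 2 \<le> sin x"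
proof (cases "x = 0")
  case False
  have c: "sqrt 2 / 2 \<le> cos y" if "0 \<le> y" "y \<le> pi / 4" for y
    using cos_monotone_0_pi_le[of y "pi / 4"] that by (simp add: cos_45)
  have "\<exists>z. 0 < z \<and> z < x / 2 \<and> sin (x / 2) - sin 0 = (x / 2 - 0) * cos z"
    by (rule MVT2) (use assms False in \<open>auto intro!: derivative_eq_intros\<close>)
  then obtain z where z: "0 < z" "z < x / 2" "sin (x / 2) = x / 2 * cos z" by auto
  have cz1: "sqrt 2 / 2 \<le> cos z" using assms z by (intro c) auto
  have cz2: "0 \<le> cos z" by (rule order_trans[OF _ cz1]) simp
  have "x / 2 = 2 * ((x / 2 * (sqrt 2 / 2)) * (sqrt 2 / 2))" by simp
  also have "\<dots> \<le> 2 * ((x / 2 * cos z) * cos (x / 2))"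
    using assms z cz1 cz2 c[of "x / 2"] by (intro mult_left_mono mult_mono mult_nonneg_nonneg) auto
  also have "\<dots> = sin x" using sin_double[of "x / 2"] z by simp
  finally show ?thesis .
qed simp

definition dirichlet :: "nat \<Rightarrow> nat \<Rightarrow> int \<Rightarrow> complex" where
  "dirichlet N m l = (\<Sum>\<tau>\<in>window m. unity_root N (- (l * \<tau>)))"

lemma norm_dirichlet_le_card: "cmod (dirichlet N m l) \<le> 2 * real m + 1"
proof -
  have "cmod (dirichlet N m l) \<le> (\<Sum>\<tau>\<in>window m. 1)"
    unfolding dirichlet_def by (rule order_trans[OF norm_sum]) simp
  then show ?thesis by simp
qed

text \<open>Multiplying by \<open>1 - unity_root N (- l)\<close> telescopes the geometric sum to two
  unimodular terms. The factor has modulus 2 sin (pi |l| / N), and the hypothesis on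
  \<open>l\<close> keeps this angle in the range where the sine has a linear lower bound.\<close>

lemma norm_dirichlet_le:
  assumes "l \<noteq> 0" "2 * \<bar>l\<bar> \<le> int N"
  shows "cmod (dirichlet N m l) \<le> real N / real_of_int \<bar>l\<bar>"
proof -
  have N: "0 < N" using assms by auto
  let ?z = "\<lambda>k::nat. unity_root N (- (l * (int k - int m)))"
  have "dirichlet N m l * (1 - unity_root N (- l)) = (\<Sum>k<2 * m + 1. ?z k - ?z (Suc k))"
    unfolding dirichlet_def sum_window_eq_lessThan sum_distrib_right
  proof (intro sum.cong refl)
    fix k
    have "?z (Suc k) = ?z k * unity_root N (- l)"
      unfolding unity_root_add[symmetric] by (simp add: algebra_simps)
    then show "?z k * (1 - unity_root N (- l)) = ?z k - ?z (Suc k)" by (simp add: algebra_simps)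
  qed
  also have "\<dots> = ?z 0 - ?z (2 * m + 1)" by (rule sum_lessThan_telescope')
  finally have "cmod (dirichlet N m l) * cmod (1 - unity_root N (- l)) = cmod (?z 0 - ?z (2 * m + 1))"
    by (simp only: norm_mult[symmetric])
  also have "\<dots> \<le> 1 + 1" by (rule order_trans[OF norm_triangle_ineq4]) simp
  finally have le: "cmod (dirichlet N m l) * cmod (1 - unity_root N (- l)) \<le> 2" by simp
  define x where "x = pi * real_of_int \<bar>l\<bar> / real N"
  have x: "0 < x" "x \<le> pi / 2"
  proof -
    show "0 < x" using N assms by (simp add: x_def)
    have "2 * real_of_int \<bar>l\<bar> \<le> real N" using assms(2) by linarith
    then have "pi * (2 * real_of_int \<bar>l\<bar>) \<le> pi * real N" by (intro mult_left_mono) auto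
    then show "x \<le> pi / 2" using N by (simp add: x_def field_simps)
  qed
  have "cmod (1 - unity_root N (- l)) = 2 * \<bar>sin (pi * of_int (- l) / real N)\<bar>"
    using dist_exp_i_1[of "2 * pi * of_int (- l) / real N"]
    unfolding unity_root_def cis_conv_exp by (simp add: norm_minus_commute)
  also have "\<bar>sin (pi * of_int (- l) / real N)\<bar> = sin x"
  proof -
    have "pi * of_int (- l) / real N = x \<or> pi * of_int (- l) / real N = - x"
      by (cases "l \<ge> 0") (auto simp: x_def)
    moreover have "0 \<le> sin x" using x by (intro sin_ge_zero) auto
    ultimately show ?thesis by auto
  qed
  finally have "x \<le> cmod (1 - unity_root N (- l))" using sin_ge_half[of x] x by simp
  then have "cmod (dirichlet N m l) * x \<le> 2"
    using le by (meson mult_left_mono norm_ge_zero order_trans)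
  then have "cmod (dirichlet N m l) \<le> 2 / x" using x by (simp add: field_simps)
  also have "\<dots> = (2 / pi) * (real N / real_of_int \<bar>l\<bar>)" by (simp add: x_def)
  also have "\<dots> \<le> 1 * (real N / real_of_int \<bar>l\<bar>)"
    using pi_gt3 by (intro mult_right_mono) auto
  finally show ?thesis by simp
qed

text \<open>The peak at 0 is bounded trivially, the other terms decay like 1 / |l|, and the two
  signs of \<open>l\<close> give two harmonic sums.\<close>

lemma sum_norm_dirichlet_le:
  assumes "m \<le> M" "0 < M"
  shows "(\<Sum>l\<in>window M. cmod (dirichlet (2 * M + 1) m l)) \<le> (2 * real M + 1) * (3 + 2 * ln (real M))"
proof -
  let ?D = "\<lambda>l. cmod (dirichlet (2 * M + 1) m l)"
  have "window M = insert 0 ({1..int M} \<union> uminus ` {1..int M})"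
  proof (intro equalityI subsetI)
    fix l assume "l \<in> window M"
    then show "l \<in> insert 0 ({1..int M} \<union> uminus ` {1..int M})"
      by (cases "l > 0"; cases "l = 0") (auto simp: window_def intro!: image_eqI[of _ _ "- l"])
  qed (auto simp: window_def)
  then have "(\<Sum>l\<in>window M. ?D l) = (\<Sum>l\<in>insert 0 ({1..int M} \<union> uminus ` {1..int M}). ?D l)"
    by (rule arg_cong)
  also have "\<dots> = ?D 0 + (\<Sum>l\<in>{1..int M} \<union> uminus ` {1..int M}. ?D l)"
    by (rule sum.insert) auto
  also have "(\<Sum>l\<in>{1..int M} \<union> uminus ` {1..int M}. ?D l) = (\<Sum>l\<in>{1..int M}. ?D l) + (\<Sum>l\<in>uminus ` {1..int M}. ?D l)"
    by (rule sum.union_disjoint) auto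
  also have "(\<Sum>l\<in>uminus ` {1..int M}. ?D l) = (\<Sum>l\<in>{1..int M}. ?D (- l))"
    by (subst sum.reindex) (auto simp: inj_on_def)
  also have "?D 0 + ((\<Sum>l\<in>{1..int M}. ?D l) + (\<Sum>l\<in>{1..int M}. ?D (- l))) \<le> (2 * real M + 1) + ((\<Sum>l\<in>{1..int M}. real (2 * M + 1) / real_of_int l) + (\<Sum>l\<in>{1..int M}. real (2 * M + 1) / real_of_int l))"
  proof (intro add_mono sum_mono)
    show "?D 0 \<le> 2 * real M + 1"
      using norm_dirichlet_le_card[of "2 * M + 1" m 0] assms by linarith
    show "?D l \<le> real (2 * M + 1) / real_of_int l" if "l \<in> {1..int M}" for l
      using norm_dirichlet_le[of l "2 * M + 1" m] that by (simp del: of_nat_add of_nat_mult)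
    show "?D (- l) \<le> real (2 * M + 1) / real_of_int l" if "l \<in> {1..int M}" for l
      using norm_dirichlet_le[of "- l" "2 * M + 1" m] that by (simp del: of_nat_add of_nat_mult)
  qed
  also have "(\<Sum>l\<in>{1..int M}. real (2 * M + 1) / real_of_int l) = (2 * real M + 1) * harm M"
  proof -
    have "(\<Sum>l\<in>{1..int M}. real (2 * M + 1) / real_of_int l) = (\<Sum>k=1..M. real (2 * M + 1) / real k)"
      by (rule sum.reindex_bij_witness[of _ int nat]) auto
    then show ?thesis by (simp add: harm_def sum_distrib_left field_simps)
  qed
  also have "(2 * real M + 1) + ((2 * real M + 1) * harm M + (2 * real M + 1) * harm M) = (2 * real M + 1) * (1 + 2 * harm M)"
    by (simp add: algebra_simps)
  also have "\<dots> \<le> (2 * real M + 1) * (3 + 2 * ln (real M))"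
    using harm_le_ln[OF assms(2)] by (intro mult_left_mono) auto
  finally show ?thesis .
qed

text \<open>Fourier inversion on the cyclic group of order 2 M + 1: the Dirichlet kernel is the
  transform of the indicator of the band. The hypothesis keeps \<open>d - \<tau>\<close> below the
  period, so \<open>d\<close> cannot alias into the band.\<close>

lemma dirichlet_expansion:
  assumes "\<bar>d\<bar> + int m < 2 * int M + 1"
  shows "(\<Sum>l\<in>window M. dirichlet (2 * M + 1) m l * unity_root (2 * M + 1) (l * d)) =
    (if d \<in> window m then of_nat (2 * M + 1) else 0)"
proof -
  have "(\<Sum>l\<in>window M. dirichlet (2 * M + 1) m l * unity_root (2 * M + 1) (l * d)) =
    (\<Sum>l\<in>window M. \<Sum>\<tau>\<in>window m. unity_root (2 * M + 1) (l * (d - \<tau>)))"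
    unfolding dirichlet_def sum_distrib_right unity_root_add[symmetric] by (simp add: algebra_simps)
  also have "\<dots> = (\<Sum>\<tau>\<in>window m. if \<tau> = d then of_nat (2 * M + 1) else 0)"
  proof (subst sum.swap, rule sum.cong[OF refl])
    fix \<tau> assume "\<tau> \<in> window m"
    then have "\<bar>d - \<tau>\<bar> < int (2 * M + 1)" using assms by (auto simp: window_def)
    then have "int (2 * M + 1) dvd (d - \<tau>) \<longleftrightarrow> \<tau> = d" by (subst dvd_int_iff_eq_0) auto
    then show "(\<Sum>l\<in>window M. unity_root (2 * M + 1) (l * (d - \<tau>))) = (if \<tau> = d then of_nat (2 * M + 1) else 0)"
      by (simp only: sum_unity_root_window)
  qed
  finally show ?thesis by (simp del: of_nat_Suc of_nat_add)
qed

text \<open>The band matrix is an average of the rank-one matrices \<^term>\<open>f t * cnj (f v)\<close> with unimodular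
  \<^term>\<open>f\<close>, weighted by the Dirichlet kernel, whose mean modulus is logarithmic.\<close>

lemma norm_trace_band_le:
  fixes Q :: "int \<Rightarrow> int \<Rightarrow> complex"
  assumes Q: "\<And>f. (\<And>t. cmod (f t) = 1) \<Longrightarrow>
      cmod (\<Sum>v\<in>window n. \<Sum>t\<in>window n. cnj (f v) * Q v t * f t) \<le> B"
    and e: "\<And>t v. e (t - v) = e t * cnj (e v)" "\<And>t. cmod (e t) = 1" and mn: "0 < m + n"
  shows "cmod (\<Sum>v\<in>window n. \<Sum>t\<in>window n. Q v t * (if t - v \<in> window m then e (t - v) else 0))
    \<le> B * (3 + 2 * ln (real (m + n)))"
proof -
  \<comment> \<open>Differences within \<open>window n\<close> reach 2 n and the band adds m, so the
    period 2 (m + n) + 1 is long enough.\<close>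
  define M where "M = m + n"
  let ?w = "unity_root (2 * M + 1)"
  let ?D = "dirichlet (2 * M + 1) m"
  let ?q = "\<lambda>l. \<Sum>v\<in>window n. \<Sum>t\<in>window n. cnj (e v * ?w (l * v)) * Q v t * (e t * ?w (l * t))"
  have q: "cmod (?q l) \<le> B" for l by (rule Q) (simp add: norm_mult e)
  have B: "0 \<le> B" using q[of 0] norm_ge_zero order_trans by blast
  have "of_nat (2 * M + 1) * (\<Sum>v\<in>window n. \<Sum>t\<in>window n. Q v t * (if t - v \<in> window m then e (t - v) else 0)) =
    (\<Sum>v\<in>window n. \<Sum>t\<in>window n. \<Sum>l\<in>window M. ?D l * (cnj (e v * ?w (l * v)) * Q v t * (e t * ?w (l * t))))"
    unfolding sum_distrib_left
  proof (intro sum.cong refl)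
    fix v t assume "v \<in> window n" "t \<in> window n"
    then have "\<bar>t - v\<bar> + int m < 2 * int M + 1" by (auto simp: window_def M_def)
    then have *: "(if t - v \<in> window m then of_nat (2 * M + 1) else 0) = (\<Sum>l\<in>window M. ?D l * ?w (l * (t - v)))"
      by (rule dirichlet_expansion[symmetric])
    have "of_nat (2 * M + 1) * (Q v t * (if t - v \<in> window m then e (t - v) else 0)) =
      (if t - v \<in> window m then of_nat (2 * M + 1) else 0) * (Q v t * (e t * cnj (e v)))"
      by (simp only: e) simp
    also have "\<dots> = (\<Sum>l\<in>window M. ?D l * (cnj (e v * ?w (l * v)) * Q v t * (e t * ?w (l * t))))"
      unfolding * sum_distrib_right
      by (intro sum.cong refl) (simp only: right_diff_distrib unity_root_diff complex_cnj_mult mult_ac)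
    finally show "of_nat (2 * M + 1) * (Q v t * (if t - v \<in> window m then e (t - v) else 0)) =
      (\<Sum>l\<in>window M. ?D l * (cnj (e v * ?w (l * v)) * Q v t * (e t * ?w (l * t))))" .
  qed
  also have "\<dots> = (\<Sum>l\<in>window M. ?D l * ?q l)"
    unfolding sum_distrib_left by (rule trans[OF sum.cong[OF refl sum.swap] sum.swap])
  finally have eq: "of_nat (2 * M + 1) * (\<Sum>v\<in>window n. \<Sum>t\<in>window n. Q v t * (if t - v \<in> window m then e (t - v) else 0)) =
    (\<Sum>l\<in>window M. ?D l * ?q l)" .
  have "real (2 * M + 1) * cmod (\<Sum>v\<in>window n. \<Sum>t\<in>window n. Q v t * (if t - v \<in> window m then e (t - v) else 0))
    = cmod (\<Sum>l\<in>window M. ?D l * ?q l)"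
    unfolding eq[symmetric] norm_mult norm_of_nat ..
  also have "\<dots> \<le> (\<Sum>l\<in>window M. cmod (?D l) * B)"
    by (intro order_trans[OF norm_sum] sum_mono) (simp only: norm_mult, intro mult_left_mono q norm_ge_zero)
  also have "\<dots> \<le> (2 * real M + 1) * (3 + 2 * ln (real M)) * B"
    unfolding sum_distrib_right[symmetric]
    using mn by (intro mult_right_mono sum_norm_dirichlet_le B) (auto simp: M_def)
  finally have "real (2 * M + 1) * cmod (\<Sum>v\<in>window n. \<Sum>t\<in>window n. Q v t * (if t - v \<in> window m then e (t - v) else 0))
    \<le> real (2 * M + 1) * (B * (3 + 2 * ln (real M)))" by (simp add: ac_simps)
  moreover have "0 < real (2 * M + 1)" by simp
  ultimately show ?thesis unfolding M_def[symmetric] by (simp only: mult_le_cancel_left_pos)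
qed

section \<open>Orthogonal projection kernels\<close>

definition hinner :: "'a set \<Rightarrow> ('a \<Rightarrow> complex) \<Rightarrow> ('a \<Rightarrow> complex) \<Rightarrow> complex" where
  "hinner W f g = (\<Sum>t\<in>W. cnj (f t) * g t)"

definition l2norm :: "'a set \<Rightarrow> ('a \<Rightarrow> complex) \<Rightarrow> real" where
  "l2norm W f = L2_set (\<lambda>t. cmod (f t)) W"

definition kernel_app :: "'a set \<Rightarrow> ('a \<Rightarrow> 'a \<Rightarrow> complex) \<Rightarrow> ('a \<Rightarrow> complex) \<Rightarrow> 'a \<Rightarrow> complex" where
  "kernel_app W P f t = (\<Sum>u\<in>W. P t u * f u)"

text \<open>A Hermitian idempotent matrix indexed by \<open>W\<close>, with no condition on entries
  outside. The explicit matrix, rather than a map onto a subspace, gives access to its trace and to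
  single rows.\<close>

definition orth_proj :: "'a set \<Rightarrow> ('a \<Rightarrow> 'a \<Rightarrow> complex) \<Rightarrow> bool" where
  "orth_proj W P \<longleftrightarrow> (\<forall>t\<in>W. \<forall>u\<in>W. cnj (P t u) = P u t) \<and>
     (\<forall>t\<in>W. \<forall>v\<in>W. (\<Sum>u\<in>W. P t u * P u v) = P t v)"

lemma l2norm_nonneg [simp]: "0 \<le> l2norm W f"
  by (simp add: l2norm_def)

lemma l2norm_power2: "(l2norm W f)\<^sup>2 = (\<Sum>t\<in>W. (cmod (f t))\<^sup>2)"
  by (simp add: l2norm_def L2_set_def sum_nonneg)

lemma l2norm_cong: "(\<And>t. t \<in> W \<Longrightarrow> f t = g t) \<Longrightarrow> l2norm W f = l2norm W g"
  unfolding l2norm_def by (rule L2_set_cong) auto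

lemma l2norm_add: "l2norm W (\<lambda>t. f t + g t) \<le> l2norm W f + l2norm W g"
  unfolding l2norm_def
  by (rule order_trans[OF L2_set_mono L2_set_triangle_ineq]) (auto intro: norm_triangle_ineq)

lemma l2norm_diff: "l2norm W (\<lambda>t. f t - g t) \<le> l2norm W f + l2norm W g"
  unfolding l2norm_def
  by (rule order_trans[OF L2_set_mono L2_set_triangle_ineq]) (auto intro: norm_triangle_ineq4)

lemma l2norm_cmult: "l2norm W (\<lambda>t. c * f t) = cmod c * l2norm W f"
  by (simp add: l2norm_def norm_mult L2_set_right_distrib)

lemma l2norm_sum: "l2norm W (\<lambda>t. \<Sum>i\<in>I. f i t) \<le> (\<Sum>i\<in>I. l2norm W (f i))"
proof (induction I rule: infinite_finite_induct)
  case (insert i I)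
  then show ?case using l2norm_add[of W "f i" "\<lambda>t. \<Sum>i\<in>I. f i t"] by simp
qed (simp_all add: l2norm_def L2_set_def)

lemma hinner_self: "hinner W f f = of_real ((l2norm W f)\<^sup>2)"
  unfolding l2norm_power2 of_real_sum complex_norm_square hinner_def by (simp add: mult.commute)

lemma hinner_cong: "(\<And>t. t \<in> W \<Longrightarrow> f t = f' t) \<Longrightarrow> (\<And>t. t \<in> W \<Longrightarrow> g t = g' t) \<Longrightarrow> hinner W f g = hinner W f' g'"
  unfolding hinner_def by (rule sum.cong) auto

lemma hinner_add_right: "hinner W f (\<lambda>t. g t + h t) = hinner W f g + hinner W f h"
  by (simp add: hinner_def ring_distribs sum.distrib)

lemma hinner_diff_right: "hinner W f (\<lambda>t. g t - h t) = hinner W f g - hinner W f h"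
  by (simp add: hinner_def ring_distribs sum_subtractf)

lemma hinner_add_left: "hinner W (\<lambda>t. g t + h t) f = hinner W g f + hinner W h f"
  by (simp add: hinner_def ring_distribs sum.distrib)

lemma cnj_hinner: "cnj (hinner W f g) = hinner W g f"
  by (simp add: hinner_def mult.commute)

lemma cmod_hinner_le: "cmod (hinner W f g) \<le> l2norm W f * l2norm W g"
proof -
  have "cmod (hinner W f g) \<le> (\<Sum>t\<in>W. \<bar>cmod (f t)\<bar> * \<bar>cmod (g t)\<bar>)"
    unfolding hinner_def by (rule order_trans[OF norm_sum]) (simp add: norm_mult)
  also have "\<dots> \<le> l2norm W f * l2norm W g"
    unfolding l2norm_def by (rule L2_set_mult_ineq)
  finally show ?thesis .
qed

lemma hinner_kernel_app:
  assumes "orth_proj W P"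
  shows "hinner W (kernel_app W P f) g = hinner W f (kernel_app W P g)"
proof -
  have "hinner W (kernel_app W P f) g = (\<Sum>t\<in>W. \<Sum>u\<in>W. cnj (f u) * (cnj (P t u) * g t))"
    by (simp add: hinner_def kernel_app_def sum_distrib_left sum_distrib_right mult_ac)
  also have "\<dots> = (\<Sum>u\<in>W. \<Sum>t\<in>W. cnj (f u) * (P u t * g t))"
    using assms by (subst sum.swap) (auto simp: orth_proj_def intro!: sum.cong)
  finally show ?thesis by (simp add: hinner_def kernel_app_def sum_distrib_left)
qed

lemma kernel_app_idem:
  assumes "orth_proj W P" "t \<in> W"
  shows "kernel_app W P (kernel_app W P f) t = kernel_app W P f t"
proof -
  have "kernel_app W P (kernel_app W P f) t = (\<Sum>u\<in>W. \<Sum>v\<in>W. P t u * P u v * f v)"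
    by (simp add: kernel_app_def sum_distrib_left mult_ac)
  also have "\<dots> = (\<Sum>v\<in>W. (\<Sum>u\<in>W. P t u * P u v) * f v)"
    by (subst sum.swap) (simp add: sum_distrib_right)
  also have "\<dots> = kernel_app W P f t"
    using assms by (auto simp: kernel_app_def orth_proj_def intro!: sum.cong)
  finally show ?thesis .
qed

lemma l2norm_kernel_app_le:
  assumes "orth_proj W P" shows "l2norm W (kernel_app W P f) \<le> l2norm W f"
proof -
  have "of_real ((l2norm W (kernel_app W P f))\<^sup>2) = hinner W f (kernel_app W P (kernel_app W P f))"
    by (simp only: hinner_self[symmetric] hinner_kernel_app[OF assms])
  also have "\<dots> = hinner W f (kernel_app W P f)"
    by (rule hinner_cong) (auto simp: kernel_app_idem[OF assms])
  finally have "(l2norm W (kernel_app W P f))\<^sup>2 = cmod (hinner W f (kernel_app W P f))"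
    by (metis abs_of_nonneg norm_of_real zero_le_power2)
  also have "\<dots> \<le> l2norm W f * l2norm W (kernel_app W P f)" by (rule cmod_hinner_le)
  finally show ?thesis
    by (cases "l2norm W (kernel_app W P f) = 0") (auto simp: power2_eq_square less_le)
qed

text \<open>The diagonal entry of P P = P, with P Hermitian. It ties the trace to row norms, both
  for selecting a row of small norm and for the size of projected noise.\<close>

lemma orth_proj_row_norm:
  assumes "orth_proj W P" "t \<in> W" shows "(\<Sum>u\<in>W. (cmod (P t u))\<^sup>2) = Re (P t t)"
proof -
  have "of_real (\<Sum>u\<in>W. (cmod (P t u))\<^sup>2) = (\<Sum>u\<in>W. P t u * P u t)"
    unfolding of_real_sum complex_norm_square
    using assms by (intro sum.cong refl) (auto simp: orth_proj_def)
  also have "\<dots> = P t t" using assms by (simp add: orth_proj_def)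
  finally show ?thesis by (metis Re_complex_of_real)
qed

definition compl_kernel :: "('a \<Rightarrow> 'a \<Rightarrow> complex) \<Rightarrow> 'a \<Rightarrow> 'a \<Rightarrow> complex" where
  "compl_kernel P t u = (if t = u then 1 else 0) - P t u"

lemma kernel_app_compl:
  assumes "finite W" "t \<in> W"
  shows "kernel_app W (compl_kernel P) f t = f t - kernel_app W P f t"
  using assms by (simp add: kernel_app_def compl_kernel_def left_diff_distrib sum_subtractf if_distrib[of "\<lambda>x. x * _"] cong: if_cong)

lemma orth_proj_compl:
  assumes [simp]: "finite W" and P: "orth_proj W P" shows "orth_proj W (compl_kernel P)"
  unfolding orth_proj_def
proof (intro conjI ballI)
  fix t v assume tv: "t \<in> W" "v \<in> W"
  show "cnj (compl_kernel P t v) = compl_kernel P v t"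
    using P tv by (auto simp: orth_proj_def compl_kernel_def)
  have "(\<Sum>u\<in>W. compl_kernel P t u * compl_kernel P u v) =
    compl_kernel P t v - (\<Sum>u\<in>W. P t u * compl_kernel P u v)"
    using kernel_app_compl[OF assms(1) tv(1), of P "\<lambda>u. compl_kernel P u v"] by (simp add: kernel_app_def)
  also have "(\<Sum>u\<in>W. P t u * compl_kernel P u v) = P t v - (\<Sum>u\<in>W. P t u * P u v)"
    using tv by (simp add: compl_kernel_def right_diff_distrib sum_subtractf if_distrib[of "\<lambda>x. _ * x"] cong: if_cong)
  also have "\<dots> = 0" using P tv by (simp add: orth_proj_def)
  finally show "(\<Sum>u\<in>W. compl_kernel P t u * compl_kernel P u v) = compl_kernel P t v" by simp
qed

text \<open>Gram-Schmidt in matrix form: each generator adds the rank-one projection onto its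
  residual \<open>r\<close>, or nothing if the residual vanishes on \<open>W\<close>. Sequences
  independent on the integers may become dependent on \<open>W\<close>, whence an inequality for the
  trace.\<close>

lemma ex_orth_proj:
  assumes "finite W" "finite B"
  shows "\<exists>P. orth_proj W P \<and> (\<Sum>t\<in>W. Re (P t t)) \<le> real (card B) \<and>
    (\<forall>b\<in>B. \<forall>t\<in>W. kernel_app W P b t = b t)"
  using assms(2)
proof (induction B)
  case empty
  show ?case by (rule exI[of _ "\<lambda>_ _. 0"]) (simp add: orth_proj_def)
next
  case (insert b B)
  then obtain P where P: "orth_proj W P" and tr: "(\<Sum>t\<in>W. Re (P t t)) \<le> real (card B)"
    and PB: "\<And>b t. b \<in> B \<Longrightarrow> t \<in> W \<Longrightarrow> kernel_app W P b t = b t" by blast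
  define r where "r t = b t - kernel_app W P b t" for t
  have Pr: "kernel_app W P r t = 0" if "t \<in> W" for t
  proof -
    have "kernel_app W P r t = kernel_app W P b t - kernel_app W P (kernel_app W P b) t"
      by (simp add: kernel_app_def[of W P r] r_def right_diff_distrib sum_subtractf)
         (simp add: kernel_app_def)
    then show ?thesis using kernel_app_idem[OF P that] by simp
  qed
  have rP: "hinner W r (kernel_app W P f) = 0" for f
    using hinner_kernel_app[OF P, of r f] Pr by (simp add: hinner_def)
  show ?case
  proof (cases "l2norm W r = 0")
    case True
    then have "(\<Sum>t\<in>W. (cmod (r t))\<^sup>2) = 0" by (simp flip: l2norm_power2)
    then have "\<forall>t\<in>W. r t = 0" using assms(1) by (simp add: sum_nonneg_eq_0_iff)
    then show ?thesis using P tr PB insert by (intro exI[of _ P]) (auto simp: r_def)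
  next
    case False
    define c where "c = complex_of_real (1 / (l2norm W r)\<^sup>2)"
    have c: "c * hinner W r r = 1" "cnj c = c"
      using False by (auto simp: c_def hinner_self simp flip: of_real_mult)
    define P' where "P' t u = P t u + c * r t * cnj (r u)" for t u
    have app: "kernel_app W P' f t = kernel_app W P f t + c * r t * hinner W r f" for f t
      by (simp add: kernel_app_def P'_def hinner_def ring_distribs sum.distrib sum_distrib_left mult_ac)
    have "orth_proj W P'"
      unfolding orth_proj_def
    proof (intro conjI ballI)
      fix t v assume tv: "t \<in> W" "v \<in> W"
      show "cnj (P' t v) = P' v t" using P tv c by (simp add: P'_def orth_proj_def mult_ac)
      have "(\<Sum>u\<in>W. P' t u * P' u v) = kernel_app W P' (\<lambda>u. P' u v) t" by (simp add: kernel_app_def)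
      also have "\<dots> = kernel_app W P (\<lambda>u. P u v) t + c * cnj (r v) * kernel_app W P r t
          + c * r t * (hinner W r (\<lambda>u. P u v) + cnj (r v) * (c * hinner W r r))"
        unfolding app by (simp add: kernel_app_def hinner_def P'_def ring_distribs sum.distrib sum_distrib_left mult_ac)
      also have "kernel_app W P (\<lambda>u. P u v) t = P t v" using P tv by (simp add: kernel_app_def orth_proj_def)
      also have "hinner W r (\<lambda>u. P u v) = cnj (kernel_app W P r v)"
        using P tv by (auto simp: hinner_def kernel_app_def orth_proj_def intro!: sum.cong)
      finally show "(\<Sum>u\<in>W. P' t u * P' u v) = P' t v"
        using c Pr tv by (simp add: P'_def mult_ac)
    qed
    moreover have "(\<Sum>t\<in>W. Re (P' t t)) \<le> real (card (insert b B))"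
    proof -
      have "Re (P' t t) = Re (P t t) + 1 / (l2norm W r)\<^sup>2 * (cmod (r t))\<^sup>2" for t
        by (simp add: P'_def c_def mult.assoc complex_mult_cnj cmod_power2)
      then have "(\<Sum>t\<in>W. Re (P' t t)) = (\<Sum>t\<in>W. Re (P t t)) + 1 / (l2norm W r)\<^sup>2 * (l2norm W r)\<^sup>2"
        by (simp only: sum.distrib l2norm_power2 sum_distrib_left)
      then show ?thesis using tr insert False by simp
    qed
    moreover have "kernel_app W P' b' t = b' t" if b': "b' \<in> insert b B" and t: "t \<in> W" for b' t
    proof (cases "b' = b")
      case True
      have "hinner W r b = hinner W r (\<lambda>t. r t + kernel_app W P b t)" by (simp add: r_def)
      then have "hinner W r b = hinner W r r" unfolding hinner_add_right rP by simp
      then have "kernel_app W P' b t = kernel_app W P b t + r t * (c * hinner W r r)"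
        by (simp add: app)
      then show ?thesis using True c(1) by (simp add: r_def)
    next
      case False
      then have "hinner W r b' = hinner W r (kernel_app W P b')"
        using b' by (intro hinner_cong) (auto simp: PB)
      then show ?thesis using False b' t by (simp add: app rP PB)
    qed
    ultimately show ?thesis by blast
  qed
qed

lemma subspace_orth_proj:
  assumes "finite W" and S: "cseq.subspace S" "cseq.dim S = s" "0 < s"
  obtains P where "orth_proj W P" "(\<Sum>t\<in>W. Re (P t t)) \<le> real s"
    "\<And>x t. x \<in> S \<Longrightarrow> t \<in> W \<Longrightarrow> kernel_app W P x t = x t"
proof -
  obtain B where B: "B \<subseteq> S" "S \<subseteq> cseq.span B" "card B = s"
    using cseq.basis_exists[of S] S by metis
  \<comment> \<open>An infinite basis would have cardinality 0, contradicting
    \<open>0 < s\<close>.\<close>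
  then have "finite B" using S card_ge_0_finite by blast
  with ex_orth_proj[OF assms(1)] B obtain P where P: "orth_proj W P" "(\<Sum>t\<in>W. Re (P t t)) \<le> real s"
    "\<And>x t. x \<in> B \<Longrightarrow> t \<in> W \<Longrightarrow> kernel_app W P x t = x t" by metis
  have "cseq.subspace {x. \<forall>t\<in>W. kernel_app W P x t = x t}"
    by (rule cseq.subspaceI)
       (auto simp: kernel_app_def ring_distribs sum.distrib mult.left_commute simp flip: sum_distrib_left)
  then have "cseq.span B \<subseteq> {x. \<forall>t\<in>W. kernel_app W P x t = x t}"
    using P by (intro cseq.span_minimal) auto
  then show ?thesis using that[of P] P B by blast
qed

section \<open>Reproducing filters of shift-invariant subspaces\<close>

lemma sum_fun_apply: "(\<Sum>i\<in>A. f i) t = (\<Sum>i\<in>A. f i t)"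
  for f :: "'i \<Rightarrow> 'a \<Rightarrow> 'b :: comm_monoid_add"
  by (induction A rule: infinite_finite_induct) auto

lemma shift_shift: "shift a (shift b x) = shift (a + b) x"
  by (simp add: shift_def fun_eq_iff algebra_simps)

lemma shift_0 [simp]: "shift 0 x = x"
  by (simp add: shift_def fun_eq_iff)

lemma module_hom_shift: "module_hom (\<lambda>(c::complex) (x::signal) t. c * x t) (\<lambda>c x t. c * x t) (shift k)"
  by unfold_locales (auto simp: shift_def fun_eq_iff)

text \<open>The delay is injective, so on a finite-dimensional invariant subspace it is onto.\<close>

lemma shift_closed_uminus:
  assumes S: "cseq.subspace S" "shift 1 ` S \<subseteq> S" "cseq.dim S = s" "0 < s" and y: "y \<in> S"
  shows "shift (- 1) y \<in> S"
proof -
  interpret vp: vector_space_pair "\<lambda>(c::complex) (x::signal) t. c * x t" "\<lambda>(c::complex) (x::signal) t. c * x t" ..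
  obtain B where B: "B \<subseteq> S" "cseq.independent B" "S \<subseteq> cseq.span B" "card B = s"
    using cseq.basis_exists[of S] S by metis
  then have fin: "finite B" using S card_ge_0_finite by blast
  have inj: "inj (shift 1)"
    by (rule inj_on_inverseI[of _ "shift (- 1)"]) (simp add: shift_def fun_eq_iff)
  have ind: "cseq.independent (shift 1 ` B)"
    by (rule vp.linear_independent_injective_image)
       (use B module_hom_shift inj in \<open>auto simp: module_hom_iff_linear intro: inj_on_subset\<close>)
  have card: "card (shift 1 ` B) = s" using B inj by (metis card_image inj_on_subset subset_UNIV)
  have "y \<in> cseq.span (shift 1 ` B)"
  proof (rule ccontr)
    assume n: "y \<notin> cseq.span (shift 1 ` B)"
    then have "cseq.independent (insert y (shift 1 ` B))" using ind by (rule cseq.independent_insertI)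
    moreover have "insert y (shift 1 ` B) \<subseteq> cseq.span B" using B S y by blast
    ultimately have "card (insert y (shift 1 ` B)) \<le> card B"
      using cseq.independent_span_bound[OF fin] by blast
    moreover have "y \<notin> shift 1 ` B" using n cseq.span_base by blast
    ultimately show False using card fin B by simp
  qed
  also have "cseq.span (shift 1 ` B) = shift 1 ` cseq.span B"
    by (rule vp.linear_span_image) (use module_hom_shift in \<open>simp add: module_hom_iff_linear\<close>)
  also have "\<dots> \<subseteq> shift 1 ` S" using B S by (intro image_mono cseq.span_minimal) auto
  finally obtain x where "x \<in> S" "y = shift 1 x" by auto
  then show ?thesis by (simp add: shift_shift)
qed

lemma shift_closed:
  assumes S: "cseq.subspace S" "shift 1 ` S \<subseteq> S" "cseq.dim S = s" "0 < s" and x: "x \<in> S"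
  shows "shift k x \<in> S"
proof (induction k rule: int_induct[of _ 0])
  case base
  then show ?case using x by (simp add: shift_def)
next
  case (step1 i)
  then have "shift 1 (shift i x) \<in> S" using S by blast
  then show ?case by (simp add: shift_shift add.commute)
next
  case (step2 i)
  then have "shift (- 1) (shift i x) \<in> S" using shift_closed_uminus[OF S] by blast
  then show ?case by (simp add: shift_shift)
qed

lemma conv_closed:
  assumes S: "cseq.subspace S" "shift 1 ` S \<subseteq> S" "cseq.dim S = s" "0 < s" and x: "x \<in> S"
    and \<phi>: "\<phi> \<in> filters m"
  shows "conv \<phi> x \<in> S"
proof -
  have "(\<Sum>\<tau>\<in>window m. (\<lambda>t. \<phi> \<tau> * shift \<tau> x t)) \<in> S"
    using S shift_closed[OF S x] by (intro cseq.subspace_sum cseq.subspace_scale) auto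
  also have "(\<Sum>\<tau>\<in>window m. (\<lambda>t. \<phi> \<tau> * shift \<tau> x t)) = conv \<phi> x"
    by (rule ext) (simp add: sum_fun_apply conv_filter[OF \<phi>] shift_def)
  finally show ?thesis .
qed

text \<open>The change of variables j = i - \<tau> that reads row \<open>i\<close> of a matrix on
  {0..k} as a filter; its lags lie in \<open>window k\<close> for every position of
  \<open>i\<close>.\<close>

lemma sum_window_reflect:
  fixes g :: "int \<Rightarrow> 'z :: comm_monoid_add"
  assumes "i \<in> {0..int k}"
  shows "(\<Sum>\<tau>\<in>window k. if i - \<tau> \<in> {0..int k} then g (i - \<tau>) else 0) = (\<Sum>j\<in>{0..int k}. g j)"
proof -
  have "(\<Sum>\<tau>\<in>window k. if i - \<tau> \<in> {0..int k} then g (i - \<tau>) else 0) = (\<Sum>\<tau>\<in>{\<tau> \<in> window k. i - \<tau> \<in> {0..int k}}. g (i - \<tau>))"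
    by (simp add: sum.inter_filter)
  also have "\<dots> = (\<Sum>j\<in>{0..int k}. g j)"
    by (rule sum.reindex_bij_witness[of _ "\<lambda>j. i - j" "\<lambda>\<tau>. i - \<tau>"]) (use assms in \<open>auto simp: window_def\<close>)
  finally show ?thesis .
qed

text \<open>A row of the projection onto \<open>S\<close> restricted to a window of \<^term>\<open>m div 2 + 1\<close> points reproduces \<open>S\<close>;
  the row with the smallest diagonal entry has small norm, and convolving it with itself turns
  this into a bound on the spectral \<open>\<ell>\<^sub>1\<close> norm.\<close>

lemma reproducing_filter:
  assumes S: "cseq.subspace S" "shift 1 ` S \<subseteq> S" "cseq.dim S = s" "0 < s"
  obtains \<phi> where "\<phi> \<in> filters m" "\<And>x t. x \<in> S \<Longrightarrow> conv \<phi> x t = x t"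
    "dft_norm1 m \<phi> \<le> 4 * real s / sqrt (2 * real m + 1)"
proof -
  \<comment> \<open>The self-convolution of a filter supported in \<open>window k\<close> must fit
    into \<open>window m\<close>.\<close>
  define k where "k = m div 2"
  define W where "W = {0..int k}"
  have [simp]: "finite W" "card W = k + 1" by (simp_all add: W_def nat_add_distrib)
  obtain P where P: "orth_proj W P" "(\<Sum>t\<in>W. Re (P t t)) \<le> real s"
    "\<And>x t. x \<in> S \<Longrightarrow> t \<in> W \<Longrightarrow> kernel_app W P x t = x t"
    using subspace_orth_proj[OF \<open>finite W\<close> S(1,3,4)] by blast
  obtain i where i: "i \<in> W" "Re (P i i) \<le> real s / (real k + 1)"
  proof (rule ccontr)
    assume "\<not> thesis"
    then have gt: "\<And>t. t \<in> W \<Longrightarrow> real s / (real k + 1) < Re (P t t)" using that by force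
    have "real s = (\<Sum>t\<in>W. real s / (real k + 1))" by (simp add: field_simps)
    also have "\<dots> < (\<Sum>t\<in>W. Re (P t t))" by (rule sum_strict_mono) (use gt in \<open>auto simp: W_def\<close>)
    finally show False using P by simp
  qed
  define \<psi> where "\<psi> \<tau> = (if i - \<tau> \<in> W then P i (i - \<tau>) else 0)" for \<tau>
  have \<psi>: "\<psi> \<in> filters k" using i by (auto simp: \<psi>_def filters_def W_def window_def)
  note sum_\<psi> = sum_window_reflect[of i k, folded W_def, OF i(1)]
  have repr: "conv \<psi> x t = x t" if x: "x \<in> S" for x t
  proof -
    \<comment> \<open>Shifting by \<open>i - t\<close> moves the point \<open>t\<close> to position
      \<open>i\<close>, and the shifted sequence is still in \<open>S\<close>; hence one row
      reproduces all values.\<close>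
    have "conv \<psi> x t = (\<Sum>\<tau>\<in>window k. if i - \<tau> \<in> W then P i (i - \<tau>) * shift (i - t) x (i - \<tau>) else 0)"
      by (auto simp: conv_filter[OF \<psi>] \<psi>_def shift_def intro!: sum.cong)
    also have "\<dots> = (\<Sum>j\<in>W. P i j * shift (i - t) x j)" by (rule sum_\<psi>)
    also have "\<dots> = kernel_app W P (shift (i - t) x) i" by (simp add: kernel_app_def)
    also have "\<dots> = shift (i - t) x i" by (rule P(3)[OF shift_closed[OF S x] i(1)])
    finally show ?thesis by (simp add: shift_def)
  qed
  have "(\<Sum>\<tau>\<in>window k. (cmod (\<psi> \<tau>))\<^sup>2) = (\<Sum>\<tau>\<in>window k. if i - \<tau> \<in> W then (cmod (P i (i - \<tau>)))\<^sup>2 else 0)"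
    by (intro sum.cong) (auto simp: \<psi>_def)
  also have "\<dots> = (\<Sum>j\<in>W. (cmod (P i j))\<^sup>2)" by (rule sum_\<psi>)
  also have "\<dots> = Re (P i i)" by (rule orth_proj_row_norm[OF P(1) i(1)])
  finally have norm: "(\<Sum>\<tau>\<in>window k. (cmod (\<psi> \<tau>))\<^sup>2) \<le> real s / (real k + 1)" using i by simp
  have k: "2 * k \<le> m" "m \<le> 2 * k + 1" by (auto simp: k_def)
  show ?thesis
  proof
    show "conv \<psi> \<psi> \<in> filters m" using conv_in_filters[OF \<psi> \<psi>] filters_mono[of "k + k" m] k by auto
    show "conv (conv \<psi> \<psi>) x t = x t" if "x \<in> S" for x t
    proof -
      have "conv \<psi> x = x" using repr[OF that] by blast
      then show ?thesis using repr[OF that] by (simp add: conv_assoc[OF \<psi> \<psi>])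
    qed
    have "dft_norm1 m (conv \<psi> \<psi>) \<le> sqrt (2 * real m + 1) * (real s / (real k + 1))"
      using norm unfolding dft_norm1_conv_self[OF \<psi> k(1)] by (intro mult_left_mono) auto
    also have "\<dots> \<le> 4 * real s / sqrt (2 * real m + 1)"
    proof -
      \<comment> \<open>From m \<le> 2 k + 1 one gets 2 m + 1 \<le> 4 k + 3. This is the origin of
        the 4 in the threshold 4 s.\<close>
      have "sqrt (2 * real m + 1) * sqrt (2 * real m + 1) \<le> 4 * (real k + 1)" using k by simp
      then have "real s * (sqrt (2 * real m + 1) * sqrt (2 * real m + 1)) \<le> real s * (4 * (real k + 1))"
        by (rule mult_left_mono) simp
      then show ?thesis by (simp add: field_simps del: real_sqrt_mult_self)
    qed
    finally show "dft_norm1 m (conv \<psi> \<psi>) \<le> 4 * real s / sqrt (2 * real m + 1)" .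
  qed
qed

section \<open>Deviation bounds for the noise\<close>

lemma window_mono: "n \<le> N \<Longrightarrow> window n \<subseteq> window N"
  by (auto simp: window_def)

lemma sum_band:
  fixes g y :: signal
  assumes "t \<in> window n"
  shows "(\<Sum>\<tau>\<in>window m. g \<tau> * y (t - \<tau>)) = (\<Sum>u\<in>window (m + n). (if t - u \<in> window m then g (t - u) else 0) * y u)"
proof -
  have "(\<Sum>u\<in>window (m + n). (if t - u \<in> window m then g (t - u) else 0) * y u) =
    (\<Sum>u\<in>{u \<in> window (m + n). t - u \<in> window m}. g (t - u) * y u)"
    by (simp add: sum.inter_filter if_distrib[of "\<lambda>x. x * _"] cong: if_cong)
  also have "\<dots> = (\<Sum>\<tau>\<in>window m. g \<tau> * y (t - \<tau>))"
    by (rule sum.reindex_bij_witness[of _ "\<lambda>\<tau>. t - \<tau>" "\<lambda>u. t - u"]) (use assms in \<open>auto simp: window_def\<close>)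
  finally show ?thesis by simp
qed

lemma sum_band_norm:
  fixes f :: "int \<Rightarrow> real"
  assumes "t \<in> window n"
  shows "(\<Sum>u\<in>window (m + n). if t - u \<in> window m then f (t - u) else 0) = (\<Sum>\<tau>\<in>window m. f \<tau>)"
proof -
  have "(\<Sum>u\<in>window (m + n). if t - u \<in> window m then f (t - u) else 0) = (\<Sum>u\<in>{u \<in> window (m + n). t - u \<in> window m}. f (t - u))"
    by (simp add: sum.inter_filter)
  also have "\<dots> = (\<Sum>\<tau>\<in>window m. f \<tau>)"
    by (rule sum.reindex_bij_witness[of _ "\<lambda>\<tau>. t - \<tau>" "\<lambda>u. t - u"]) (use assms in \<open>auto simp: window_def\<close>)
  finally show ?thesis .
qed

lemma whp_noise_sum_squares:
  fixes a :: "'i \<Rightarrow> int \<Rightarrow> complex"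
  assumes "finite I" "W \<subseteq> window N" and B: "(\<Sum>i\<in>I. \<Sum>u\<in>W. (cmod (a i u))\<^sup>2) \<le> B" and "0 < \<delta>"
  shows "whp (noise N) \<delta> (\<lambda>\<zeta>. (\<Sum>i\<in>I. (cmod (\<Sum>u\<in>W. a i u * \<zeta> u))\<^sup>2) \<le> 4 * B * ln (2 / \<delta>))"
proof -
  have "whp (noise N) \<delta> (\<lambda>\<zeta>. (\<Sum>i\<in>I. (cmod (\<Sum>u\<in>window N. (if u \<in> W then a i u else 0) * \<zeta> u))\<^sup>2) \<le> 4 * B * ln (2 / \<delta>))"
    unfolding noise_def
  proof (rule gprod_sum_squares_tail)
    have "(\<Sum>u\<in>window N. (cmod (if u \<in> W then a i u else 0))\<^sup>2) = (\<Sum>u\<in>W. (cmod (a i u))\<^sup>2)" for i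
      using assms(2) by (intro sum.mono_neutral_cong_right) auto
    then show "(\<Sum>i\<in>I. \<Sum>u\<in>window N. (cmod (if u \<in> W then a i u else 0))\<^sup>2) \<le> B" using B by simp
  qed (use assms in auto)
  moreover have "(\<Sum>u\<in>window N. (if u \<in> W then a i u else 0) * \<zeta> u) = (\<Sum>u\<in>W. a i u * \<zeta> u)" for i and \<zeta> :: signal
    using assms(2) by (intro sum.mono_neutral_cong_right) auto
  ultimately show ?thesis by simp
qed

text \<open>The squared Frobenius norm of a projection is its trace, so the scale is s and not 2 n +
  1.\<close>

lemma whp_projection:
  assumes P: "orth_proj (window n) P" "(\<Sum>t\<in>window n. Re (P t t)) \<le> real s" and "0 < \<delta>"
  shows "whp (noise (m + n)) \<delta> (\<lambda>\<zeta>. (l2norm (window n) (kernel_app (window n) P \<zeta>))\<^sup>2 \<le> 4 * real s * ln (2 / \<delta>))"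
  unfolding l2norm_power2 kernel_app_def
  by (rule whp_noise_sum_squares) (use assms window_mono[of n "m + n"] in \<open>simp_all add: orth_proj_row_norm\<close>)

text \<open>Self-adjointness moves \<open>Q\<close> onto the deterministic vectors
  \<open>w i\<close>, whose norms it cannot increase. Controlling the sum of squares instead of the
  maximum avoids a union bound over \<open>I\<close>, hence a logarithm of its size.\<close>

lemma whp_inner:
  assumes Q: "orth_proj (window n) Q" and I: "finite I" and w: "\<And>i. i \<in> I \<Longrightarrow> l2norm (window n) (w i) \<le> b" and "0 < \<delta>"
  shows "whp (noise (m + n)) \<delta> (\<lambda>\<zeta>. (\<Sum>i\<in>I. (cmod (hinner (window n) (kernel_app (window n) Q \<zeta>) (w i)))\<^sup>2)
    \<le> 4 * (real (card I) * b\<^sup>2) * ln (2 / \<delta>))"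
proof -
  have eq: "cmod (hinner (window n) (kernel_app (window n) Q \<zeta>) (w i)) =
    cmod (\<Sum>u\<in>window n. cnj (kernel_app (window n) Q (w i) u) * \<zeta> u)" for \<zeta> i
  proof -
    have "hinner (window n) (kernel_app (window n) Q \<zeta>) (w i) = cnj (hinner (window n) (kernel_app (window n) Q (w i)) \<zeta>)"
      unfolding hinner_kernel_app[OF Q] cnj_hinner ..
    then show ?thesis by (simp only: complex_mod_cnj hinner_def)
  qed
  show ?thesis unfolding eq
  proof (rule whp_noise_sum_squares)
    have "(\<Sum>u\<in>window n. (cmod (cnj (kernel_app (window n) Q (w i) u)))\<^sup>2) \<le> b\<^sup>2" if "i \<in> I" for i
    proof -
      have "l2norm (window n) (kernel_app (window n) Q (w i)) \<le> b"
        using l2norm_kernel_app_le[OF Q] w[OF that] by (rule order_trans)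
      then have "(l2norm (window n) (kernel_app (window n) Q (w i)))\<^sup>2 \<le> b\<^sup>2" by (intro power_mono) auto
      then show ?thesis by (simp add: l2norm_power2)
    qed
    then show "(\<Sum>i\<in>I. \<Sum>u\<in>window n. (cmod (cnj (kernel_app (window n) Q (w i) u)))\<^sup>2) \<le> real (card I) * b\<^sup>2"
      by (rule sum_bounded_above)
  qed (use assms window_mono[of n "m + n"] in auto)
qed

text \<open>The filter is fixed before the noise, so this serves the oracle and not the
  estimate.\<close>

lemma whp_filtered_noise:
  assumes \<phi>: "\<phi> \<in> filters m" and "0 < \<delta>"
  shows "whp (noise (m + n)) \<delta> (\<lambda>\<zeta>. (l2norm (window n) (conv \<phi> \<zeta>))\<^sup>2
    \<le> 4 * ((2 * real n + 1) * (seminorm2 m \<phi>)\<^sup>2) * ln (2 / \<delta>))"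
proof -
  have sq: "(seminorm2 m \<phi>)\<^sup>2 = (\<Sum>\<tau>\<in>window m. (cmod (\<phi> \<tau>))\<^sup>2)"
    by (simp add: seminorm2_def L2_set_def sum_nonneg)
  let ?a = "\<lambda>t u. if t - u \<in> window m then \<phi> (t - u) else 0"
  have "whp (noise (m + n)) \<delta> (\<lambda>\<zeta>. (\<Sum>t\<in>window n. (cmod (\<Sum>u\<in>window (m + n). ?a t u * \<zeta> u))\<^sup>2)
    \<le> 4 * ((2 * real n + 1) * (seminorm2 m \<phi>)\<^sup>2) * ln (2 / \<delta>))"
  proof (rule whp_noise_sum_squares)
    have "(\<Sum>u\<in>window (m + n). (cmod (?a t u))\<^sup>2) = (seminorm2 m \<phi>)\<^sup>2" if "t \<in> window n" for t
      using sum_band_norm[OF that, where f = "\<lambda>\<tau>. (cmod (\<phi> \<tau>))\<^sup>2"] unfolding sq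
      by (simp add: if_distrib[of cmod] if_distrib[of "\<lambda>x. x\<^sup>2"] cong: if_cong)
    then show "(\<Sum>t\<in>window n. \<Sum>u\<in>window (m + n). (cmod (?a t u))\<^sup>2) \<le> (2 * real n + 1) * (seminorm2 m \<phi>)\<^sup>2"
      by (simp add: add.commute)
  qed (use assms in auto)
  moreover have "(\<Sum>t\<in>window n. (cmod (\<Sum>u\<in>window (m + n). ?a t u * \<zeta> u))\<^sup>2) = (l2norm (window n) (conv \<phi> \<zeta>))\<^sup>2" for \<zeta>
    unfolding l2norm_power2 by (intro sum.cong refl) (simp only: conv_filter[OF \<phi>] sum_band)
  ultimately show ?thesis by simp
qed

text \<open>The matrix is \<open>Q\<close> times a band matrix with 2 n + 1 rows of 2 m + 1
  unimodular entries, and applying \<open>Q\<close> to its columns does not increase the Frobenius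
  norm. The trace is handled by \<open>norm_trace_band_le\<close>.\<close>

lemma whp_modulated_noise:
  assumes Q: "orth_proj (window n) Q" and "0 < \<delta>" and mn: "0 < m + n"
  shows "whp (noise (m + n)) \<delta> (\<lambda>\<zeta>.
    cmod (hinner (window n) (kernel_app (window n) Q \<zeta>) (\<lambda>t. \<Sum>\<tau>\<in>window m. unity_root (2 * m + 1) (int k * \<tau>) * \<zeta> (t - \<tau>)))
    \<le> 4 * ((2 * real n + 1) * (3 + 2 * ln (real (m + n)))) + 24 * sqrt ((2 * real n + 1) * (2 * real m + 1)) * ln (8 / \<delta>))"
proof -
  let ?W = "window n" and ?U = "window (m + n)"
  define e where "e \<tau> = unity_root (2 * m + 1) (int k * \<tau>)" for \<tau>
  define b where "b t u = (if t - u \<in> window m then e (t - u) else 0)" for t u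
  \<comment> \<open>Rows are padded with zeros, so that the form becomes a square matrix acting on
    the full noise vector.\<close>
  define A where "A v u = (if v \<in> ?W then kernel_app ?W Q (\<lambda>t. b t u) v else 0)" for v u
  define F where "F = sqrt ((2 * real n + 1) * (2 * real m + 1))"
  have "whp (noise (m + n)) \<delta> (\<lambda>\<zeta>. cmod (\<Sum>v\<in>?U. \<Sum>u\<in>?U. cnj (\<zeta> v) * A v u * \<zeta> u) \<le> 4 * cmod (\<Sum>v\<in>?U. A v v) + 24 * F * ln (8 / \<delta>))"
    unfolding noise_def
  proof (rule gprod_quadratic_tail)
    have "(\<Sum>v\<in>?U. \<Sum>u\<in>?U. (cmod (A v u))\<^sup>2) = (\<Sum>u\<in>?U. \<Sum>v\<in>?U. (cmod (A v u))\<^sup>2)" by (rule sum.swap)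
    also have "\<dots> = (\<Sum>u\<in>?U. \<Sum>v\<in>?W. (cmod (kernel_app ?W Q (\<lambda>t. b t u) v))\<^sup>2)"
      using window_mono[of n "m + n"] by (intro sum.cong refl sum.mono_neutral_cong_right) (auto simp: A_def)
    also have "\<dots> \<le> (\<Sum>u\<in>?U. \<Sum>t\<in>?W. (cmod (b t u))\<^sup>2)"
      unfolding l2norm_power2[symmetric] by (intro sum_mono power_mono l2norm_kernel_app_le Q) auto
    also have "\<dots> = (\<Sum>t\<in>?W. \<Sum>u\<in>?U. (cmod (b t u))\<^sup>2)" by (rule sum.swap)
    also have "\<dots> = (\<Sum>t\<in>?W. \<Sum>\<tau>\<in>window m. 1)"
    proof (rule sum.cong[OF refl])
      fix t assume "t \<in> ?W"
      have "(\<Sum>u\<in>?U. (cmod (b t u))\<^sup>2) = (\<Sum>u\<in>?U. if t - u \<in> window m then 1 else 0)"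
        by (intro sum.cong refl) (simp add: b_def e_def)
      also have "\<dots> = (\<Sum>\<tau>\<in>window m. 1)" by (rule sum_band_norm) fact
      finally show "(\<Sum>u\<in>?U. (cmod (b t u))\<^sup>2) = (\<Sum>\<tau>\<in>window m. 1)" .
    qed
    also have "\<dots> = F\<^sup>2" by (simp add: F_def add.commute)
    finally show "(\<Sum>v\<in>?U. \<Sum>u\<in>?U. (cmod (A v u))\<^sup>2) \<le> F\<^sup>2" .
    show "0 < F" by (simp add: F_def)
  qed (use \<open>0 < \<delta>\<close> in auto)
  then show ?thesis
  proof (rule whp_mono)
    fix \<zeta> :: signal
    assume *: "cmod (\<Sum>v\<in>?U. \<Sum>u\<in>?U. cnj (\<zeta> v) * A v u * \<zeta> u) \<le> 4 * cmod (\<Sum>v\<in>?U. A v v) + 24 * F * ln (8 / \<delta>)"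
    have "(\<Sum>v\<in>?U. \<Sum>u\<in>?U. cnj (\<zeta> v) * A v u * \<zeta> u) = (\<Sum>v\<in>?W. \<Sum>u\<in>?U. cnj (\<zeta> v) * kernel_app ?W Q (\<lambda>t. b t u) v * \<zeta> u)"
      using window_mono[of n "m + n"] by (intro sum.mono_neutral_cong_right) (auto simp: A_def)
    also have "\<dots> = hinner ?W \<zeta> (kernel_app ?W Q (\<lambda>t. \<Sum>u\<in>?U. b t u * \<zeta> u))"
    proof -
      have "kernel_app ?W Q (\<lambda>t. \<Sum>u\<in>?U. b t u * \<zeta> u) v = (\<Sum>u\<in>?U. kernel_app ?W Q (\<lambda>t. b t u) v * \<zeta> u)" for v
        unfolding kernel_app_def sum_distrib_left sum_distrib_right
        by (subst sum.swap) (simp add: mult_ac)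
      then show ?thesis by (simp add: hinner_def sum_distrib_left mult_ac)
    qed
    also have "\<dots> = hinner ?W (kernel_app ?W Q \<zeta>) (\<lambda>t. \<Sum>u\<in>?U. b t u * \<zeta> u)" by (rule hinner_kernel_app[OF Q, symmetric])
    also have "\<dots> = hinner ?W (kernel_app ?W Q \<zeta>) (\<lambda>t. \<Sum>\<tau>\<in>window m. e \<tau> * \<zeta> (t - \<tau>))"
      by (intro hinner_cong refl) (simp only: b_def sum_band)
    finally have q: "cmod (hinner ?W (kernel_app ?W Q \<zeta>) (\<lambda>t. \<Sum>\<tau>\<in>window m. e \<tau> * \<zeta> (t - \<tau>)))
      \<le> 4 * cmod (\<Sum>v\<in>?U. A v v) + 24 * F * ln (8 / \<delta>)" using * by (simp only:)
    have "(\<Sum>v\<in>?U. A v v) = (\<Sum>v\<in>?W. \<Sum>t\<in>?W. Q v t * (if t - v \<in> window m then e (t - v) else 0))"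
      using window_mono[of n "m + n"] by (intro sum.mono_neutral_cong_right) (auto simp: A_def kernel_app_def b_def)
    \<comment> \<open>A unimodular vector has squared norm 2 n + 1 on the window, and
      \<open>Q\<close> is a contraction.\<close>
    moreover have "cmod (\<Sum>v\<in>?W. \<Sum>t\<in>?W. Q v t * (if t - v \<in> window m then e (t - v) else 0)) \<le> (2 * real n + 1) * (3 + 2 * ln (real (m + n)))"
    proof (rule norm_trace_band_le)
      fix f :: signal assume f: "\<And>t. cmod (f t) = 1"
      have "(\<Sum>v\<in>?W. \<Sum>t\<in>?W. cnj (f v) * Q v t * f t) = hinner ?W f (kernel_app ?W Q f)"
        by (simp add: hinner_def kernel_app_def sum_distrib_left mult_ac)
      also have "cmod \<dots> \<le> l2norm ?W f * l2norm ?W (kernel_app ?W Q f)" by (rule cmod_hinner_le)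
      also have "\<dots> \<le> l2norm ?W f * l2norm ?W f" by (intro mult_left_mono l2norm_kernel_app_le Q) auto
      also have "\<dots> = 2 * real n + 1" using l2norm_power2[of ?W f] by (simp add: f power2_eq_square)
      finally show "cmod (\<Sum>v\<in>?W. \<Sum>t\<in>?W. cnj (f v) * Q v t * f t) \<le> 2 * real n + 1" .
    qed (use mn in \<open>auto simp: e_def unity_root_diff right_diff_distrib\<close>)
    ultimately show "cmod (hinner ?W (kernel_app ?W Q \<zeta>) (\<lambda>t. \<Sum>\<tau>\<in>window m. unity_root (2 * m + 1) (int k * \<tau>) * \<zeta> (t - \<tau>)))
      \<le> 4 * ((2 * real n + 1) * (3 + 2 * ln (real (m + n)))) + 24 * sqrt ((2 * real n + 1) * (2 * real m + 1)) * ln (8 / \<delta>)"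
      using q unfolding e_def F_def by simp
  qed simp
qed

section \<open>Logarithms of the failure probabilities\<close>

lemma ln_16_div_le:
  fixes \<alpha> :: real
  assumes "0 < \<alpha>" "\<alpha> \<le> 1 / 2" shows "ln (16 / \<alpha>) \<le> 5 * ln (1 / \<alpha>)"
proof -
  have \<alpha>: "2 \<le> 1 / \<alpha>" using assms by (simp add: field_simps)
  then have "(2::real) ^ 4 \<le> (1 / \<alpha>) ^ 4" by (intro power_mono) auto
  then have "16 * (1 / \<alpha>) \<le> (1 / \<alpha>) ^ 4 * (1 / \<alpha>)" using assms by (intro mult_right_mono) auto
  then have "ln (16 / \<alpha>) \<le> ln ((1 / \<alpha>) ^ 5)"
    using assms by (subst ln_le_cancel_iff) (auto simp: power_numeral_reduce mult_ac)
  also have "\<dots> = 5 * ln (1 / \<alpha>)" using assms by (subst ln_realpow) auto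
  finally show ?thesis .
qed

text \<open>The 2 m + 1 frequencies share \<alpha> / 2. With X the argument of the logarithm on the
  right, the argument on the left is at most 48 X, hence at most \<open>X ^ 7\<close> because X
  \<ge> 2 and 48 \<le> 64.\<close>

lemma ln_union_bound_le:
  assumes "0 < \<alpha>" "\<alpha> \<le> 1 / 2" "1 \<le> m"
  shows "ln (8 / (\<alpha> / (2 * (2 * real m + 1)))) \<le> 7 * ln ((real m + real n) / \<alpha>)"
proof -
  define X where "X = (real m + real n) / \<alpha>"
  have "2 * \<alpha> \<le> real m + real n" using assms by simp
  then have X: "2 \<le> X" using assms by (simp add: X_def field_simps)
  have "8 / (\<alpha> / (2 * (2 * real m + 1))) = 16 * (2 * real m + 1) / \<alpha>" by simp
  also have "\<dots> \<le> 48 * X"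
    unfolding X_def times_divide_eq_right using assms by (intro divide_right_mono) auto
  also have "\<dots> \<le> 2 ^ 6 * X" using X by simp
  also have "\<dots> \<le> X ^ 6 * X" using X by (intro mult_right_mono power_mono) auto
  also have "\<dots> = X ^ 7" by (simp add: power_numeral_reduce mult_ac)
  finally have "8 / (\<alpha> / (2 * (2 * real m + 1))) \<le> X ^ 7" .
  then have "ln (8 / (\<alpha> / (2 * (2 * real m + 1)))) \<le> ln (X ^ 7)"
    using assms X by (subst ln_le_cancel_iff) auto
  also have "\<dots> = 7 * ln X" using X by (subst ln_realpow) auto
  finally show ?thesis by (simp add: X_def)
qed

lemma log_bounds:
  assumes "0 < \<alpha>" "\<alpha> \<le> 1 / 2" "1 \<le> m"
  shows "1 / 2 \<le> ln ((real m + real n) / \<alpha>)" "0 < ln (1 / \<alpha>)"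
    "ln (1 / \<alpha>) \<le> ln ((real m + real n) / \<alpha>)" "ln (real m + real n) \<le> ln ((real m + real n) / \<alpha>)"
proof -
  have "2 * \<alpha> \<le> real m + real n" "1 \<le> real m + real n" using assms by simp_all
  then have "2 \<le> (real m + real n) / \<alpha>" "1 / \<alpha> \<le> (real m + real n) / \<alpha>" "1 < 1 / \<alpha>"
    using assms by (simp_all add: field_simps)
  moreover have "real m + real n \<le> (real m + real n) / \<alpha>"
    using assms divide_left_mono[of \<alpha> 1 "real m + real n"] by simp
  moreover have "1 / 2 \<le> ln (2::real)"
    using ln_mono[OF exp_half_le2] by simp
  ultimately show "1 / 2 \<le> ln ((real m + real n) / \<alpha>)" "0 < ln (1 / \<alpha>)"
    "ln (1 / \<alpha>) \<le> ln ((real m + real n) / \<alpha>)" "ln (real m + real n) \<le> ln ((real m + real n) / \<alpha>)"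
    using assms by (auto intro: order_trans ln_mono)
qed

definition modulated :: "nat \<Rightarrow> nat \<Rightarrow> signal \<Rightarrow> signal" where
  "modulated m k \<zeta> t = (\<Sum>\<tau>\<in>window m. unity_root (2 * m + 1) (int k * \<tau>) * \<zeta> (t - \<tau>))"

lemma kappa_mn_power2: "(2 * real m + 1) * (kappa_mn m n)\<^sup>2 = 2 * real n + 1"
  by (simp add: kappa_mn_def field_simps)

lemma kappa_mn_pos: "0 < kappa_mn m n"
  by (simp add: kappa_mn_def)

text \<open>The first four bounds fail with probability at most \<alpha> / 8 each, and all
  frequencies together with probability \<alpha> / 2; only that union bound pays for log (m + n).
  The constant 20 is 4 from the sum-of-squares tail times 5 from ln (16 / \<alpha>) \<le> 5 ln (1 /
  \<alpha>).\<close>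

lemma whp_oracle_event:
  fixes P :: "int \<Rightarrow> int \<Rightarrow> complex" and \<phi> \<epsilon> :: signal
  assumes P: "orth_proj (window n) P" "(\<Sum>t\<in>window n. Re (P t t)) \<le> real s"
    and \<phi>: "\<phi> \<in> filters m" "dft_norm1 m \<phi> \<le> 4 * real s / sqrt (2 * real m + 1)"
    and \<epsilon>: "\<forall>\<tau>\<in>window m. l2norm (window n) (shift \<tau> \<epsilon>) \<le> b" and b: "0 \<le> b"
    and \<alpha>: "0 < \<alpha>" "\<alpha> \<le> 1 / 2" and m: "1 \<le> m"
  defines "L\<^sub>1 \<equiv> ln (1 / \<alpha>)" and "L \<equiv> ln ((real m + real n) / \<alpha>)" and "W \<equiv> window n"
  shows "whp (noise (m + n)) \<alpha> (\<lambda>\<zeta>.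
    l2norm W (kernel_app W P \<zeta>) \<le> sqrt (20 * real s * L\<^sub>1) \<and>
    cmod (hinner W (kernel_app W (compl_kernel P) \<zeta>) \<epsilon>) \<le> sqrt (20 * L\<^sub>1) * b \<and>
    (\<Sum>\<tau>\<in>window m. (cmod (hinner W (kernel_app W (compl_kernel P) \<zeta>) (shift \<tau> \<epsilon>)))\<^sup>2)
      \<le> (2 * real m + 1) * (sqrt (20 * L\<^sub>1) * b)\<^sup>2 \<and>
    l2norm W (conv \<phi> \<zeta>) \<le> 18 * (real s * (kappa_mn m n * sqrt L\<^sub>1)) \<and>
    (\<forall>k\<in>{1..2 * m + 1}. cmod (hinner W (kernel_app W (compl_kernel P) \<zeta>) (modulated m k \<zeta>))
      \<le> (2 * real m + 1) * (116 * (((kappa_mn m n)\<^sup>2 + 1) * L))))"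
proof -
  let ?Q = "compl_kernel P" and ?M = "noise (m + n)"
  have Q: "orth_proj W ?Q" unfolding W_def by (rule orth_proj_compl) (use P in auto)
  have L1: "0 < L\<^sub>1" and L: "1 / 2 \<le> L" "ln (real m + real n) \<le> L"
    using log_bounds(2)[OF \<alpha> m] log_bounds(1,4)[OF \<alpha> m, of n] by (simp_all add: L\<^sub>1_def L_def)
  have ln16: "ln (2 / (\<alpha> / 8)) \<le> 5 * L\<^sub>1"
    using ln_16_div_le[OF \<alpha>] by (simp add: L\<^sub>1_def)
  have "whp ?M (\<alpha> / 8) (\<lambda>\<zeta>. (l2norm W (kernel_app W P \<zeta>))\<^sup>2 \<le> 4 * real s * ln (2 / (\<alpha> / 8)))"
    unfolding W_def by (rule whp_projection) (use P \<alpha> in auto)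
  then have 1: "whp ?M (\<alpha> / 8) (\<lambda>\<zeta>. l2norm W (kernel_app W P \<zeta>) \<le> sqrt (20 * real s * L\<^sub>1))"
  proof (rule whp_mono)
    fix \<zeta> assume "(l2norm W (kernel_app W P \<zeta>))\<^sup>2 \<le> 4 * real s * ln (2 / (\<alpha> / 8))"
    also have "\<dots> \<le> 4 * real s * (5 * L\<^sub>1)" using ln16 by (intro mult_left_mono) auto
    finally show "l2norm W (kernel_app W P \<zeta>) \<le> sqrt (20 * real s * L\<^sub>1)" by (intro real_le_rsqrt) simp
  qed simp
  have sq: "(sqrt (20 * L\<^sub>1) * b)\<^sup>2 = 20 * L\<^sub>1 * b\<^sup>2" using L1 by (simp add: power_mult_distrib)
  have "shift 0 \<epsilon> = \<epsilon>" by simp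
  moreover have "0 \<in> window m" by (simp add: window_def)
  ultimately have \<epsilon>0: "l2norm W \<epsilon> \<le> b" using \<epsilon> unfolding W_def by fastforce
  \<comment> \<open>A one-element index set specializes the summed bound to a single
    pairing.\<close>
  have "whp ?M (\<alpha> / 8) (\<lambda>\<zeta>. (\<Sum>i\<in>{()}. (cmod (hinner W (kernel_app W ?Q \<zeta>) \<epsilon>))\<^sup>2) \<le> 4 * (real (card {()}) * b\<^sup>2) * ln (2 / (\<alpha> / 8)))"
    unfolding W_def by (rule whp_inner) (use Q \<epsilon>0 \<alpha> in \<open>auto simp: W_def\<close>)
  then have 2: "whp ?M (\<alpha> / 8) (\<lambda>\<zeta>. cmod (hinner W (kernel_app W ?Q \<zeta>) \<epsilon>) \<le> sqrt (20 * L\<^sub>1) * b)"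
  proof (rule whp_mono)
    fix \<zeta> assume "(\<Sum>i\<in>{()}. (cmod (hinner W (kernel_app W ?Q \<zeta>) \<epsilon>))\<^sup>2) \<le> 4 * (real (card {()}) * b\<^sup>2) * ln (2 / (\<alpha> / 8))"
    then have "(cmod (hinner W (kernel_app W ?Q \<zeta>) \<epsilon>))\<^sup>2 \<le> 4 * b\<^sup>2 * ln (2 / (\<alpha> / 8))" by simp
    also have "\<dots> \<le> 4 * b\<^sup>2 * (5 * L\<^sub>1)" using ln16 by (intro mult_left_mono) auto
    also have "\<dots> = (sqrt (20 * L\<^sub>1) * b)\<^sup>2" unfolding sq by simp
    finally show "cmod (hinner W (kernel_app W ?Q \<zeta>) \<epsilon>) \<le> sqrt (20 * L\<^sub>1) * b"
      by (rule power2_le_imp_le) (use L1 b in simp)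
  qed simp
  have "whp ?M (\<alpha> / 8) (\<lambda>\<zeta>. (\<Sum>\<tau>\<in>window m. (cmod (hinner W (kernel_app W ?Q \<zeta>) (shift \<tau> \<epsilon>)))\<^sup>2) \<le> 4 * (real (card (window m)) * b\<^sup>2) * ln (2 / (\<alpha> / 8)))"
    unfolding W_def by (rule whp_inner) (use Q \<epsilon> \<alpha> in \<open>auto simp: W_def\<close>)
  then have 3: "whp ?M (\<alpha> / 8) (\<lambda>\<zeta>. (\<Sum>\<tau>\<in>window m. (cmod (hinner W (kernel_app W ?Q \<zeta>) (shift \<tau> \<epsilon>)))\<^sup>2) \<le> (2 * real m + 1) * (sqrt (20 * L\<^sub>1) * b)\<^sup>2)"
  proof (rule whp_mono)
    fix \<zeta> assume "(\<Sum>\<tau>\<in>window m. (cmod (hinner W (kernel_app W ?Q \<zeta>) (shift \<tau> \<epsilon>)))\<^sup>2) \<le> 4 * (real (card (window m)) * b\<^sup>2) * ln (2 / (\<alpha> / 8))"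
    also have "\<dots> \<le> 4 * (real (card (window m)) * b\<^sup>2) * (5 * L\<^sub>1)" using ln16 by (intro mult_left_mono) auto
    also have "\<dots> = (2 * real m + 1) * (sqrt (20 * L\<^sub>1) * b)\<^sup>2" unfolding sq by (simp add: algebra_simps)
    finally show "(\<Sum>\<tau>\<in>window m. (cmod (hinner W (kernel_app W ?Q \<zeta>) (shift \<tau> \<epsilon>)))\<^sup>2) \<le> (2 * real m + 1) * (sqrt (20 * L\<^sub>1) * b)\<^sup>2" .
  qed simp
  have "whp ?M (\<alpha> / 8) (\<lambda>\<zeta>. (l2norm W (conv \<phi> \<zeta>))\<^sup>2 \<le> 4 * ((2 * real n + 1) * (seminorm2 m \<phi>)\<^sup>2) * ln (2 / (\<alpha> / 8)))"
    unfolding W_def by (rule whp_filtered_noise) (use \<phi> \<alpha> in auto)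
  then have 4: "whp ?M (\<alpha> / 8) (\<lambda>\<zeta>. l2norm W (conv \<phi> \<zeta>) \<le> 18 * (real s * (kappa_mn m n * sqrt L\<^sub>1)))"
  proof (rule whp_mono)
    fix \<zeta> assume "(l2norm W (conv \<phi> \<zeta>))\<^sup>2 \<le> 4 * ((2 * real n + 1) * (seminorm2 m \<phi>)\<^sup>2) * ln (2 / (\<alpha> / 8))"
    also have "\<dots> \<le> 4 * ((2 * real n + 1) * (4 * real s / sqrt (2 * real m + 1))\<^sup>2) * (5 * L\<^sub>1)"
    proof (intro mult_mono power_mono ln16)
      show "seminorm2 m \<phi> \<le> 4 * real s / sqrt (2 * real m + 1)"
        using seminorm2_le_dft_norm1 \<phi>(2) by (rule order_trans)
      show "0 \<le> ln (2 / (\<alpha> / 8))" using \<alpha> by simp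
    qed (auto simp: seminorm2_def)
    \<comment> \<open>320 = 4 * 16 * 5 is then rounded up to the square 324 of 18.\<close>
    also have "\<dots> = 320 * ((real s)\<^sup>2 * ((kappa_mn m n)\<^sup>2 * L\<^sub>1))"
      by (simp add: power_divide power_mult_distrib kappa_mn_def field_simps)
    also have "\<dots> \<le> 324 * ((real s)\<^sup>2 * ((kappa_mn m n)\<^sup>2 * L\<^sub>1))" using L1 by (intro mult_right_mono) auto
    also have "\<dots> = (18 * (real s * (kappa_mn m n * sqrt L\<^sub>1)))\<^sup>2" using L1 by (simp add: power_mult_distrib)
    finally show "l2norm W (conv \<phi> \<zeta>) \<le> 18 * (real s * (kappa_mn m n * sqrt L\<^sub>1))"
      by (rule power2_le_imp_le) (use L1 kappa_mn_pos[of m n] in simp)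
  qed simp
  have "whp ?M (\<Sum>k\<in>{1..2 * m + 1}. \<alpha> / (2 * (2 * real m + 1))) (\<lambda>\<zeta>. \<forall>k\<in>{1..2 * m + 1}.
    cmod (hinner W (kernel_app W ?Q \<zeta>) (modulated m k \<zeta>)) \<le> (2 * real m + 1) * (116 * (((kappa_mn m n)\<^sup>2 + 1) * L)))"
  proof (rule whp_ball)
    fix k assume "k \<in> {1..2 * m + 1}"
    let ?\<delta> = "\<alpha> / (2 * (2 * real m + 1))"
    define F where "F = sqrt ((2 * real n + 1) * (2 * real m + 1))"
    have "whp ?M ?\<delta> (\<lambda>\<zeta>. cmod (hinner W (kernel_app W ?Q \<zeta>) (modulated m k \<zeta>))
        \<le> 4 * ((2 * real n + 1) * (3 + 2 * ln (real (m + n)))) + 24 * F * ln (8 / ?\<delta>))"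
      unfolding modulated_def[abs_def] F_def W_def
      by (rule whp_modulated_noise) (use Q \<alpha> m in \<open>auto simp: W_def\<close>)
    then show "whp ?M ?\<delta> (\<lambda>\<zeta>. cmod (hinner W (kernel_app W ?Q \<zeta>) (modulated m k \<zeta>))
        \<le> (2 * real m + 1) * (116 * (((kappa_mn m n)\<^sup>2 + 1) * L)))"
    proof (rule whp_mono)
      fix \<zeta> assume "cmod (hinner W (kernel_app W ?Q \<zeta>) (modulated m k \<zeta>))
        \<le> 4 * ((2 * real n + 1) * (3 + 2 * ln (real (m + n)))) + 24 * F * ln (8 / ?\<delta>)"
      \<comment> \<open>Since L \<ge> 1 / 2, the bracket 3 + 2 ln is at most 8 L. This gives 4 * 8 =
        32 and 24 * 7 = 168; the arithmetic-geometric mean inequality halves 168 to 84, and 32 + 84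
        = 116.\<close>
      also have "\<dots> \<le> 4 * ((2 * real n + 1) * (8 * L)) + 24 * F * (7 * L)"
        using ln_union_bound_le[OF \<alpha> m, of n] L
        by (intro add_mono mult_left_mono) (auto simp: L_def[symmetric] F_def)
      also have "\<dots> = (32 * (2 * real n + 1) + 168 * F) * L" by (simp add: algebra_simps)
      also have "\<dots> \<le> (116 * ((2 * real n + 1) + (2 * real m + 1))) * L"
      proof (rule mult_right_mono)
        have "F \<le> ((2 * real n + 1) + (2 * real m + 1)) / 2"
          unfolding F_def by (rule arith_geo_mean_sqrt) auto
        then show "32 * (2 * real n + 1) + 168 * F \<le> 116 * ((2 * real n + 1) + (2 * real m + 1))" by simp
      qed (use L in auto)
      also have "(2 * real n + 1) + (2 * real m + 1) = (2 * real m + 1) * ((kappa_mn m n)\<^sup>2 + 1)"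
        by (simp add: distrib_left kappa_mn_power2)
      finally show "cmod (hinner W (kernel_app W ?Q \<zeta>) (modulated m k \<zeta>))
        \<le> (2 * real m + 1) * (116 * (((kappa_mn m n)\<^sup>2 + 1) * L))" by (simp add: mult_ac)
    qed simp
  qed (use \<alpha> in auto)
  moreover have "(\<Sum>k\<in>{1..2 * m + 1}. \<alpha> / (2 * (2 * real m + 1))) = \<alpha> / 2" by (simp add: field_simps)
  ultimately have 5: "whp ?M (\<alpha> / 2) (\<lambda>\<zeta>. \<forall>k\<in>{1..2 * m + 1}.
    cmod (hinner W (kernel_app W ?Q \<zeta>) (modulated m k \<zeta>)) \<le> (2 * real m + 1) * (116 * (((kappa_mn m n)\<^sup>2 + 1) * L)))"
    by (simp only:)
  have "\<alpha> / 8 + (\<alpha> / 8 + (\<alpha> / 8 + (\<alpha> / 8 + \<alpha> / 2))) = \<alpha>" by simp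
  then show ?thesis
    using whp_conj[OF 1 whp_conj[OF 2 whp_conj[OF 3 whp_conj[OF 4 5]]]] \<alpha> by simp
qed

text \<open>\<open>P\<close> projects onto the invariant subspace, so its complement annihilates
  \<open>xS - conv \<phi> xS\<close> even though \<open>\<phi>\<close> may depend on the noise; only the residual
  \<open>\<epsilon>\<close> and the noise itself remain in the complementary part.\<close>

lemma cross_term_bound:
  fixes x xS \<epsilon> \<zeta> \<phi> :: signal
  assumes P: "orth_proj (window n) P" and \<phi>: "\<phi> \<in> filters m" and x: "\<And>t. x t = xS t + \<epsilon> t"
    and v: "\<And>t. t \<in> window n \<Longrightarrow> kernel_app (window n) P (\<lambda>t. xS t - conv \<phi> xS t) t = xS t - conv \<phi> xS t"
    and p: "l2norm (window n) (kernel_app (window n) P \<zeta>) \<le> p"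
    and e: "cmod (hinner (window n) (kernel_app (window n) (compl_kernel P) \<zeta>) \<epsilon>) \<le> e"
      "(\<Sum>\<tau>\<in>window m. (cmod (hinner (window n) (kernel_app (window n) (compl_kernel P) \<zeta>) (shift \<tau> \<epsilon>)))\<^sup>2)
        \<le> (2 * real m + 1) * e\<^sup>2"
    and q: "\<And>k. k \<in> {1..2 * m + 1} \<Longrightarrow> cmod (hinner (window n) (kernel_app (window n) (compl_kernel P) \<zeta>) (modulated m k \<zeta>))
        \<le> (2 * real m + 1) * q"
    and \<sigma>: "0 \<le> \<sigma>"
  defines "g \<equiv> \<lambda>t. x t - conv \<phi> (\<lambda>t. x t + complex_of_real \<sigma> * \<zeta> t) t"
    and "R \<equiv> sqrt (2 * real m + 1) * dft_norm1 m \<phi>"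
  shows "cmod (hinner (window n) \<zeta> g) \<le> p * l2norm (window n) g + (1 + R) * e + \<sigma> * R * q"
proof -
  let ?W = "window n"
  let ?Q = "compl_kernel P"
  define z where "z = kernel_app ?W ?Q \<zeta>"
  have Q: "orth_proj ?W ?Q" by (rule orth_proj_compl) (use P in auto)
  have e0: "0 \<le> e" using e(1) norm_ge_zero order_trans by blast
  have conv_lin: "conv \<phi> (\<lambda>t. x t + complex_of_real \<sigma> * \<zeta> t) t = conv \<phi> xS t + conv \<phi> \<epsilon> t + \<sigma> * conv \<phi> \<zeta> t" for t
    by (simp add: conv_filter[OF \<phi>] x ring_distribs sum.distrib sum_distrib_left mult.left_commute)
  have "hinner ?W \<zeta> g = hinner ?W (\<lambda>t. kernel_app ?W P \<zeta> t + z t) g"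
    by (intro hinner_cong) (simp_all add: z_def kernel_app_compl)
  then have split: "hinner ?W \<zeta> g = hinner ?W (kernel_app ?W P \<zeta>) g + hinner ?W z g"
    by (simp only: hinner_add_left)
  have "cmod (hinner ?W (kernel_app ?W P \<zeta>) g) \<le> l2norm ?W (kernel_app ?W P \<zeta>) * l2norm ?W g"
    by (rule cmod_hinner_le)
  also have "\<dots> \<le> p * l2norm ?W g" using p by (intro mult_right_mono) auto
  finally have part1: "cmod (hinner ?W (kernel_app ?W P \<zeta>) g) \<le> p * l2norm ?W g" .
  have "hinner ?W z (\<lambda>t. xS t - conv \<phi> xS t) = hinner ?W \<zeta> (kernel_app ?W ?Q (\<lambda>t. xS t - conv \<phi> xS t))"
    unfolding z_def by (rule hinner_kernel_app[OF Q])
  also have "\<dots> = hinner ?W \<zeta> (\<lambda>t. 0)" by (intro hinner_cong) (simp_all add: kernel_app_compl v)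
  finally have "hinner ?W z (\<lambda>t. xS t - conv \<phi> xS t) = 0" by (simp add: hinner_def)
  moreover have "g = (\<lambda>t. (xS t - conv \<phi> xS t) + ((\<epsilon> t - conv \<phi> \<epsilon> t) - \<sigma> * conv \<phi> \<zeta> t))"
    unfolding g_def conv_lin by (simp add: fun_eq_iff x)
  ultimately have zg: "hinner ?W z g = hinner ?W z \<epsilon> - hinner ?W z (conv \<phi> \<epsilon>) - hinner ?W z (\<lambda>t. \<sigma> * conv \<phi> \<zeta> t)"
    by (simp only: hinner_add_right hinner_diff_right) simp
  have "cmod (hinner ?W z (conv \<phi> \<epsilon>)) \<le> R * e"
  proof -
    have "hinner ?W z (conv \<phi> \<epsilon>) = (\<Sum>\<tau>\<in>window m. \<phi> \<tau> * hinner ?W z (shift \<tau> \<epsilon>))"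
      unfolding hinner_def conv_filter[OF \<phi>] shift_def sum_distrib_left by (subst sum.swap) (simp add: mult_ac)
    also have "cmod \<dots> \<le> (\<Sum>\<tau>\<in>window m. \<bar>cmod (\<phi> \<tau>)\<bar> * \<bar>cmod (hinner ?W z (shift \<tau> \<epsilon>))\<bar>)"
      by (rule order_trans[OF norm_sum]) (simp add: norm_mult)
    \<comment> \<open>Cauchy-Schwarz over the lags, because the pairings with the shifted residuals
      are controlled in mean square only.\<close>
    also have "\<dots> \<le> seminorm2 m \<phi> * L2_set (\<lambda>\<tau>. cmod (hinner ?W z (shift \<tau> \<epsilon>))) (window m)"
      unfolding seminorm2_def by (rule L2_set_mult_ineq)
    also have "\<dots> \<le> dft_norm1 m \<phi> * sqrt ((2 * real m + 1) * e\<^sup>2)"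
      using e(2) unfolding L2_set_def z_def
      by (intro mult_mono seminorm2_le_dft_norm1 real_sqrt_le_mono dft_norm1_nonneg) (auto intro: sum_nonneg)
    also have "\<dots> = R * e" using e0 by (simp add: R_def real_sqrt_mult)
    finally show ?thesis .
  qed
  moreover have "cmod (hinner ?W z (\<lambda>t. \<sigma> * conv \<phi> \<zeta> t)) \<le> \<sigma> * R * q"
  proof -
    define r where "r = sqrt (2 * real m + 1)"
    have r: "0 < r" "r * r = 2 * real m + 1" by (simp_all add: r_def)
    have "r * hinner ?W z (conv \<phi> \<zeta>) = hinner ?W z (\<lambda>t. r * conv \<phi> \<zeta> t)"
      by (simp add: hinner_def sum_distrib_left mult_ac)
    also have "\<dots> = hinner ?W z (\<lambda>t. \<Sum>k=1..2 * m + 1. dft m \<phi> k * modulated m k \<zeta> t)"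
      unfolding r_def modulated_def by (intro hinner_cong refl conv_eq_sum_dft[OF \<phi>])
    also have "\<dots> = (\<Sum>k=1..2 * m + 1. dft m \<phi> k * hinner ?W z (modulated m k \<zeta>))"
      unfolding hinner_def sum_distrib_left by (subst sum.swap) (simp add: mult_ac)
    finally have "cmod (r * hinner ?W z (conv \<phi> \<zeta>)) = cmod (\<Sum>k=1..2 * m + 1. dft m \<phi> k * hinner ?W z (modulated m k \<zeta>))"
      by (rule arg_cong)
    \<comment> \<open>Duality of l1 and maximum over the frequencies: the noise enters through the
      maximum only, so \<phi> may depend on it.\<close>
    also have "\<dots> \<le> (\<Sum>k=1..2 * m + 1. cmod (dft m \<phi> k) * ((2 * real m + 1) * q))"
      by (rule order_trans[OF norm_sum], rule sum_mono, unfold norm_mult, intro mult_left_mono)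
         (use q in \<open>auto simp: z_def\<close>)
    also have "\<dots> = dft_norm1 m \<phi> * (r * r * q)" by (simp only: dft_norm1_def sum_distrib_right r)
    finally have "r * cmod (hinner ?W z (conv \<phi> \<zeta>)) \<le> r * (R * q)"
      using r by (simp add: norm_mult R_def r_def mult_ac)
    then have "cmod (hinner ?W z (conv \<phi> \<zeta>)) \<le> R * q" using r by simp
    moreover have "hinner ?W z (\<lambda>t. \<sigma> * conv \<phi> \<zeta> t) = \<sigma> * hinner ?W z (conv \<phi> \<zeta>)"
      by (simp add: hinner_def sum_distrib_left mult_ac)
    ultimately show ?thesis using \<sigma> by (simp add: norm_mult mult.assoc mult_left_mono)
  qed
  ultimately have "cmod (hinner ?W z g) \<le> e + R * e + \<sigma> * R * q"
    using e(1) unfolding zg z_def[symmetric]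
    by (intro order_trans[OF norm_triangle_ineq4] add_mono) auto
  then show ?thesis
    unfolding split using part1 by (intro order_trans[OF norm_triangle_ineq]) (simp add: algebra_simps)
qed

section \<open>Oracle inequality\<close>

text \<open>The risk counts an error equal to \<open>r\<close> as a failure, so the loss must be
  strictly below \<open>r\<close> off the exceptional set; hence the strict inequalities in the rate
  bounds. Monotonicity of the measure needs only the exceptional set to be measurable.\<close>

lemma risk_le:
  assumes "\<And>x. x \<in> X \<Longrightarrow> whp (noise N) \<alpha>
    (\<lambda>\<zeta>. L2_set (\<lambda>t. cmod (xhat (observe N \<sigma> x \<zeta>) t - x t)) D < r)"
  shows "risk N \<sigma> D \<alpha> xhat X \<le> ereal r"
  unfolding risk_def
proof (rule Inf_lower, rule CollectI, intro exI conjI refl SUP_least)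
  fix x assume "x \<in> X"
  then obtain A where A: "A \<in> sets (noise N)" "emeasure (noise N) A \<le> ennreal \<alpha>"
    "\<And>\<zeta>. \<zeta> \<in> space (noise N) - A \<Longrightarrow> L2_set (\<lambda>t. cmod (xhat (observe N \<sigma> x \<zeta>) t - x t)) D < r"
    using assms[of x] unfolding whp_def by blast
  have "emeasure (noise N) {\<zeta> \<in> space (noise N). r \<le> L2_set (\<lambda>t. cmod (xhat (observe N \<sigma> x \<zeta>) t - x t)) D} \<le> emeasure (noise N) A"
    by (intro emeasure_mono A(1)) (use A(3) in fastforce)
  also note A(2)
  finally show "emeasure (noise N) {\<zeta> \<in> space (noise N). r \<le> L2_set (\<lambda>t. cmod (xhat (observe N \<sigma> x \<zeta>) t - x t)) D} \<le> ennreal \<alpha>" .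
qed simp

text \<open>The data are undefined outside their window, but all lags from \<open>window n\<close>
  stay inside it.\<close>

lemma conv_observe:
  assumes \<phi>: "\<phi> \<in> filters m" and t: "t \<in> window n"
  shows "conv \<phi> (observe (m + n) \<sigma> x \<zeta>) t = conv \<phi> (\<lambda>t. x t + complex_of_real \<sigma> * \<zeta> t) t"
  unfolding conv_filter[OF \<phi>]
proof (rule sum.cong[OF refl])
  fix \<tau> assume "\<tau> \<in> window m"
  then have "t - \<tau> \<in> window (m + n)" using t by (auto simp: window_def)
  then show "\<phi> \<tau> * observe (m + n) \<sigma> x \<zeta> (t - \<tau>) = \<phi> \<tau> * (x (t - \<tau>) + complex_of_real \<sigma> * \<zeta> (t - \<tau>))"
    by (simp add: observe_def)
qed

text \<open>The fit residual is the loss vector plus noise. The last summand is the same for every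
  filter and cancels when two objectives are compared.\<close>

lemma l2norm_add_noise:
  "(l2norm W (\<lambda>t. g t + complex_of_real \<sigma> * \<zeta> t))\<^sup>2 =
    (l2norm W g)\<^sup>2 + 2 * \<sigma> * Re (hinner W \<zeta> g) + (l2norm W (\<lambda>t. complex_of_real \<sigma> * \<zeta> t))\<^sup>2"
proof -
  have "(cmod (a + complex_of_real \<sigma> * b))\<^sup>2 = (cmod a)\<^sup>2 + 2 * \<sigma> * Re (cnj b * a) + (cmod (complex_of_real \<sigma> * b))\<^sup>2" for a b
    unfolding cmod_power2 by (simp add: power2_eq_square algebra_simps)
  then show ?thesis
    unfolding l2norm_power2 hinner_def Re_sum sum_distrib_left sum.distrib[symmetric] by (intro sum.cong) auto
qed

lemma l2norm_conv_le:
  assumes \<phi>: "\<phi> \<in> filters m" and \<epsilon>: "\<And>\<tau>. \<tau> \<in> window m \<Longrightarrow> l2norm W (shift \<tau> \<epsilon>) \<le> b" and b: "0 \<le> b"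
  shows "l2norm W (conv \<phi> \<epsilon>) \<le> sqrt (2 * real m + 1) * dft_norm1 m \<phi> * b"
proof -
  have "conv \<phi> \<epsilon> = (\<lambda>t. \<Sum>\<tau>\<in>window m. \<phi> \<tau> * shift \<tau> \<epsilon> t)"
    by (simp add: conv_filter[OF \<phi>] shift_def fun_eq_iff)
  then have "l2norm W (conv \<phi> \<epsilon>) \<le> (\<Sum>\<tau>\<in>window m. l2norm W (\<lambda>t. \<phi> \<tau> * shift \<tau> \<epsilon> t))"
    by (simp only: l2norm_sum)
  also have "\<dots> \<le> (\<Sum>\<tau>\<in>window m. cmod (\<phi> \<tau>) * b)"
    unfolding l2norm_cmult by (intro sum_mono mult_left_mono \<epsilon>) auto
  also have "\<dots> = (\<Sum>\<tau>\<in>window m. \<bar>1\<bar> * \<bar>cmod (\<phi> \<tau>)\<bar>) * b" by (simp add: sum_distrib_right)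
  also have "\<dots> \<le> (L2_set (\<lambda>_. 1) (window m) * seminorm2 m \<phi>) * b"
    unfolding seminorm2_def by (intro mult_right_mono L2_set_mult_ineq b)
  also have "\<dots> \<le> (sqrt (2 * real m + 1) * dft_norm1 m \<phi>) * b"
    by (intro mult_right_mono mult_mono seminorm2_le_dft_norm1 b) (auto simp: L2_set_def seminorm2_def add.commute sum_nonneg)
  finally show ?thesis .
qed

definition fit_error :: "nat \<Rightarrow> signal \<Rightarrow> signal \<Rightarrow> real" where
  "fit_error n y \<phi> = (seminorm2 n (\<lambda>t. y t - conv \<phi> y t))\<^sup>2"

definition estimation_error :: "nat \<Rightarrow> signal \<Rightarrow> signal \<Rightarrow> signal \<Rightarrow> real" where
  "estimation_error n x y \<phi> = L2_set (\<lambda>t. cmod (conv \<phi> y t - x t)) (window n)"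

text \<open>In these units the constraint reads \<open>scaled_norm m \<phi> \<le> \<rho>\<close>,
  and the penalty is \<sigma>, \<lambda> and this norm multiplied and squared.\<close>

definition scaled_norm :: "nat \<Rightarrow> signal \<Rightarrow> real" where
  "scaled_norm m \<phi> = sqrt (2 * real m + 1) * dft_norm1 m \<phi>"

text \<open>The slack \<open>a\<close> is \<open>0\<close> for the constrained estimator and the difference of the
  penalties for the penalized one.\<close>

definition oracle_bound ::
  "nat \<Rightarrow> nat \<Rightarrow> nat \<Rightarrow> real \<Rightarrow> real \<Rightarrow> real \<Rightarrow> signal \<Rightarrow> signal \<Rightarrow> signal \<Rightarrow> bool" where
  "oracle_bound m n s \<kappa> \<sigma> \<alpha> x \<phi>\<^sub>0 y \<longleftrightarrow>
    (let p = sqrt (20 * real s * ln (1 / \<alpha>)); e = sqrt (20 * ln (1 / \<alpha>)) * (\<kappa> * \<sigma>);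
         q = 116 * (((kappa_mn m n)\<^sup>2 + 1) * ln ((real m + real n) / \<alpha>))
     in \<exists>r\<^sub>0. 0 \<le> r\<^sub>0 \<and> r\<^sub>0 \<le> 18 * (\<sigma> * real s * (kappa_mn m n * sqrt (ln (1 / \<alpha>)) + \<kappa>)) \<and>
      (\<forall>\<phi>\<in>filters m. \<forall>a. fit_error n y \<phi> + a \<le> fit_error n y \<phi>\<^sub>0 \<longrightarrow>
        (estimation_error n x y \<phi>)\<^sup>2 + a \<le> r\<^sub>0\<^sup>2 + 2 * \<sigma> * (p * (r\<^sub>0 + estimation_error n x y \<phi>) +
          2 * e + (scaled_norm m \<phi>\<^sub>0 + scaled_norm m \<phi>) * (e + \<sigma> * q))))"

text \<open>The exceptional set is the same for all filters \<open>\<phi>\<close> and slacks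
  \<open>a\<close>, so the bound may be applied to a minimizer computed from the data.\<close>

lemma oracle_inequality:
  assumes x: "x \<in> signal_class m n s \<kappa> \<sigma>" and s: "1 \<le> s" and m: "1 \<le> m" and \<kappa>: "0 \<le> \<kappa>" and \<sigma>: "0 < \<sigma>"
    and \<alpha>: "0 < \<alpha>" "\<alpha> \<le> 1 / 2"
  obtains \<phi>\<^sub>0 where "\<phi>\<^sub>0 \<in> filters m" "scaled_norm m \<phi>\<^sub>0 \<le> 4 * real s"
    "whp (noise (m + n)) \<alpha> (\<lambda>\<zeta>. oracle_bound m n s \<kappa> \<sigma> \<alpha> x \<phi>\<^sub>0 (observe (m + n) \<sigma> x \<zeta>))"
proof -
  define obj where "obj \<phi> \<zeta> = fit_error n (observe (m + n) \<sigma> x \<zeta>) \<phi>" for \<phi> \<zeta>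
  define loss where "loss \<phi> \<zeta> = estimation_error n x (observe (m + n) \<sigma> x \<zeta>) \<phi>" for \<phi> \<zeta>
  define R where "R = scaled_norm m"
  define p where "p = sqrt (20 * real s * ln (1 / \<alpha>))"
  define e where "e = sqrt (20 * ln (1 / \<alpha>)) * (\<kappa> * \<sigma>)"
  define q where "q = 116 * (((kappa_mn m n)\<^sup>2 + 1) * ln ((real m + real n) / \<alpha>))"
  let ?W = "window n"
  obtain S xS \<epsilon> where S: "cseq.subspace S" "shift 1 ` S \<subseteq> S" "cseq.dim S = s" "0 < s"
    and xS: "xS \<in> S" and x_eq: "x = xS + \<epsilon>"
    and \<epsilon>: "\<And>\<tau>. \<tau> \<in> window m \<Longrightarrow> seminorm2 n (shift (- \<tau>) \<epsilon>) \<le> \<kappa> * \<sigma>"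
    using x s unfolding signal_class_def by auto
  have x_t: "x t = xS t + \<epsilon> t" for t by (simp add: x_eq)
  have seminorm: "seminorm2 n f = l2norm ?W f" for f by (simp add: seminorm2_def l2norm_def)
  have \<epsilon>': "l2norm ?W (shift \<tau> \<epsilon>) \<le> \<kappa> * \<sigma>" if "\<tau> \<in> window m" for \<tau>
    using \<epsilon>[of "- \<tau>"] that by (auto simp: seminorm window_def)
  then have \<epsilon>'': "\<forall>\<tau>\<in>window m. l2norm ?W (shift \<tau> \<epsilon>) \<le> \<kappa> * \<sigma>" by blast
  obtain P where P: "orth_proj ?W P" "(\<Sum>t\<in>?W. Re (P t t)) \<le> real s"
    "\<And>x t. x \<in> S \<Longrightarrow> t \<in> ?W \<Longrightarrow> kernel_app ?W P x t = x t"
    using subspace_orth_proj[OF finite_window S(1,3,4)] by blast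
  obtain \<phi>\<^sub>0 where \<phi>\<^sub>0: "\<phi>\<^sub>0 \<in> filters m" "\<And>x t. x \<in> S \<Longrightarrow> conv \<phi>\<^sub>0 x t = x t"
    "dft_norm1 m \<phi>\<^sub>0 \<le> 4 * real s / sqrt (2 * real m + 1)"
    using reproducing_filter[OF S] by blast
  have R\<phi>\<^sub>0: "R \<phi>\<^sub>0 \<le> 4 * real s" using \<phi>\<^sub>0(3) by (simp add: R_def scaled_norm_def field_simps)
  have R0: "0 \<le> R \<phi>" for \<phi> by (simp add: R_def scaled_norm_def dft_norm1_nonneg)
  have b: "0 \<le> \<kappa> * \<sigma>" using \<kappa> \<sigma> by simp
  have v: "kernel_app ?W P (\<lambda>t. xS t - conv \<phi> xS t) t = xS t - conv \<phi> xS t" if "\<phi> \<in> filters m" "t \<in> ?W" for \<phi> t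
  proof -
    have "xS - conv \<phi> xS \<in> S" by (intro cseq.subspace_diff S(1) xS conv_closed[OF S xS that(1)])
    then show ?thesis using P(3)[OF _ that(2), of "xS - conv \<phi> xS"] by (simp add: kernel_app_def)
  qed
  define g where "g \<phi> \<zeta> = (\<lambda>t. x t - conv \<phi> (\<lambda>t. x t + complex_of_real \<sigma> * \<zeta> t) t)" for \<phi> \<zeta>
  have loss: "loss \<phi> \<zeta> = l2norm ?W (g \<phi> \<zeta>)" if "\<phi> \<in> filters m" for \<phi> \<zeta>
    unfolding loss_def estimation_error_def l2norm_def
    by (rule L2_set_cong) (simp_all add: g_def conv_observe[OF that] norm_minus_commute)
  have obj: "obj \<phi> \<zeta> = (l2norm ?W (g \<phi> \<zeta>))\<^sup>2 + 2 * \<sigma> * Re (hinner ?W \<zeta> (g \<phi> \<zeta>)) + (l2norm ?W (\<lambda>t. complex_of_real \<sigma> * \<zeta> t))\<^sup>2"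
    if "\<phi> \<in> filters m" for \<phi> \<zeta>
  proof -
    have "observe (m + n) \<sigma> x \<zeta> t = x t + complex_of_real \<sigma> * \<zeta> t" if "t \<in> ?W" for t
      using window_mono[of n "m + n"] that by (auto simp: observe_def)
    then have "obj \<phi> \<zeta> = (l2norm ?W (\<lambda>t. g \<phi> \<zeta> t + complex_of_real \<sigma> * \<zeta> t))\<^sup>2"
      unfolding obj_def fit_error_def seminorm
      by (intro arg_cong[where f = "\<lambda>x. x\<^sup>2"] l2norm_cong) (simp add: g_def conv_observe[OF that])
    then show ?thesis by (simp only: l2norm_add_noise)
  qed
  have "whp (noise (m + n)) \<alpha> (\<lambda>\<zeta>. \<exists>r\<^sub>0. 0 \<le> r\<^sub>0 \<and>
      r\<^sub>0 \<le> 18 * (\<sigma> * real s * (kappa_mn m n * sqrt (ln (1 / \<alpha>)) + \<kappa>)) \<and>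
      (\<forall>\<phi>\<in>filters m. \<forall>a. obj \<phi> \<zeta> + a \<le> obj \<phi>\<^sub>0 \<zeta> \<longrightarrow>
        (loss \<phi> \<zeta>)\<^sup>2 + a \<le> r\<^sub>0\<^sup>2 + 2 * \<sigma> * (p * (r\<^sub>0 + loss \<phi> \<zeta>) + 2 * e + (R \<phi>\<^sub>0 + R \<phi>) * (e + \<sigma> * q))))"
    using whp_oracle_event[OF P(1,2) \<phi>\<^sub>0(1,3) \<epsilon>'' b \<alpha> m]
    unfolding p_def[symmetric] e_def[symmetric] q_def[symmetric]
  proof (rule whp_mono, elim conjE, intro exI conjI ballI allI impI)
    fix \<zeta> :: signal
    assume p: "l2norm ?W (kernel_app ?W P \<zeta>) \<le> p"
      and e: "cmod (hinner ?W (kernel_app ?W (compl_kernel P) \<zeta>) \<epsilon>) \<le> e"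
        "(\<Sum>\<tau>\<in>window m. (cmod (hinner ?W (kernel_app ?W (compl_kernel P) \<zeta>) (shift \<tau> \<epsilon>)))\<^sup>2) \<le> (2 * real m + 1) * e\<^sup>2"
      and n0: "l2norm ?W (conv \<phi>\<^sub>0 \<zeta>) \<le> 18 * (real s * (kappa_mn m n * sqrt (ln (1 / \<alpha>))))"
      and q: "\<forall>k\<in>{1..2 * m + 1}. cmod (hinner ?W (kernel_app ?W (compl_kernel P) \<zeta>) (modulated m k \<zeta>)) \<le> (2 * real m + 1) * q"
    have cross: "cmod (hinner ?W \<zeta> (g \<phi> \<zeta>)) \<le> p * l2norm ?W (g \<phi> \<zeta>) + (1 + R \<phi>) * e + \<sigma> * R \<phi> * q" if "\<phi> \<in> filters m" for \<phi>
      unfolding g_def R_def scaled_norm_def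
      by (rule cross_term_bound[OF P(1) that x_t v[OF that] p e]) (use q \<sigma> in auto)
    \<comment> \<open>This fixes the existential witness: \<open>r\<^sub>0\<close> is the loss of
      the oracle.\<close>
    show "0 \<le> l2norm ?W (g \<phi>\<^sub>0 \<zeta>)" by simp
    show "l2norm ?W (g \<phi>\<^sub>0 \<zeta>) \<le> 18 * (\<sigma> * real s * (kappa_mn m n * sqrt (ln (1 / \<alpha>)) + \<kappa>))"
    proof -
      \<comment> \<open>The oracle reproduces \<open>xS\<close>, so its loss involves the residual
        and filtered noise only.\<close>
      have "g \<phi>\<^sub>0 \<zeta> = (\<lambda>t. (\<epsilon> t - conv \<phi>\<^sub>0 \<epsilon> t) - complex_of_real \<sigma> * conv \<phi>\<^sub>0 \<zeta> t)"
      proof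
        fix t
        have "conv \<phi>\<^sub>0 (\<lambda>t. x t + complex_of_real \<sigma> * \<zeta> t) t = conv \<phi>\<^sub>0 xS t + conv \<phi>\<^sub>0 \<epsilon> t + \<sigma> * conv \<phi>\<^sub>0 \<zeta> t"
          by (simp add: conv_filter[OF \<phi>\<^sub>0(1)] x_t ring_distribs sum.distrib sum_distrib_left mult.left_commute)
        then show "g \<phi>\<^sub>0 \<zeta> t = (\<epsilon> t - conv \<phi>\<^sub>0 \<epsilon> t) - complex_of_real \<sigma> * conv \<phi>\<^sub>0 \<zeta> t"
          using \<phi>\<^sub>0(2)[OF xS] by (simp only: g_def) (simp add: x_t)
      qed
      then have "l2norm ?W (g \<phi>\<^sub>0 \<zeta>) \<le> l2norm ?W \<epsilon> + l2norm ?W (conv \<phi>\<^sub>0 \<epsilon>) + \<sigma> * l2norm ?W (conv \<phi>\<^sub>0 \<zeta>)"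
        using l2norm_diff[of ?W "\<lambda>t. \<epsilon> t - conv \<phi>\<^sub>0 \<epsilon> t" "\<lambda>t. complex_of_real \<sigma> * conv \<phi>\<^sub>0 \<zeta> t"]
          l2norm_diff[of ?W \<epsilon> "conv \<phi>\<^sub>0 \<epsilon>"] \<sigma> by (simp add: l2norm_cmult)
      also have "\<dots> \<le> \<kappa> * \<sigma> + R \<phi>\<^sub>0 * (\<kappa> * \<sigma>) + \<sigma> * (18 * (real s * (kappa_mn m n * sqrt (ln (1 / \<alpha>)))))"
        using \<epsilon>'[of 0] l2norm_conv_le[OF \<phi>\<^sub>0(1) \<epsilon>' b] n0 \<sigma>
        by (intro add_mono mult_left_mono) (auto simp: R_def scaled_norm_def window_def)
      also have "\<dots> \<le> real s * (\<kappa> * \<sigma>) + 4 * real s * (\<kappa> * \<sigma>) + \<sigma> * (18 * (real s * (kappa_mn m n * sqrt (ln (1 / \<alpha>)))))"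
      proof -
        have "1 * (\<kappa> * \<sigma>) \<le> real s * (\<kappa> * \<sigma>)" using s b by (intro mult_right_mono) auto
        then show ?thesis using mult_right_mono[OF R\<phi>\<^sub>0 b] by linarith
      qed
      also have "\<dots> \<le> 18 * (\<sigma> * real s * (kappa_mn m n * sqrt (ln (1 / \<alpha>)) + \<kappa>))"
      proof -
        have "0 \<le> real s * (\<kappa> * \<sigma>)" using b by simp
        then show ?thesis by (simp add: algebra_simps)
      qed
      finally show ?thesis .
    qed
    fix \<phi> a assume \<phi>: "\<phi> \<in> filters m" and le: "obj \<phi> \<zeta> + a \<le> obj \<phi>\<^sub>0 \<zeta>"
    have "(loss \<phi> \<zeta>)\<^sup>2 + a \<le> (l2norm ?W (g \<phi>\<^sub>0 \<zeta>))\<^sup>2 + 2 * \<sigma> * (Re (hinner ?W \<zeta> (g \<phi>\<^sub>0 \<zeta>)) - Re (hinner ?W \<zeta> (g \<phi> \<zeta>)))"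
      using le unfolding obj[OF \<phi>] obj[OF \<phi>\<^sub>0(1)] loss[OF \<phi>] by (simp add: right_diff_distrib)
    also have "\<dots> \<le> (l2norm ?W (g \<phi>\<^sub>0 \<zeta>))\<^sup>2 + 2 * \<sigma> * (p * (l2norm ?W (g \<phi>\<^sub>0 \<zeta>) + loss \<phi> \<zeta>) + 2 * e + (R \<phi>\<^sub>0 + R \<phi>) * (e + \<sigma> * q))"
    proof (intro add_left_mono mult_left_mono)
      have "Re (hinner ?W \<zeta> (g \<phi>\<^sub>0 \<zeta>)) - Re (hinner ?W \<zeta> (g \<phi> \<zeta>)) \<le> cmod (hinner ?W \<zeta> (g \<phi>\<^sub>0 \<zeta>)) + cmod (hinner ?W \<zeta> (g \<phi> \<zeta>))"
        using abs_Re_le_cmod[of "hinner ?W \<zeta> (g \<phi>\<^sub>0 \<zeta>)"] abs_Re_le_cmod[of "hinner ?W \<zeta> (g \<phi> \<zeta>)"] by linarith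
      also have "\<dots> \<le> (p * l2norm ?W (g \<phi>\<^sub>0 \<zeta>) + (1 + R \<phi>\<^sub>0) * e + \<sigma> * R \<phi>\<^sub>0 * q) + (p * loss \<phi> \<zeta> + (1 + R \<phi>) * e + \<sigma> * R \<phi> * q)"
        unfolding loss[OF \<phi>] by (intro add_mono cross \<phi> \<phi>\<^sub>0(1))
      also have "\<dots> = p * (l2norm ?W (g \<phi>\<^sub>0 \<zeta>) + loss \<phi> \<zeta>) + 2 * e + (R \<phi>\<^sub>0 + R \<phi>) * (e + \<sigma> * q)"
        by (simp add: algebra_simps)
      finally show "Re (hinner ?W \<zeta> (g \<phi>\<^sub>0 \<zeta>)) - Re (hinner ?W \<zeta> (g \<phi> \<zeta>))
        \<le> p * (l2norm ?W (g \<phi>\<^sub>0 \<zeta>) + loss \<phi> \<zeta>) + 2 * e + (R \<phi>\<^sub>0 + R \<phi>) * (e + \<sigma> * q)" .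
    qed (use \<sigma> in simp)
    finally show "(loss \<phi> \<zeta>)\<^sup>2 + a \<le> (l2norm ?W (g \<phi>\<^sub>0 \<zeta>))\<^sup>2 + 2 * \<sigma> * (p * (l2norm ?W (g \<phi>\<^sub>0 \<zeta>) + loss \<phi> \<zeta>) + 2 * e + (R \<phi>\<^sub>0 + R \<phi>) * (e + \<sigma> * q))" .
  qed simp
  then have "whp (noise (m + n)) \<alpha> (\<lambda>\<zeta>. oracle_bound m n s \<kappa> \<sigma> \<alpha> x \<phi>\<^sub>0 (observe (m + n) \<sigma> x \<zeta>))"
    by (simp only: oracle_bound_def Let_def obj_def loss_def R_def p_def e_def q_def)
  with \<phi>\<^sub>0(1) R\<phi>\<^sub>0 show ?thesis unfolding R_def by (rule that)
qed

section \<open>Risk bounds\<close>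

text \<open>Completing the square in \<open>r\<close> absorbs the term linear in the loss, which
  comes from pairing the loss with the projected noise.\<close>

lemma le_of_quadratic:
  fixes r :: real
  assumes "r\<^sup>2 \<le> r\<^sub>0\<^sup>2 + 2 * b * (r\<^sub>0 + r) + d" "0 \<le> b" "0 \<le> r\<^sub>0" "0 \<le> D" "d \<le> D\<^sup>2"
  shows "r \<le> r\<^sub>0 + 3 * b + D"
proof -
  have "(r - b)\<^sup>2 \<le> r\<^sub>0\<^sup>2 + 2 * b * r\<^sub>0 + b\<^sup>2 + D\<^sup>2"
    using assms by (simp add: power2_eq_square algebra_simps)
  also have "\<dots> \<le> (r\<^sub>0 + b + b + D)\<^sup>2"
  proof -
    have "0 \<le> b * r\<^sub>0" "0 \<le> b * D" "0 \<le> r\<^sub>0 * D" "0 \<le> b * b" using assms by simp_all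
    then show ?thesis by (simp add: power2_eq_square algebra_simps)
  qed
  finally have "r - b \<le> r\<^sub>0 + b + b + D" by (rule power2_le_imp_le) (use assms in simp)
  then show ?thesis by simp
qed

context
  fixes m n s :: nat and \<alpha> \<kappa> \<sigma> :: real
  assumes s: "1 \<le> s" and m: "1 \<le> m" and \<kappa>: "0 \<le> \<kappa>" and \<sigma>: "0 < \<sigma>" and \<alpha>: "0 < \<alpha>" "\<alpha> \<le> 1 / 2"
begin

lemma sqrt_20_ln_le: "sqrt (20 * ln (1 / \<alpha>)) * (\<kappa> * \<sigma>) \<le> 5 * \<sigma> * (\<kappa> * sqrt (ln (1 / \<alpha>)))"
proof -
  have "sqrt 20 \<le> (5::real)" by (rule real_le_lsqrt) auto
  then have "sqrt 20 * (sqrt (ln (1 / \<alpha>)) * (\<kappa> * \<sigma>)) \<le> 5 * (sqrt (ln (1 / \<alpha>)) * (\<kappa> * \<sigma>))"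
    using \<kappa> \<sigma> \<alpha> by (intro mult_right_mono) auto
  then show ?thesis by (simp add: real_sqrt_mult ac_simps)
qed

text \<open>\<open>le_of_quadratic\<close> with \<sigma> \<open>p\<close> as linear coefficient and
  D = 22 \<sigma> sqrt B, where B is the radicand of \<open>psi\<close>. The oracle part contributes
  18, the root 3 * 3 + 22 = 31, and 32 makes the inequality strict.\<close>

lemma psi_bound:
  fixes r r\<^sub>0 R R\<^sub>0 \<rho> :: real
  defines "p \<equiv> sqrt (20 * real s * ln (1 / \<alpha>))" and "e \<equiv> sqrt (20 * ln (1 / \<alpha>)) * (\<kappa> * \<sigma>)"
    and "q \<equiv> 116 * (((kappa_mn m n)\<^sup>2 + 1) * ln ((real m + real n) / \<alpha>))"
  assumes \<rho>: "4 * real s \<le> \<rho>" and R: "R \<le> \<rho>" "R\<^sub>0 \<le> 4 * real s"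
    and r0: "0 \<le> r\<^sub>0" "r\<^sub>0 \<le> 18 * (\<sigma> * real s * (kappa_mn m n * sqrt (ln (1 / \<alpha>)) + \<kappa>))"
    and r: "r\<^sup>2 \<le> r\<^sub>0\<^sup>2 + 2 * \<sigma> * (p * (r\<^sub>0 + r) + 2 * e + (R\<^sub>0 + R) * (e + \<sigma> * q))"
  shows "r < 32 * psi m n \<alpha> \<sigma> s \<kappa> \<rho>"
proof -
  define L\<^sub>1 L where "L\<^sub>1 = ln (1 / \<alpha>)" and "L = ln ((real m + real n) / \<alpha>)"
  define k2 where "k2 = (kappa_mn m n)\<^sup>2 + 1"
  define B where "B = \<rho> * k2 * L + \<rho> * \<kappa> * sqrt L\<^sub>1 + real s"
  define a where "a = \<sigma> * real s * (kappa_mn m n * sqrt L\<^sub>1 + \<kappa>)"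
  have L: "0 < L\<^sub>1" "L\<^sub>1 \<le> L" using log_bounds(2)[OF \<alpha> m] log_bounds(3)[OF \<alpha> m, of n] by (simp_all add: L\<^sub>1_def L_def)
  have k2: "1 \<le> k2" by (simp add: k2_def)
  have \<rho>4: "4 \<le> \<rho>" using \<rho> s by simp
  have nn: "0 \<le> \<rho> * k2 * L" "0 \<le> \<rho> * \<kappa> * sqrt L\<^sub>1" using \<rho>4 k2 L \<kappa> by simp_all
  have B: "0 < B" using nn s by (simp add: B_def)
  have a: "0 \<le> a" using \<kappa> \<sigma> L kappa_mn_pos[of m n] by (simp add: a_def)
  have e: "0 \<le> e" "e \<le> 5 * \<sigma> * (\<kappa> * sqrt L\<^sub>1)"
    using sqrt_20_ln_le \<kappa> \<sigma> L by (simp_all add: e_def L\<^sub>1_def)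
  have q: "q = 116 * (k2 * L)" by (simp add: q_def k2_def L_def)
  have q0: "0 \<le> e + \<sigma> * q" using e \<sigma> k2 L by (simp add: q)
  have p: "p \<le> 3 * sqrt B"
  proof -
    have "20 * real s * L\<^sub>1 \<le> 5 * \<rho> * L"
      by (rule mult_mono) (use \<rho> \<rho>4 L in auto)
    also have "\<dots> \<le> 5 * (\<rho> * k2 * L)"
      using k2 \<rho>4 L mult_right_mono[of 1 k2 "\<rho> * L"] by (simp add: ac_simps)
    also have "\<dots> \<le> 9 * B"
    proof -
      have "5 * u \<le> 9 * (u + v + real s)" if "0 \<le> u" "0 \<le> v" for u v :: real using that by simp
      then show ?thesis unfolding B_def using nn by blast
    qed
    finally have "p \<le> sqrt (9 * B)" unfolding p_def L\<^sub>1_def[symmetric] by (rule real_sqrt_le_mono)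
    then show ?thesis by (simp add: real_sqrt_mult)
  qed
  \<comment> \<open>Both norms are at most \<rho>, and 4 \<le> \<rho> turns 2 e into at most \<rho>
    e / 2.\<close>
  have "2 * \<sigma> * (2 * e + (R\<^sub>0 + R) * (e + \<sigma> * q)) \<le> 2 * \<sigma> * (\<rho> * e / 2 + (2 * \<rho>) * (e + \<sigma> * q))"
    using R \<rho> \<rho>4 e \<sigma> q0 mult_right_mono[of 4 \<rho> e] by (intro mult_left_mono add_mono mult_right_mono) auto
  also have "\<dots> = 5 * \<sigma> * \<rho> * e + 4 * \<rho> * \<sigma>\<^sup>2 * q" by (simp add: algebra_simps power2_eq_square)
  also have "\<dots> \<le> 5 * \<sigma> * \<rho> * (5 * \<sigma> * (\<kappa> * sqrt L\<^sub>1)) + 4 * \<rho> * \<sigma>\<^sup>2 * q"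
    using \<rho>4 \<sigma> by (intro add_right_mono mult_left_mono e) auto
  also have "\<dots> = \<sigma>\<^sup>2 * (25 * (\<rho> * \<kappa> * sqrt L\<^sub>1) + 464 * (\<rho> * k2 * L))"
    by (simp add: q algebra_simps power2_eq_square)
  \<comment> \<open>484 = 22^2 dominates 25 as well as 464 = 4 * 116.\<close>
  also have "\<dots> \<le> \<sigma>\<^sup>2 * (484 * B)"
  proof (rule mult_left_mono)
    have "25 * v + 464 * u \<le> 484 * (u + v + real s)" if "0 \<le> u" "0 \<le> v" for u v :: real using that by simp
    then show "25 * (\<rho> * \<kappa> * sqrt L\<^sub>1) + 464 * (\<rho> * k2 * L) \<le> 484 * B" unfolding B_def using nn by blast
  qed simp
  also have "\<dots> = (22 * \<sigma> * sqrt B)\<^sup>2" using B by (simp add: power_mult_distrib)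
  finally have d: "2 * \<sigma> * (2 * e + (R\<^sub>0 + R) * (e + \<sigma> * q)) \<le> (22 * \<sigma> * sqrt B)\<^sup>2" .
  have "r \<le> r\<^sub>0 + 3 * (\<sigma> * p) + 22 * \<sigma> * sqrt B"
  proof (rule le_of_quadratic[OF _ _ r0(1) _ d])
    show "r\<^sup>2 \<le> r\<^sub>0\<^sup>2 + 2 * (\<sigma> * p) * (r\<^sub>0 + r) + 2 * \<sigma> * (2 * e + (R\<^sub>0 + R) * (e + \<sigma> * q))"
      using r by (simp add: algebra_simps)
  qed (use \<sigma> B L in \<open>auto simp: p_def L\<^sub>1_def\<close>)
  also have "\<dots> \<le> 18 * a + 3 * (\<sigma> * (3 * sqrt B)) + 22 * \<sigma> * sqrt B"
    using r0(2) p \<sigma> by (intro add_mono mult_left_mono) (auto simp: a_def L\<^sub>1_def)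
  also have "\<dots> \<le> 31 * (a + \<sigma> * sqrt B)" using a by (simp add: algebra_simps)
  also have "\<dots> < 32 * (a + \<sigma> * sqrt B)"
  proof (rule mult_strict_right_mono)
    show "0 < a + \<sigma> * sqrt B" using a \<sigma> B by (intro add_nonneg_pos) auto
  qed simp
  also have "a + \<sigma> * sqrt B = psi m n \<alpha> \<sigma> s \<kappa> \<rho>"
    by (simp add: psi_def a_def B_def k2_def L_def L\<^sub>1_def)
  finally show ?thesis .
qed

lemma psi_le_psi_bar:
  assumes "\<rho> \<le> C * real s" "1 \<le> C"
  shows "psi m n \<alpha> \<sigma> s \<kappa> \<rho> \<le> C * psi_bar m n \<alpha> \<sigma> s \<kappa>"
proof -
  define L\<^sub>1 L where "L\<^sub>1 = ln (1 / \<alpha>)" and "L = ln ((real m + real n) / \<alpha>)"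
  define k2 where "k2 = (kappa_mn m n)\<^sup>2 + 1"
  have L: "0 < L\<^sub>1" "L\<^sub>1 \<le> L" using log_bounds(2)[OF \<alpha> m] log_bounds(3)[OF \<alpha> m, of n] by (simp_all add: L\<^sub>1_def L_def)
  define B where "B = real s * k2 * L + real s * \<kappa> * sqrt L\<^sub>1 + real s"
  define a where "a = \<sigma> * real s * (kappa_mn m n * sqrt L\<^sub>1 + \<kappa>)"
  have a: "0 \<le> a" using \<kappa> \<sigma> L kappa_mn_pos[of m n] by (simp add: a_def)
  have B: "0 \<le> B" using L \<kappa> by (simp add: B_def k2_def)
  have "\<rho> * k2 * L + \<rho> * \<kappa> * sqrt L\<^sub>1 + real s \<le> (C * real s) * k2 * L + (C * real s) * \<kappa> * sqrt L\<^sub>1 + C * real s"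
    using assms L \<kappa> mult_right_mono[of 1 C "real s"] by (intro add_mono mult_right_mono) (auto simp: k2_def)
  also have "\<dots> = C * B" by (simp add: B_def algebra_simps)
  \<comment> \<open>Enlarging C to its square lets the factor leave the root as C, matching the
    first summand.\<close>
  also have "\<dots> \<le> C * (C * B)" using assms B mult_right_mono[of 1 C B] by (intro mult_left_mono) auto
  finally have "sqrt (\<rho> * k2 * L + \<rho> * \<kappa> * sqrt L\<^sub>1 + real s) \<le> sqrt (C * (C * B))" by (rule real_sqrt_le_mono)
  also have "\<dots> = C * sqrt B" using assms by (simp add: real_sqrt_mult)
  finally have "\<sigma> * sqrt (\<rho> * k2 * L + \<rho> * \<kappa> * sqrt L\<^sub>1 + real s) \<le> \<sigma> * (C * sqrt B)"
    using \<sigma> by (intro mult_left_mono) auto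
  moreover have "a \<le> C * a" using assms a mult_right_mono[of 1 C a] by simp
  ultimately have "a + \<sigma> * sqrt (\<rho> * k2 * L + \<rho> * \<kappa> * sqrt L\<^sub>1 + real s) \<le> C * (a + \<sigma> * sqrt B)"
    by (simp add: algebra_simps)
  then show ?thesis by (simp add: psi_def psi_bar_def a_def B_def k2_def L_def L\<^sub>1_def)
qed

text \<open>The right side is arranged so that \<kappa> can be charged to the first part of
  \<open>psi_tilde\<close>. The mixed term of \<open>Q1\<close> is dominated by the cross term of
  the square, and its summand 1 is at most 2 ln ((m + n) / \<alpha>).\<close>

lemma sqrt_Q1_le: "sqrt (Q1 m n \<alpha> \<kappa>) \<le> \<kappa> + 4 * (kappa_mn m n + 1) * sqrt (ln ((real m + real n) / \<alpha>))"
proof -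
  define L\<^sub>1 L where "L\<^sub>1 = ln (1 / \<alpha>)" and "L = ln ((real m + real n) / \<alpha>)"
  define k where "k = kappa_mn m n"
  have L: "0 < L\<^sub>1" "L\<^sub>1 \<le> L" "1 / 2 \<le> L"
    using log_bounds(2)[OF \<alpha> m] log_bounds(1,3)[OF \<alpha> m, of n] by (simp_all add: L\<^sub>1_def L_def)
  have k: "0 < k" using kappa_mn_pos by (simp add: k_def)
  have "Q1 m n \<alpha> \<kappa> = (k\<^sup>2 + 1) * L + \<kappa> * sqrt L\<^sub>1 + 1" by (simp add: Q1_def k_def L_def L\<^sub>1_def)
  also have "\<dots> \<le> (k\<^sup>2 + 1) * L + \<kappa> * sqrt L + 2 * L"
    using L \<kappa> by (intro add_mono mult_left_mono) auto
  also have "\<dots> \<le> \<kappa>\<^sup>2 + 8 * (k + 1) * (\<kappa> * sqrt L) + 16 * (k + 1)\<^sup>2 * L"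
  proof -
    have "(k\<^sup>2 + 1 + 2) * L \<le> (16 * (k + 1)\<^sup>2) * L"
      using L k by (intro mult_right_mono) (auto simp: power2_eq_square algebra_simps)
    moreover have "1 * (\<kappa> * sqrt L) \<le> (8 * (k + 1)) * (\<kappa> * sqrt L)"
      using L k \<kappa> by (intro mult_right_mono) auto
    moreover have "(k\<^sup>2 + 1) * L + 2 * L = (k\<^sup>2 + 1 + 2) * L" by (simp add: algebra_simps)
    ultimately show ?thesis using zero_le_power2[of \<kappa>] by linarith
  qed
  also have "\<dots> = (\<kappa> + 4 * (k + 1) * sqrt L)\<^sup>2"
    using L by (simp add: power2_sum power_mult_distrib)
  finally have "sqrt (Q1 m n \<alpha> \<kappa>) \<le> sqrt ((\<kappa> + 4 * (k + 1) * sqrt L)\<^sup>2)" by (rule real_sqrt_le_mono)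
  also have "\<dots> = \<kappa> + 4 * (k + 1) * sqrt L" using L k \<kappa> by simp
  finally show ?thesis by (simp add: k_def L_def)
qed

text \<open>The term linear in \<open>R\<close> is absorbed by the penalty \<open>\<sigma>\<^sup>2 * Q * R\<^sup>2\<close>.\<close>

lemma psi_tilde_bound:
  fixes r r\<^sub>0 R R\<^sub>0 :: real
  defines "p \<equiv> sqrt (20 * real s * ln (1 / \<alpha>))" and "e \<equiv> sqrt (20 * ln (1 / \<alpha>)) * (\<kappa> * \<sigma>)"
    and "q \<equiv> 116 * (((kappa_mn m n)\<^sup>2 + 1) * ln ((real m + real n) / \<alpha>))"
    and "Q \<equiv> Q1 m n \<alpha> \<kappa>"
  assumes R: "0 \<le> R" "0 \<le> R\<^sub>0" "R\<^sub>0 \<le> 4 * real s"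
    and r0: "0 \<le> r\<^sub>0" "r\<^sub>0 \<le> 18 * (\<sigma> * real s * (kappa_mn m n * sqrt (ln (1 / \<alpha>)) + \<kappa>))"
    and r: "r\<^sup>2 + (\<sigma>\<^sup>2 * Q * R\<^sup>2 - \<sigma>\<^sup>2 * Q * R\<^sub>0\<^sup>2)
      \<le> r\<^sub>0\<^sup>2 + 2 * \<sigma> * (p * (r\<^sub>0 + r) + 2 * e + (R\<^sub>0 + R) * (e + \<sigma> * q))"
  shows "r < 500 * psi_tilde m n \<alpha> \<sigma> s \<kappa>"
proof -
  define L\<^sub>1 L where "L\<^sub>1 = ln (1 / \<alpha>)" and "L = ln ((real m + real n) / \<alpha>)"
  define k where "k = kappa_mn m n"
  define a where "a = \<sigma> * real s * (k * sqrt L\<^sub>1 + \<kappa>)"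
  define b where "b = \<sigma> * real s * (k + 1) * sqrt L"
  have L: "0 < L\<^sub>1" "L\<^sub>1 \<le> L" using log_bounds(2)[OF \<alpha> m] log_bounds(3)[OF \<alpha> m, of n] by (simp_all add: L\<^sub>1_def L_def)
  have k: "0 < k" using kappa_mn_pos by (simp add: k_def)
  have Q_eq: "Q = (k\<^sup>2 + 1) * L + \<kappa> * sqrt L\<^sub>1 + 1" by (simp add: Q_def Q1_def k_def L_def L\<^sub>1_def)
  have nn: "0 \<le> (k\<^sup>2 + 1) * L" "0 \<le> \<kappa> * sqrt L\<^sub>1" using L \<kappa> by simp_all
  have Q: "1 \<le> Q" using nn by (simp add: Q_eq)
  have e: "0 \<le> e" "e \<le> 5 * \<sigma> * (\<kappa> * sqrt L\<^sub>1)"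
    using sqrt_20_ln_le \<kappa> \<sigma> L by (simp_all add: e_def L\<^sub>1_def)
  have eQ: "e \<le> 5 * \<sigma> * Q"
    using nn \<sigma> by (intro order_trans[OF e(2)] mult_left_mono) (auto simp: Q_eq)
  have eq: "e + \<sigma> * q \<le> 116 * \<sigma> * Q"
  proof -
    have "e + \<sigma> * q \<le> \<sigma> * (5 * (\<kappa> * sqrt L\<^sub>1) + 116 * ((k\<^sup>2 + 1) * L))"
      using e(2) by (simp add: q_def k_def L_def algebra_simps)
    also have "\<dots> \<le> \<sigma> * (116 * Q)" using nn \<sigma> by (intro mult_left_mono) (auto simp: Q_eq)
    finally show ?thesis by simp
  qed
  have s1: "1 \<le> real s" using s by simp
  have "2 * \<sigma> * (2 * e + (R\<^sub>0 + R) * (e + \<sigma> * q)) - (\<sigma>\<^sup>2 * Q * R\<^sup>2 - \<sigma>\<^sup>2 * Q * R\<^sub>0\<^sup>2)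
    \<le> 2 * \<sigma> * (2 * (5 * \<sigma> * Q) + (R\<^sub>0 + R) * (116 * \<sigma> * Q)) - (\<sigma>\<^sup>2 * Q * R\<^sup>2 - \<sigma>\<^sup>2 * Q * R\<^sub>0\<^sup>2)"
    using R \<sigma> by (intro diff_right_mono mult_left_mono add_mono eQ eq) auto
  also have "\<dots> = \<sigma>\<^sup>2 * Q * (20 + 232 * R\<^sub>0 + 232 * R - R\<^sup>2 + R\<^sub>0\<^sup>2)"
    by (simp add: power2_eq_square algebra_simps)
  also have "\<dots> \<le> \<sigma>\<^sup>2 * Q * (14641 * (real s)\<^sup>2)"
  proof (intro mult_left_mono)
    \<comment> \<open>The maximum is attained at R = 116, and 116^2 = 13456.\<close>
    have "232 * R - R\<^sup>2 \<le> 13456"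
      using zero_le_power2[of "R - 116"] by (simp add: power2_eq_square algebra_simps)
    moreover have "R\<^sub>0\<^sup>2 \<le> 16 * (real s)\<^sup>2" using power_mono[OF R(3,2), of 2] by (simp add: power_mult_distrib)
    moreover have "1 \<le> (real s)\<^sup>2" "real s \<le> (real s)\<^sup>2"
      using s1 by (auto simp: power2_eq_square intro: order_trans[OF s1])
    moreover have "232 * R\<^sub>0 \<le> 928 * real s" using R by simp
    \<comment> \<open>20 + 928 + 13456 + 16 = 14420 is rounded up to 14641 = 121^2.\<close>
    ultimately show "20 + 232 * R\<^sub>0 + 232 * R - R\<^sup>2 + R\<^sub>0\<^sup>2 \<le> 14641 * (real s)\<^sup>2"
      by linarith
  qed (use Q in auto)
  also have "\<dots> = (121 * \<sigma> * real s * sqrt Q)\<^sup>2" using Q by (simp add: power_mult_distrib)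
  finally have d: "2 * \<sigma> * (2 * e + (R\<^sub>0 + R) * (e + \<sigma> * q)) - (\<sigma>\<^sup>2 * Q * R\<^sup>2 - \<sigma>\<^sup>2 * Q * R\<^sub>0\<^sup>2)
    \<le> (121 * \<sigma> * real s * sqrt Q)\<^sup>2" .
  have p: "p \<le> 5 * (real s * sqrt L)"
  proof -
    have "20 * real s * L\<^sub>1 \<le> (25 * (real s)\<^sup>2) * L"
      using L s1 by (intro mult_mono) (auto simp: power2_eq_square)
    also have "\<dots> = (5 * (real s * sqrt L))\<^sup>2" using L by (simp add: power_mult_distrib)
    finally show ?thesis unfolding p_def L\<^sub>1_def[symmetric] using L by (intro real_le_lsqrt) auto
  qed
  have "r \<le> r\<^sub>0 + 3 * (\<sigma> * p) + 121 * \<sigma> * real s * sqrt Q"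
  proof (rule le_of_quadratic[OF _ _ r0(1) _ d])
    show "r\<^sup>2 \<le> r\<^sub>0\<^sup>2 + 2 * (\<sigma> * p) * (r\<^sub>0 + r) +
      (2 * \<sigma> * (2 * e + (R\<^sub>0 + R) * (e + \<sigma> * q)) - (\<sigma>\<^sup>2 * Q * R\<^sup>2 - \<sigma>\<^sup>2 * Q * R\<^sub>0\<^sup>2))"
      using r by (simp add: algebra_simps)
  qed (use \<sigma> L Q in \<open>auto simp: p_def L\<^sub>1_def\<close>)
  also have "\<dots> \<le> 18 * a + 3 * (\<sigma> * (5 * (real s * sqrt L))) + 121 * \<sigma> * real s * (\<kappa> + 4 * (k + 1) * sqrt L)"
    using r0(2) p \<sigma> sqrt_Q1_le
    by (intro add_mono mult_left_mono) (auto simp: a_def L\<^sub>1_def Q_def k_def L_def)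
  \<comment> \<open>18 + 121 = 139 and 15 + 4 * 121 = 499.\<close>
  also have "\<dots> \<le> 139 * a + 499 * b"
  proof -
    have "\<sigma> * real s * \<kappa> \<le> a" using \<sigma> k L by (simp add: a_def algebra_simps)
    moreover have "\<sigma> * real s * sqrt L \<le> b" using \<sigma> k L by (simp add: b_def algebra_simps)
    moreover have "18 * a + 3 * (\<sigma> * (5 * (real s * sqrt L))) + 121 * \<sigma> * real s * (\<kappa> + 4 * (k + 1) * sqrt L)
      = 18 * a + 15 * (\<sigma> * real s * sqrt L) + 121 * (\<sigma> * real s * \<kappa>) + 484 * b"
      by (simp add: b_def algebra_simps)
    ultimately show ?thesis by linarith
  qed
  also have "\<dots> < 500 * (a + b)"
  proof -
    have "0 \<le> a" "0 < b" using \<sigma> k L \<kappa> s by (simp_all add: a_def b_def)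
    then show ?thesis by simp
  qed
  also have "a + b = psi_tilde m n \<alpha> \<sigma> s \<kappa>"
    by (simp add: psi_tilde_def a_def b_def k_def L_def L\<^sub>1_def)
  finally show ?thesis .
qed

lemma constrained_risk_le:
  assumes \<phi>: "constrained_filter m n \<rho> \<phi>hat" and \<rho>: "4 * real s \<le> \<rho>"
  shows "risk (m + n) \<sigma> (window n) \<alpha> (filter_estimate \<phi>hat) (signal_class m n s \<kappa> \<sigma>)
    \<le> ereal (32 * psi m n \<alpha> \<sigma> s \<kappa> \<rho>)"
proof (rule risk_le)
  fix x assume x: "x \<in> signal_class m n s \<kappa> \<sigma>"
  let ?y = "observe (m + n) \<sigma> x"
  obtain \<phi>\<^sub>0 where \<phi>\<^sub>0: "\<phi>\<^sub>0 \<in> filters m" "scaled_norm m \<phi>\<^sub>0 \<le> 4 * real s"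
    and ev: "whp (noise (m + n)) \<alpha> (\<lambda>\<zeta>. oracle_bound m n s \<kappa> \<sigma> \<alpha> x \<phi>\<^sub>0 (?y \<zeta>))"
    using oracle_inequality[OF x s m \<kappa> \<sigma> \<alpha>] by blast
  from ev show "whp (noise (m + n)) \<alpha>
      (\<lambda>\<zeta>. L2_set (\<lambda>t. cmod (filter_estimate \<phi>hat (?y \<zeta>) t - x t)) (window n) < 32 * psi m n \<alpha> \<sigma> s \<kappa> \<rho>)"
  proof (rule whp_mono)
    fix \<zeta>
    let ?\<phi> = "\<phi>hat (?y \<zeta>)"
    have "?y \<zeta> \<in> observations (m + n)" by (simp add: observe_def observations_def)
    then have min: "is_arg_min (fit_error n (?y \<zeta>))
        (\<lambda>\<phi>. \<phi> \<in> filters m \<and> dft_norm1 m \<phi> \<le> \<rho> / sqrt (2 * real m + 1)) ?\<phi>"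
      using \<phi> by (simp add: constrained_filter_def fit_error_def[abs_def])
    then have f: "?\<phi> \<in> filters m" and R: "scaled_norm m ?\<phi> \<le> \<rho>"
      by (auto simp: is_arg_min_def scaled_norm_def field_simps)
    \<comment> \<open>Feasibility of the oracle, which is what the threshold 4 s is for.\<close>
    have "dft_norm1 m \<phi>\<^sub>0 \<le> \<rho> / sqrt (2 * real m + 1)" using \<phi>\<^sub>0(2) \<rho> by (simp add: scaled_norm_def field_simps)
    then have le: "fit_error n (?y \<zeta>) ?\<phi> + 0 \<le> fit_error n (?y \<zeta>) \<phi>\<^sub>0"
      using min \<phi>\<^sub>0(1) unfolding is_arg_min_def by (auto simp: not_less)
    assume "oracle_bound m n s \<kappa> \<sigma> \<alpha> x \<phi>\<^sub>0 (?y \<zeta>)"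
    then obtain r\<^sub>0 where r0: "0 \<le> r\<^sub>0" "r\<^sub>0 \<le> 18 * (\<sigma> * real s * (kappa_mn m n * sqrt (ln (1 / \<alpha>)) + \<kappa>))"
      and bd: "(estimation_error n x (?y \<zeta>) ?\<phi>)\<^sup>2 + 0 \<le> r\<^sub>0\<^sup>2 + 2 * \<sigma> *
        (sqrt (20 * real s * ln (1 / \<alpha>)) * (r\<^sub>0 + estimation_error n x (?y \<zeta>) ?\<phi>) +
          2 * (sqrt (20 * ln (1 / \<alpha>)) * (\<kappa> * \<sigma>)) + (scaled_norm m \<phi>\<^sub>0 + scaled_norm m ?\<phi>) *
          (sqrt (20 * ln (1 / \<alpha>)) * (\<kappa> * \<sigma>) + \<sigma> * (116 * (((kappa_mn m n)\<^sup>2 + 1) * ln ((real m + real n) / \<alpha>)))))"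
      using f le unfolding oracle_bound_def Let_def by blast
    have "estimation_error n x (?y \<zeta>) ?\<phi> < 32 * psi m n \<alpha> \<sigma> s \<kappa> \<rho>"
      by (rule psi_bound[OF \<rho> R \<phi>\<^sub>0(2) r0 bd[unfolded add_0_right]])
    then show "L2_set (\<lambda>t. cmod (filter_estimate \<phi>hat (?y \<zeta>) t - x t)) (window n) < 32 * psi m n \<alpha> \<sigma> s \<kappa> \<rho>"
      by (simp add: estimation_error_def filter_estimate_def)
  qed simp
qed

lemma penalized_risk_le:
  assumes \<phi>: "penalized_filter m n \<sigma> (sqrt (Q1 m n \<alpha> \<kappa>)) \<phi>hat"
  shows "risk (m + n) \<sigma> (window n) \<alpha> (filter_estimate \<phi>hat) (signal_class m n s \<kappa> \<sigma>)
    \<le> ereal (500 * psi_tilde m n \<alpha> \<sigma> s \<kappa>)"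
proof (rule risk_le)
  fix x assume x: "x \<in> signal_class m n s \<kappa> \<sigma>"
  let ?y = "observe (m + n) \<sigma> x"
  let ?Q = "Q1 m n \<alpha> \<kappa>"
  obtain \<phi>\<^sub>0 where \<phi>\<^sub>0: "\<phi>\<^sub>0 \<in> filters m" "scaled_norm m \<phi>\<^sub>0 \<le> 4 * real s"
    and ev: "whp (noise (m + n)) \<alpha> (\<lambda>\<zeta>. oracle_bound m n s \<kappa> \<sigma> \<alpha> x \<phi>\<^sub>0 (?y \<zeta>))"
    using oracle_inequality[OF x s m \<kappa> \<sigma> \<alpha>] by blast
  have Q: "0 \<le> ?Q"
    using log_bounds(2)[OF \<alpha> m] log_bounds(1)[OF \<alpha> m, of n] \<kappa> by (simp add: Q1_def)
  have nonneg: "0 \<le> scaled_norm m \<psi>" for \<psi> by (simp add: scaled_norm_def dft_norm1_nonneg)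
  from ev show "whp (noise (m + n)) \<alpha>
      (\<lambda>\<zeta>. L2_set (\<lambda>t. cmod (filter_estimate \<phi>hat (?y \<zeta>) t - x t)) (window n) < 500 * psi_tilde m n \<alpha> \<sigma> s \<kappa>)"
  proof (rule whp_mono)
    fix \<zeta>
    let ?\<phi> = "\<phi>hat (?y \<zeta>)"
    let ?a = "\<sigma>\<^sup>2 * ?Q * (scaled_norm m ?\<phi>)\<^sup>2 - \<sigma>\<^sup>2 * ?Q * (scaled_norm m \<phi>\<^sub>0)\<^sup>2"
    have pen: "\<sigma>\<^sup>2 * (sqrt ?Q)\<^sup>2 * (2 * real m + 1) * (dft_norm1 m \<psi>)\<^sup>2 = \<sigma>\<^sup>2 * ?Q * (scaled_norm m \<psi>)\<^sup>2" for \<psi>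
      using Q by (simp add: scaled_norm_def power_mult_distrib)
    have "?y \<zeta> \<in> observations (m + n)" by (simp add: observe_def observations_def)
    then have min: "is_arg_min (\<lambda>\<psi>. fit_error n (?y \<zeta>) \<psi> + \<sigma>\<^sup>2 * ?Q * (scaled_norm m \<psi>)\<^sup>2) (\<lambda>\<psi>. \<psi> \<in> filters m) ?\<phi>"
      using \<phi> unfolding penalized_filter_def pen fit_error_def by blast
    then have f: "?\<phi> \<in> filters m" by (simp add: is_arg_min_def)
    have le: "fit_error n (?y \<zeta>) ?\<phi> + ?a \<le> fit_error n (?y \<zeta>) \<phi>\<^sub>0"
      using min \<phi>\<^sub>0(1) unfolding is_arg_min_def by (auto simp: not_less)
    assume "oracle_bound m n s \<kappa> \<sigma> \<alpha> x \<phi>\<^sub>0 (?y \<zeta>)"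
    then obtain r\<^sub>0 where r0: "0 \<le> r\<^sub>0" "r\<^sub>0 \<le> 18 * (\<sigma> * real s * (kappa_mn m n * sqrt (ln (1 / \<alpha>)) + \<kappa>))"
      and bd: "(estimation_error n x (?y \<zeta>) ?\<phi>)\<^sup>2 + ?a \<le> r\<^sub>0\<^sup>2 + 2 * \<sigma> *
        (sqrt (20 * real s * ln (1 / \<alpha>)) * (r\<^sub>0 + estimation_error n x (?y \<zeta>) ?\<phi>) +
          2 * (sqrt (20 * ln (1 / \<alpha>)) * (\<kappa> * \<sigma>)) + (scaled_norm m \<phi>\<^sub>0 + scaled_norm m ?\<phi>) *
          (sqrt (20 * ln (1 / \<alpha>)) * (\<kappa> * \<sigma>) + \<sigma> * (116 * (((kappa_mn m n)\<^sup>2 + 1) * ln ((real m + real n) / \<alpha>)))))"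
      using f le unfolding oracle_bound_def Let_def by blast
    have "estimation_error n x (?y \<zeta>) ?\<phi> < 500 * psi_tilde m n \<alpha> \<sigma> s \<kappa>"
      by (rule psi_tilde_bound[OF nonneg nonneg \<phi>\<^sub>0(2) r0 bd])
    then show "L2_set (\<lambda>t. cmod (filter_estimate \<phi>hat (?y \<zeta>) t - x t)) (window n) < 500 * psi_tilde m n \<alpha> \<sigma> s \<kappa>"
      by (simp add: estimation_error_def filter_estimate_def)
  qed simp
qed

end


theorem proposition4p2:
  shows
    "(\<exists>C::real. C > 0 \<and>
        (\<forall>(s::nat) (m::nat) (n::nat) (\<kappa>::real) (\<sigma>::real) (\<rho>::real) (\<phi>hat::signal \<Rightarrow> signal) (\<alpha>::real).
           1 \<le> s \<and> 2 * s - 1 \<le> m \<and> 0 \<le> \<kappa> \<and> 0 < \<sigma> \<and> 4 * real s \<le> \<rho> \<and>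
           constrained_filter m n \<rho> \<phi>hat \<and> 0 < \<alpha> \<and> \<alpha> \<le> 1 / 2 \<longrightarrow>
           risk (m + n) \<sigma> (window n) \<alpha> (filter_estimate \<phi>hat) (signal_class m n s \<kappa> \<sigma>)
             \<le> ereal (C * psi m n \<alpha> \<sigma> s \<kappa> \<rho>))) \<and>
     (\<forall>C'::real. C' \<ge> 4 \<longrightarrow> (\<exists>C::real. C > 0 \<and>
        (\<forall>(s::nat) (m::nat) (n::nat) (\<kappa>::real) (\<sigma>::real) (\<rho>::real) (\<phi>hat::signal \<Rightarrow> signal) (\<alpha>::real).
           1 \<le> s \<and> 2 * s - 1 \<le> m \<and> 0 \<le> \<kappa> \<and> 0 < \<sigma> \<and> 4 * real s \<le> \<rho> \<and> \<rho> \<le> C' * real s \<and>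
           constrained_filter m n \<rho> \<phi>hat \<and> 0 < \<alpha> \<and> \<alpha> \<le> 1 / 2 \<longrightarrow>
           risk (m + n) \<sigma> (window n) \<alpha> (filter_estimate \<phi>hat) (signal_class m n s \<kappa> \<sigma>)
             \<le> ereal (C * psi_bar m n \<alpha> \<sigma> s \<kappa>)))) \<and>
     (\<exists>C::real. C > 0 \<and>
        (\<forall>(s::nat) (m::nat) (n::nat) (\<kappa>::real) (\<sigma>::real) (\<phi>hat::signal \<Rightarrow> signal) (\<alpha>::real).
           1 \<le> s \<and> 2 * s - 1 \<le> m \<and> 0 \<le> \<kappa> \<and> 0 < \<sigma> \<and> 0 < \<alpha> \<and> \<alpha> \<le> 1 / 2 \<and>
           penalized_filter m n \<sigma> (sqrt (Q1 m n \<alpha> \<kappa>)) \<phi>hat \<longrightarrow>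
           risk (m + n) \<sigma> (window n) \<alpha> (filter_estimate \<phi>hat) (signal_class m n s \<kappa> \<sigma>)
             \<le> ereal (C * psi_tilde m n \<alpha> \<sigma> s \<kappa>)))"
proof (intro conjI allI impI)
  show "\<exists>C::real. C > 0 \<and>
        (\<forall>(s::nat) (m::nat) (n::nat) (\<kappa>::real) (\<sigma>::real) (\<rho>::real) (\<phi>hat::signal \<Rightarrow> signal) (\<alpha>::real).
           1 \<le> s \<and> 2 * s - 1 \<le> m \<and> 0 \<le> \<kappa> \<and> 0 < \<sigma> \<and> 4 * real s \<le> \<rho> \<and>
           constrained_filter m n \<rho> \<phi>hat \<and> 0 < \<alpha> \<and> \<alpha> \<le> 1 / 2 \<longrightarrow>
           risk (m + n) \<sigma> (window n) \<alpha> (filter_estimate \<phi>hat) (signal_class m n s \<kappa> \<sigma>)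
             \<le> ereal (C * psi m n \<alpha> \<sigma> s \<kappa> \<rho>))"
    by (rule exI[of _ 32], intro conjI allI impI) (simp, rule constrained_risk_le, auto)
next
  fix C' :: real assume C': "C' \<ge> 4"
  show "\<exists>C::real. C > 0 \<and>
        (\<forall>(s::nat) (m::nat) (n::nat) (\<kappa>::real) (\<sigma>::real) (\<rho>::real) (\<phi>hat::signal \<Rightarrow> signal) (\<alpha>::real).
           1 \<le> s \<and> 2 * s - 1 \<le> m \<and> 0 \<le> \<kappa> \<and> 0 < \<sigma> \<and> 4 * real s \<le> \<rho> \<and> \<rho> \<le> C' * real s \<and>
           constrained_filter m n \<rho> \<phi>hat \<and> 0 < \<alpha> \<and> \<alpha> \<le> 1 / 2 \<longrightarrow>
           risk (m + n) \<sigma> (window n) \<alpha> (filter_estimate \<phi>hat) (signal_class m n s \<kappa> \<sigma>)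
             \<le> ereal (C * psi_bar m n \<alpha> \<sigma> s \<kappa>))"
  \<comment> \<open>32 comes from the general bound, C' from passing from \<open>psi\<close> to
    \<open>psi_bar\<close>.\<close>
  proof (rule exI[of _ "32 * C'"], intro conjI allI impI)
    fix s m n :: nat and \<kappa> \<sigma> \<rho> \<alpha> :: real and \<phi>hat :: "signal \<Rightarrow> signal"
    assume a: "1 \<le> s \<and> 2 * s - 1 \<le> m \<and> 0 \<le> \<kappa> \<and> 0 < \<sigma> \<and> 4 * real s \<le> \<rho> \<and> \<rho> \<le> C' * real s \<and>
           constrained_filter m n \<rho> \<phi>hat \<and> 0 < \<alpha> \<and> \<alpha> \<le> 1 / 2"
    then have m: "1 \<le> m" by linarith
    have "risk (m + n) \<sigma> (window n) \<alpha> (filter_estimate \<phi>hat) (signal_class m n s \<kappa> \<sigma>) \<le> ereal (32 * psi m n \<alpha> \<sigma> s \<kappa> \<rho>)"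
      by (rule constrained_risk_le) (use a m in auto)
    also have "\<dots> \<le> ereal (32 * (C' * psi_bar m n \<alpha> \<sigma> s \<kappa>))"
      using psi_le_psi_bar[of s m \<kappa> \<sigma> \<alpha> \<rho> C' n] a m C' by simp
    finally show "risk (m + n) \<sigma> (window n) \<alpha> (filter_estimate \<phi>hat) (signal_class m n s \<kappa> \<sigma>)
        \<le> ereal (32 * C' * psi_bar m n \<alpha> \<sigma> s \<kappa>)" by (simp add: mult.assoc)
  qed (use C' in simp)
next
  show "\<exists>C::real. C > 0 \<and>
        (\<forall>(s::nat) (m::nat) (n::nat) (\<kappa>::real) (\<sigma>::real) (\<phi>hat::signal \<Rightarrow> signal) (\<alpha>::real).
           1 \<le> s \<and> 2 * s - 1 \<le> m \<and> 0 \<le> \<kappa> \<and> 0 < \<sigma> \<and> 0 < \<alpha> \<and> \<alpha> \<le> 1 / 2 \<and>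
           penalized_filter m n \<sigma> (sqrt (Q1 m n \<alpha> \<kappa>)) \<phi>hat \<longrightarrow>
           risk (m + n) \<sigma> (window n) \<alpha> (filter_estimate \<phi>hat) (signal_class m n s \<kappa> \<sigma>)
             \<le> ereal (C * psi_tilde m n \<alpha> \<sigma> s \<kappa>))"
    by (rule exI[of _ 500], intro conjI allI impI) (simp, rule penalized_risk_le, auto)
qed

end
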